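(* Let $A\in\mathbb{R}^{m\times n}$, let $\phi$ be the Huber loss on $\mathbb{R}^m$ (see context), and set $f(x,\theta):=\phi(Ax-\theta)$ for $(x,\theta)\in\mathbb{R}^n\times\mathbb{R}^m$. Then the regularity assumption, the definability assumption, and the uniform range condition of the context hold for $f$ with $\Theta=O=\mathbb{R}^m$, any $\bar\varepsilon>0$, and $$J_F(x,\theta):=\{(A^{\mathsf T}QA\ \ {-A^{\mathsf T}Q}):Q\in\partial(\nabla\phi)(Ax-\theta)\};$$ the range factors $W_\varepsilon=-(\sqrt{Q_\varepsilon}A)^\dagger\sqrt{Q_\varepsilon}$, $Q_\varepsilon\in\partial(\nabla\phi)(Ax^\star_\varepsilon(\theta)-\theta)$, satisfy the global bound $\|W_\varepsilon\|\le\chi(A)$. Consequently, the minimal-norm solution map $x^\star_{\min}:\mathbb{R}^m\to\mathbb{R}^n$ is path-differentiable, and $J_{x^\star_{\min}}$ (see context) is a definable conservative Jacobian of it.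
   Context: Definability is relative to a fixed o-minimal structure expanding the real field; a (set-valued) map is definable if its graph is. $\|\cdot\|$ is the Euclidean/operator norm, $\dagger$ the Moore–Penrose pseudoinverse, $\partial$ the Clarke Jacobian. Huber loss: $\phi(y)=\sum_{i=1}^mh(y_i)$, $h(t)=t^2/2$ if $|t|\le1$, $h(t)=|t|-1/2$ if $|t|>1$. Then $\partial(\nabla\phi)(y)$ consists of the matrices $\operatorname{diag}(q)$ with $q_i=1$ if $|y_i|<1$, $q_i\in[0,1]$ if $|y_i|=1$, $q_i=0$ if $|y_i|>1$. $\chi(A):=\max\{\|(A_{R,C})^{-1}\|:R\subset\{1,\dots,m\},\,C\subset\{1,\dots,n\},\,|R|=|C|\ge1,\ A_{R,C}\text{ nonsingular}\}$, with $\chi(A)=0$ if $A=0$. Conservative Jacobian: for $U\subset\mathbb{R}^d$ open and $G:U\to\mathbb{R}^q$ locally Lipschitz, $J_G:U\rightrightarrows\mathbb{R}^{q\times d}$ is a conservative Jacobian of $G$ on $U$ if it is nonempty-valued, locally bounded, has closed graph, and for every absolutely continuous curve $\mu:[0,1]\to U$ and almost every $t$, $\frac{d}{dt}G(\mu(t))=V\dot\mu(t)$ for all $V\in J_G(\mu(t))$. $G$ is path-differentiable if it has a conservative Jacobian. Regularity assumption: for every $\theta\in\Theta$, $f(\cdot,\theta)$ is $\mathcal{C}^{1,1}(\mathbb{R}^n)$ (differentiable with Lipschitz gradient), convex, and $\mathcal{S}(\theta):=\operatorname{argmin}_xf(x,\theta)\ne\emptyset$; and $F:=\nabla_xf$ is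 locally Lipschitz jointly in $(x,\theta)$. Definability assumption: $f$ and $\Theta$ are definable. $x^\star_{\min}(\theta)$ is the minimal Euclidean norm element of $\mathcal{S}(\theta)$; for $\varepsilon>0$, $x^\star_\varepsilon(\theta)$ is the unique minimizer of $x\mapsto f(x,\theta)+\frac{\varepsilon}{2}\|x\|_2^2$. Uniform range condition: $J_F$ is a definable conservative Jacobian of $F$, and for every compact $K\subset O$ there exists $C_K>0$ such that, for every $\theta\in K$, $0<\varepsilon\le\bar\varepsilon$ and $(H_\varepsilon\ M_\varepsilon)\in J_F(x^\star_\varepsilon(\theta),\theta)$ (with $H_\varepsilon\in\mathbb{R}^{n\times n}$, $M_\varepsilon\in\mathbb{R}^{n\times m}$), the block $H_\varepsilon$ is symmetric positive semidefinite and $M_\varepsilon=H_\varepsilon W_\varepsilon$ for some $W_\varepsilon\in\mathbb{R}^{n\times m}$ with $\|W_\varepsilon\|\le C_K$. For $0<\varepsilon\le\bar\varepsilon$: $J_{x^\star_\varepsilon}(\theta):=\{-(H_\varepsilon+\varepsilon I_n)^{-1}M_\varepsilon:(H_\varepsilon\ M_\varepsilon)\in J_F(x^\star_\varepsilon(\theta),\theta)\}$. $J_{x^\star_{\min}}(\theta)$ is the set of $V\in\mathbb{R}^{n\times m}$ for which there exist $\theta_k\in O$, $\theta_k\to\theta$, $\varepsilon_k\downarrow0$ ($0<\varepsilon_k\le\bar\varepsilon$), $V_k\to V$ with $V_k\in J_{x^\star_{\varepsilon_k}}(\theta_k)$ and $x^\star_{\varepsilon_k}(\theta_k)\to x^\star_{\min}(\theta)$.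 *)

theory Defs
  imports "HOL-Analysis.Analysis"
begin

section \<open>O-minimal structures and definability\<close>

text \<open>
  The space of real \<open>n\<close>-tuples is represented by the lists of length \<open>n\<close>, so that a structure is
  a family indexed by the natural numbers. The conditions are those of van den Dries. The clause
  on \<open>S 1\<close> puts every singleton into \<open>S 1\<close>, so definability is definability with parameters.
\<close>

definition tuples :: "nat \<Rightarrow> real list set" where
  "tuples n = {xs. length xs = n}"

definition structure_on_reals :: "(nat \<Rightarrow> real list set set) \<Rightarrow> bool" where
  "structure_on_reals S \<longleftrightarrow>
     (\<forall>n. S n \<subseteq> Pow (tuples n) \<and> {} \<in> S n
        \<and> (\<forall>X\<in>S n. \<forall>Y\<in>S n. X \<union> Y \<in> S n) \<and> (\<forall>X\<in>S n. tuples n - X \<in> S n)) \<and>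
     (\<forall>n. \<forall>X\<in>S n. {x # xs |x xs. xs \<in> X} \<in> S (Suc n) \<and> {xs @ [x] |x xs. xs \<in> X} \<in> S (Suc n)) \<and>
     (\<forall>n\<ge>1. {xs \<in> tuples n. hd xs = last xs} \<in> S n) \<and>
     (\<forall>n. \<forall>X\<in>S (Suc n). butlast ` X \<in> S n)"

definition o_minimal_expansion_of_real_field :: "(nat \<Rightarrow> real list set set) \<Rightarrow> bool" where
  "o_minimal_expansion_of_real_field S \<longleftrightarrow>
     structure_on_reals S \<and>
     {[x, y] |x y. x < y} \<in> S 2 \<and>
     {[x, y, x + y] |x y. True} \<in> S 3 \<and>
     {[x, y, x * y] |x y. True} \<in> S 3 \<and>
     S 1 = {(\<lambda>x. [x]) ` (\<Union>I) |I. finite I \<and> (\<forall>i\<in>I. is_interval i)}"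

text \<open>
  Coordinates are taken with respect to the standard basis. A structure is closed under
  permutation of coordinates, so the choice of the enumeration \<open>bs\<close> does not matter.
\<close>

definition definable :: "(nat \<Rightarrow> real list set set) \<Rightarrow> 'a::euclidean_space set \<Rightarrow> bool" where
  "definable S X \<longleftrightarrow>
     (\<forall>bs. distinct bs \<and> set bs = (Basis :: 'a set) \<longrightarrow>
        (\<lambda>x. map (\<lambda>b. x \<bullet> b) bs) ` X \<in> S DIM('a))"

definition graph_on :: "'a set \<Rightarrow> ('a \<Rightarrow> 'b) \<Rightarrow> ('a \<times> 'b) set" where
  "graph_on U g = {(x, g x) |x. x \<in> U}"

definition multi_graph_on :: "'a set \<Rightarrow> ('a \<Rightarrow> 'b set) \<Rightarrow> ('a \<times> 'b) set" where
  "multi_graph_on U J = {(x, v). x \<in> U \<and> v \<in> J x}"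


section \<open>Matrices\<close>

text \<open>
  Since \<open>norm\<close> on \<open>real^'n^'m\<close> is the Frobenius norm, the operator norm is introduced separately.
\<close>

definition op_norm :: "real^'n^'m \<Rightarrow> real" where
  "op_norm B = onorm (\<lambda>x. B *v x)"

definition sym_psd :: "real^'n^'n \<Rightarrow> bool" where
  "sym_psd H \<longleftrightarrow> transpose H = H \<and> (\<forall>v. 0 \<le> v \<bullet> (H *v v))"

definition psd_sqrt :: "real^'n^'n \<Rightarrow> real^'n^'n" where
  "psd_sqrt Q = (THE R. sym_psd R \<and> R ** R = Q)"

definition pseudoinverse :: "real^'n^'m \<Rightarrow> real^'m^'n" where
  "pseudoinverse B = (THE X. B ** X ** B = B \<and> X ** B ** X = X \<and>
      transpose (B ** X) = B ** X \<and> transpose (X ** B) = X ** B)"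

definition join_vec :: "real^'n \<Rightarrow> real^'m \<Rightarrow> real^('n::finite + 'm::finite)" where
  "join_vec x y = (\<chi> k. case k of Inl i \<Rightarrow> x $ i | Inr j \<Rightarrow> y $ j)"

definition left_vec :: "real^('n::finite + 'm::finite) \<Rightarrow> real^'n" where
  "left_vec z = (\<chi> i. z $ Inl i)"

definition right_vec :: "real^('n::finite + 'm::finite) \<Rightarrow> real^'m" where
  "right_vec z = (\<chi> j. z $ Inr j)"

definition hcat :: "real^'n^'q \<Rightarrow> real^'m^'q \<Rightarrow> real^('n::finite + 'm::finite)^'q" where
  "hcat H M = (\<chi> i. join_vec (H $ i) (M $ i))"

text \<open>
  A matrix with rows in \<open>R\<close> and columns in \<open>C\<close> is represented by its extension by zero, which has
  the same operator norm. In particular \<open>partial_id R\<close> represents the identity matrix with rows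
  and columns in \<open>R\<close>, and \<open>submatrix_inverse A R C B\<close> states that \<open>B\<close> represents the two-sided
  inverse of the submatrix of \<open>A\<close> given by \<open>R\<close> and \<open>C\<close>.
\<close>

definition submatrix_of :: "real^'n^'m \<Rightarrow> 'm set \<Rightarrow> 'n set \<Rightarrow> real^'n^'m" where
  "submatrix_of A R C = (\<chi> i j. if i \<in> R \<and> j \<in> C then A $ i $ j else 0)"

definition partial_id :: "'k set \<Rightarrow> real^'k^'k" where
  "partial_id R = (\<chi> i j. if i = j \<and> i \<in> R then 1 else 0)"

definition submatrix_inverse :: "real^'n^'m \<Rightarrow> 'm set \<Rightarrow> 'n set \<Rightarrow> real^'m^'n \<Rightarrow> bool" where
  "submatrix_inverse A R C B \<longleftrightarrow>
     (\<forall>j i. \<not> (j \<in> C \<and> i \<in> R) \<longrightarrow> B $ j $ i = 0) \<and>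
     submatrix_of A R C ** B = partial_id R \<and> B ** submatrix_of A R C = partial_id C"

definition chi_number :: "real^'n^'m \<Rightarrow> real" where
  "chi_number A =
     (if A = 0 then 0
      else Max {op_norm B |B R C. card R = card C \<and> card R \<ge> 1 \<and> submatrix_inverse A R C B})"


section \<open>Generalized derivatives\<close>

definition gradient :: "('a::euclidean_space \<Rightarrow> real) \<Rightarrow> 'a \<Rightarrow> 'a" where
  "gradient g x = (THE D. GDERIV g x :> D)"

definition locally_lipschitz_on :: "'a::metric_space set \<Rightarrow> ('a \<Rightarrow> 'b::metric_space) \<Rightarrow> bool" where
  "locally_lipschitz_on U G \<longleftrightarrow> (\<forall>x\<in>U. \<exists>r>0. \<exists>L. L-lipschitz_on (U \<inter> ball x r) G)"

definition clarke_jacobian :: "(real^'d \<Rightarrow> real^'q) \<Rightarrow> real^'d \<Rightarrow> (real^'d^'q) set" where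
  "clarke_jacobian G x = convex hull
     {V. \<exists>y. (\<forall>k::nat. G differentiable (at (y k))) \<and> y \<longlonglongrightarrow> x \<and>
           (\<lambda>k. jacobian G (at (y k))) \<longlonglongrightarrow> V}"

definition abs_continuous_on :: "real \<Rightarrow> real \<Rightarrow> (real \<Rightarrow> 'a::real_normed_vector) \<Rightarrow> bool" where
  "abs_continuous_on a b c \<longleftrightarrow>
     (\<forall>e>0. \<exists>d>0. \<forall>I. finite I \<and> (\<forall>(s, t)\<in>I. a \<le> s \<and> s \<le> t \<and> t \<le> b) \<and>
        pairwise (\<lambda>p q. disjnt {fst p<..<snd p} {fst q<..<snd q}) I \<and>
        (\<Sum>(s, t)\<in>I. t - s) < d \<longrightarrow> (\<Sum>(s, t)\<in>I. norm (c t - c s)) < e)"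

definition conservative_jacobian ::
    "(real^'d) set \<Rightarrow> (real^'d \<Rightarrow> real^'q) \<Rightarrow> (real^'d \<Rightarrow> (real^'d^'q) set) \<Rightarrow> bool" where
  "conservative_jacobian U G J \<longleftrightarrow>
     open U \<and> locally_lipschitz_on U G \<and>
     (\<forall>x\<in>U. J x \<noteq> {}) \<and>
     (\<forall>x\<in>U. \<exists>r>0. bounded (\<Union>y\<in>U \<inter> ball x r. J y)) \<and>
     closedin (top_of_set (U \<times> UNIV)) (multi_graph_on U J) \<and>
     (\<forall>c. abs_continuous_on 0 1 c \<and> c ` {0..1} \<subseteq> U \<longrightarrow>
        (AE t in lebesgue_on {0..1}.
           \<exists>v. (c has_vector_derivative v) (at t within {0..1}) \<and>
             (\<forall>V\<in>J (c t). ((\<lambda>s. G (c s)) has_vector_derivative V *v v) (at t within {0..1}))))"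

definition path_differentiable_on :: "(real^'d) set \<Rightarrow> (real^'d \<Rightarrow> real^'q) \<Rightarrow> bool" where
  "path_differentiable_on U G \<longleftrightarrow> (\<exists>J. conservative_jacobian U G J)"

definition definable_conservative_jacobian ::
    "(nat \<Rightarrow> real list set set) \<Rightarrow> (real^'d) set \<Rightarrow> (real^'d \<Rightarrow> real^'q) \<Rightarrow>
      (real^'d \<Rightarrow> (real^'d^'q) set) \<Rightarrow> bool" where
  "definable_conservative_jacobian S U G J \<longleftrightarrow>
     conservative_jacobian U G J \<and> definable S (multi_graph_on U J)"


section \<open>Parametric convex minimization\<close>

definition argmin_set :: "('a \<Rightarrow> real) \<Rightarrow> 'a set" where
  "argmin_set g = {x. is_arg_min g (\<lambda>_. True) x}"

definition partial_gradient :: "(real^'n \<Rightarrow> real^'m \<Rightarrow> real) \<Rightarrow> real^('n::finite + 'm::finite) \<Rightarrow> real^'n" where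
  "partial_gradient f z = gradient (\<lambda>x. f x (right_vec z)) (left_vec z)"

definition x_min :: "(real^'n \<Rightarrow> real^'m \<Rightarrow> real) \<Rightarrow> real^'m \<Rightarrow> real^'n" where
  "x_min f \<theta> = (THE x. is_arg_min norm (\<lambda>x. x \<in> argmin_set (\<lambda>x. f x \<theta>)) x)"

definition x_reg :: "(real^'n \<Rightarrow> real^'m \<Rightarrow> real) \<Rightarrow> real \<Rightarrow> real^'m \<Rightarrow> real^'n" where
  "x_reg f \<epsilon> \<theta> = (THE x. x \<in> argmin_set (\<lambda>x. f x \<theta> + \<epsilon> / 2 * (norm x)\<^sup>2))"

definition regularity_assumption :: "(real^'n \<Rightarrow> real^'m \<Rightarrow> real) \<Rightarrow> (real^'m) set \<Rightarrow> bool" where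
  "regularity_assumption f \<Theta> \<longleftrightarrow>
     (\<forall>\<theta>\<in>\<Theta>. (\<forall>x. (\<lambda>x. f x \<theta>) differentiable (at x)) \<and>
        (\<exists>L. L-lipschitz_on UNIV (gradient (\<lambda>x. f x \<theta>))) \<and>
        convex_on UNIV (\<lambda>x. f x \<theta>) \<and>
        argmin_set (\<lambda>x. f x \<theta>) \<noteq> {}) \<and>
     locally_lipschitz_on {z. right_vec z \<in> \<Theta>} (partial_gradient f)"

definition definability_assumption ::
    "(nat \<Rightarrow> real list set set) \<Rightarrow> (real^'n \<Rightarrow> real^'m \<Rightarrow> real) \<Rightarrow> (real^'m) set \<Rightarrow> bool" where
  "definability_assumption S f \<Theta> \<longleftrightarrow>
     definable S (graph_on (UNIV \<times> \<Theta>) (\<lambda>(x, \<theta>). f x \<theta>)) \<and> definable S \<Theta>"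

definition uniform_range_condition ::
    "(nat \<Rightarrow> real list set set) \<Rightarrow> (real^'n \<Rightarrow> real^'m \<Rightarrow> real) \<Rightarrow> (real^'m) set \<Rightarrow> real \<Rightarrow>
      (real^('n::finite + 'm::finite) \<Rightarrow> (real^('n::finite + 'm::finite)^'n) set) \<Rightarrow> bool" where
  "uniform_range_condition S f U \<epsilon>max JF \<longleftrightarrow>
     definable_conservative_jacobian S {z. right_vec z \<in> U} (partial_gradient f) JF \<and>
     (\<forall>K. compact K \<and> K \<subseteq> U \<longrightarrow>
        (\<exists>c>0. \<forall>\<theta>\<in>K. \<forall>\<epsilon> H M. 0 < \<epsilon> \<and> \<epsilon> \<le> \<epsilon>max \<and>
           hcat H M \<in> JF (join_vec (x_reg f \<epsilon> \<theta>) \<theta>) \<longrightarrow>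
           sym_psd H \<and> (\<exists>W. M = H ** W \<and> op_norm W \<le> c)))"

definition J_reg ::
    "(real^'n \<Rightarrow> real^'m \<Rightarrow> real) \<Rightarrow> (real^('n::finite + 'm::finite) \<Rightarrow> (real^('n::finite + 'm::finite)^'n) set) \<Rightarrow>
      real \<Rightarrow> real^'m \<Rightarrow> (real^'m^'n) set" where
  "J_reg f JF \<epsilon> \<theta> =
     {- (matrix_inv (H + \<epsilon> *\<^sub>R mat 1) ** M) |H M. hcat H M \<in> JF (join_vec (x_reg f \<epsilon> \<theta>) \<theta>)}"

definition J_min ::
    "(real^'n \<Rightarrow> real^'m \<Rightarrow> real) \<Rightarrow> (real^'m) set \<Rightarrow> real \<Rightarrow>
      (real^('n::finite + 'm::finite) \<Rightarrow> (real^('n::finite + 'm::finite)^'n) set) \<Rightarrow> real^'m \<Rightarrow> (real^'m^'n) set" where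
  "J_min f U \<epsilon>max JF \<theta> =
     {V. \<exists>\<theta>s \<epsilon>s Vs.
        (\<forall>k::nat. \<theta>s k \<in> U) \<and> \<theta>s \<longlonglongrightarrow> \<theta> \<and>
        (\<forall>k. 0 < \<epsilon>s k \<and> \<epsilon>s k \<le> \<epsilon>max) \<and> decseq \<epsilon>s \<and> \<epsilon>s \<longlonglongrightarrow> 0 \<and>
        (\<forall>k. Vs k \<in> J_reg f JF (\<epsilon>s k) (\<theta>s k)) \<and> Vs \<longlonglongrightarrow> V \<and>
        (\<lambda>k. x_reg f (\<epsilon>s k) (\<theta>s k)) \<longlonglongrightarrow> x_min f \<theta>}"


section \<open>Huber regression\<close>

definition huber :: "real \<Rightarrow> real" where
  "huber t = (if \<bar>t\<bar> \<le> 1 then t\<^sup>2 / 2 else \<bar>t\<bar> - 1 / 2)"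

definition huber_loss :: "real^'m \<Rightarrow> real" where
  "huber_loss y = (\<Sum>i\<in>UNIV. huber (y $ i))"

definition huber_hessians :: "real^'m \<Rightarrow> (real^'m^'m) set" where
  "huber_hessians y = clarke_jacobian (gradient huber_loss) y"

definition huber_objective :: "real^'n^'m \<Rightarrow> real^'n \<Rightarrow> real^'m \<Rightarrow> real" where
  "huber_objective A x \<theta> = huber_loss (A *v x - \<theta>)"

definition huber_JF :: "real^'n^'m \<Rightarrow> real^('n::finite + 'm::finite) \<Rightarrow> (real^('n::finite + 'm::finite)^'n) set" where
  "huber_JF A z =
     {hcat (transpose A ** Q ** A) (- (transpose A ** Q)) |Q.
        Q \<in> huber_hessians (A *v left_vec z - right_vec z)}"

definition huber_range_factor :: "real^'n^'m \<Rightarrow> real^'m^'m \<Rightarrow> real^'m^'n" where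
  "huber_range_factor A Q = - (pseudoinverse (psd_sqrt Q ** A) ** psd_sqrt Q)"

end

theory Submission
  imports Defs
begin

text \<open>
  Write \<open>Q = diag(q)\<close> with \<open>q \<ge> 0\<close>. A solution of the weighted least squares problem
  \<open>A\<^sup>T Q (A u - v) = 0\<close> can be chosen with norm at most \<open>\<chi>(A) \<bar>v\<bar>\<close>, because it lies in a polytope whose
  vertices solve invertible square subsystems of \<open>A u = v\<close>. This bounds the range factors. Since the
  difference of two values of the gradient of the Huber loss is \<open>Q\<close> times the difference of the
  arguments for some such \<open>Q\<close>, it also makes all regularized solution maps, and hence \<open>x\<^sub>m\<^sub>i\<^sub>n\<close>,
  Lipschitz with constant \<open>\<chi>(A)\<close>.

  The limiting Jacobian is shown to be conservative without general facts on o-minimal structures. Along a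
  sequence of regularized solutions whose residuals have a fixed pattern, the limit points
  \<open>(\<theta>, x\<^sub>m\<^sub>i\<^sub>n \<theta>)\<close> lie in an affine space, and every limit of Jacobians agrees with this space on its
  directions. For a curve, at almost every time the patterns that occur do so at an accumulating
  set of times, so the derivative of \<open>(\<theta>, x\<^sub>m\<^sub>i\<^sub>n \<theta>)\<close> is such a direction.
  Here absolutely continuous curves are differentiable almost everywhere by a Vitali covering
  argument, and definability follows by writing the graphs as first-order formulas.
\<close>

section \<open>Absolutely continuous functions are differentiable almost everywhere\<close>

text \<open>Strong convexity alone gives Lipschitz constants for the regularized solutions that grow
  like \<open>1/\<epsilon>\<close>, and the weighted problems degenerate when weights tend to 0. The
  number \<open>chi_number A\<close> depends on neither \<open>\<epsilon>\<close> nor the weights,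
  so this single bound supplies the compactness behind the existence of minimizers, their limits,
  and the boundedness and nonemptiness of the limiting Jacobian. At residual coordinates equal to 1
  or -1 the weights are arbitrary and may change along a sequence, so the limit point does not
  determine a limit of Jacobians. It is pinned down only on directions that keep those residuals
  constant. \<open>J_min\<close> speaks of sequences, over which a first-order formula cannot
  quantify. Regularized solutions converge to \<open>x_min\<close> jointly in
  \<open>\<epsilon>\<close> and \<open>\<theta>\<close>, so the convergence demanded in
  \<open>J_min\<close> is automatic and membership becomes an approximation property whose
  quantifiers range over vectors and matrices only. Both closedness of the graph and definability
  are read off from this form.\<close>

definition interval_family :: "real \<Rightarrow> real \<Rightarrow> (real \<times> real) set \<Rightarrow> bool" where
  "interval_family a b I \<longleftrightarrow> finite I \<and> (\<forall>p\<in>I. a \<le> fst p \<and> fst p \<le> snd p \<and> snd p \<le> b) \<and>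
     pairwise (\<lambda>p q. disjnt {fst p<..<snd p} {fst q<..<snd q}) I"

lemma abs_continuous_on_iff:
  "abs_continuous_on a b c \<longleftrightarrow> (\<forall>e>0. \<exists>d>0. \<forall>I. interval_family a b I \<longrightarrow>
      (\<Sum>p\<in>I. snd p - fst p) < d \<longrightarrow> (\<Sum>p\<in>I. norm (c (snd p) - c (fst p))) < e)"
  unfolding abs_continuous_on_def interval_family_def case_prod_beta by (simp add: imp_conjL)

section \<open>Elementary properties of absolute continuity\<close>

lemma abs_continuous_on_lipschitz_compose:
  assumes c: "abs_continuous_on a b c" and f: "\<And>x y. norm (f x - f y) \<le> L * norm (x - y)"
  shows "abs_continuous_on a b (\<lambda>t. f (c t))"
  unfolding abs_continuous_on_iff
proof (intro allI impI)
  fix e :: real assume "0 < e"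
  \<comment> \<open>Enlarging \<open>L\<close> to \<open>\<bar>L\<bar> + 1\<close> keeps the divisor
    positive whatever the sign of \<open>L\<close>.\<close>
  then have "0 < e / (\<bar>L\<bar> + 1)" by simp
  then obtain d where d: "0 < d" and D: "\<And>I. \<lbrakk>interval_family a b I; (\<Sum>p\<in>I. snd p - fst p) < d\<rbrakk> \<Longrightarrow> (\<Sum>p\<in>I. norm (c (snd p) - c (fst p))) < e / (\<bar>L\<bar> + 1)"
    using c unfolding abs_continuous_on_iff by meson
  have f': "norm (f x - f y) \<le> (\<bar>L\<bar> + 1) * norm (x - y)" for x y
    by (rule order_trans[OF f mult_right_mono]) auto
  have "(\<Sum>p\<in>I. norm (f (c (snd p)) - f (c (fst p)))) < e"
    if "interval_family a b I" "(\<Sum>p\<in>I. snd p - fst p) < d" for I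
  proof -
    have "(\<Sum>p\<in>I. norm (f (c (snd p)) - f (c (fst p)))) \<le> (\<Sum>p\<in>I. (\<bar>L\<bar> + 1) * norm (c (snd p) - c (fst p)))"
      by (intro sum_mono f')
    also have "\<dots> < (\<bar>L\<bar> + 1) * (e / (\<bar>L\<bar> + 1))"
      unfolding sum_distrib_left[symmetric] using D[of I] that by (intro mult_strict_left_mono) auto
    finally show ?thesis by (simp add: add_nonneg_eq_0_iff)
  qed
  with d show "\<exists>d>0. \<forall>I. interval_family a b I \<longrightarrow> (\<Sum>p\<in>I. snd p - fst p) < d \<longrightarrow> (\<Sum>p\<in>I. norm (f (c (snd p)) - f (c (fst p)))) < e"
    by blast
qed

lemma abs_continuous_on_diff_linear:
  fixes g :: "real \<Rightarrow> real"
  assumes c: "abs_continuous_on a b g"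
  shows "abs_continuous_on a b (\<lambda>t. g t - m * t)"
  unfolding abs_continuous_on_iff
proof (intro allI impI)
  fix e :: real assume "0 < e"
  then obtain d where d: "0 < d" and D: "\<And>I. \<lbrakk>interval_family a b I; (\<Sum>p\<in>I. snd p - fst p) < d\<rbrakk> \<Longrightarrow> (\<Sum>p\<in>I. norm (g (snd p) - g (fst p))) < e / 2"
    using c unfolding abs_continuous_on_iff by (meson half_gt_zero)
  let ?d = "min d (e / 2 / (\<bar>m\<bar> + 1))"
  have "(\<Sum>p\<in>I. norm ((g (snd p) - m * snd p) - (g (fst p) - m * fst p))) < e"
    if I: "interval_family a b I" "(\<Sum>p\<in>I. snd p - fst p) < ?d" for I
  proof -
    have cancel: "k * (x / k) = x" if "k \<ge> 1" for k x :: real using that by simp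
    have "(\<Sum>p\<in>I. norm ((g (snd p) - m * snd p) - (g (fst p) - m * fst p)))
       \<le> (\<Sum>p\<in>I. norm (g (snd p) - g (fst p)) + (\<bar>m\<bar> + 1) * (snd p - fst p))"
    proof (rule sum_mono)
      fix p assume "p \<in> I"
      then have p: "0 \<le> snd p - fst p" using I by (auto simp: interval_family_def)
      have "norm ((g (snd p) - m * snd p) - (g (fst p) - m * fst p)) \<le> norm (g (snd p) - g (fst p)) + \<bar>m * (snd p - fst p)\<bar>"
        unfolding real_norm_def right_diff_distrib by linarith
      also have "\<bar>m * (snd p - fst p)\<bar> \<le> (\<bar>m\<bar> + 1) * (snd p - fst p)"
        using p by (simp add: abs_mult mult_right_mono)
      finally show "norm ((g (snd p) - m * snd p) - (g (fst p) - m * fst p))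
         \<le> norm (g (snd p) - g (fst p)) + (\<bar>m\<bar> + 1) * (snd p - fst p)" by simp
    qed
    also have "\<dots> = (\<Sum>p\<in>I. norm (g (snd p) - g (fst p))) + (\<bar>m\<bar> + 1) * (\<Sum>p\<in>I. snd p - fst p)"
      by (simp add: sum.distrib sum_distrib_left)
    also have "\<dots> < e / 2 + (\<bar>m\<bar> + 1) * (e / 2 / (\<bar>m\<bar> + 1))"
      using D[of I] I by (intro add_strict_mono mult_strict_left_mono) auto
    also have "\<dots> = e"
      by (subst cancel) auto
    finally show ?thesis .
  qed
  with d \<open>0 < e\<close> show "\<exists>d>0. \<forall>I. interval_family a b I \<longrightarrow> (\<Sum>p\<in>I. snd p - fst p) < d \<longrightarrow> (\<Sum>p\<in>I. norm ((g (snd p) - m * snd p) - (g (fst p) - m * fst p))) < e"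
    by (intro exI[of _ ?d]) auto
qed

lemma abs_continuous_on_imp_continuous_on:
  fixes c :: "real \<Rightarrow> 'a::real_normed_vector"
  assumes c: "abs_continuous_on a b c"
  shows "continuous_on {a..b} c"
  unfolding continuous_on_iff
proof (intro ballI allI impI)
  fix x e :: real assume x: "x \<in> {a..b}" and "0 < e"
  then obtain d where d: "0 < d" and D: "\<And>I. \<lbrakk>interval_family a b I; (\<Sum>p\<in>I. snd p - fst p) < d\<rbrakk> \<Longrightarrow> (\<Sum>p\<in>I. norm (c (snd p) - c (fst p))) < e"
    using c unfolding abs_continuous_on_iff by meson
  have "dist (c y) (c x) < e" if "y \<in> {a..b}" "dist y x < d" for y
    using D[of "{(min x y, max x y)}"] that x
    by (cases "x \<le> y") (auto simp: interval_family_def dist_norm norm_minus_commute min_def max_def)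
  with d show "\<exists>d>0. \<forall>x'\<in>{a..b}. dist x' x < d \<longrightarrow> dist (c x') (c x) < e" by blast
qed

text \<open>Removing one interval \<open>(s, t)\<close> splits the rest of \<open>J\<close> into the
  part left of \<open>s\<close> and the part right of \<open>t\<close>, and induction on the
  cardinality treats both. The telescoping identity is stated for every \<open>h\<close> at once
  because one and the same family of gaps is measured both by increments of a function and by
  lengths.\<close>

lemma interval_gaps:
  fixes a b :: real and J :: "(real \<times> real) set"
  assumes "finite J" "a \<le> b" "\<And>p. p \<in> J \<Longrightarrow> a \<le> fst p \<and> fst p < snd p \<and> snd p \<le> b"
    "pairwise (\<lambda>p q. disjnt {fst p<..<snd p} {fst q<..<snd q}) J"
  shows "\<exists>R. finite R \<and> (\<forall>p\<in>R. a \<le> fst p \<and> fst p < snd p \<and> snd p \<le> b) \<and>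
    pairwise (\<lambda>p q. disjnt {fst p<..<snd p} {fst q<..<snd q}) R \<and>
    (\<forall>h::real\<Rightarrow>real. (\<Sum>p\<in>R. h (snd p) - h (fst p)) = h b - h a - (\<Sum>p\<in>J. h (snd p) - h (fst p)))"
  using assms
proof (induction "card J" arbitrary: J a b rule: less_induct)
  case less
  show ?case
  proof (cases "J = {}")
    case True
    show ?thesis
    proof (cases "a = b")
      case True with \<open>J = {}\<close> show ?thesis by (intro exI[of _ "{}"]) auto
    next
      case False with \<open>J = {}\<close> less.prems show ?thesis by (intro exI[of _ "{(a, b)}"]) auto
    qed
  next
    case False
    then obtain s t where st: "(s, t) \<in> J" by auto
    with less.prems have ast: "a \<le> s" "s < t" "t \<le> b" by force+
    define L where "L = {p \<in> J - {(s, t)}. snd p \<le> s}"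
    define U where "U = {p \<in> J - {(s, t)}. t \<le> fst p}"
    have split: "snd p \<le> s \<or> t \<le> fst p" if "p \<in> J - {(s, t)}" for p
    proof (rule ccontr)
      assume n: "\<not> ?thesis"
      have "disjnt {fst p<..<snd p} {s<..<t}"
        using less.prems(4) st that unfolding pairwise_def by force
      moreover have "max s (fst p) < min t (snd p)"
        using n ast less.prems(3)[of p] that by auto
      then obtain z where "max s (fst p) < z" "z < min t (snd p)" using dense by blast
      ultimately show False by (auto simp: disjnt_def)
    qed
    have J: "J = insert (s, t) (L \<union> U)" using split st by (auto simp: L_def U_def)
    have fin: "finite L" "finite U" using less.prems by (auto simp: L_def U_def)
    have LU: "L \<inter> U = {}"
      unfolding L_def U_def using ast less.prems(3) by fastforce
    have nst: "(s, t) \<notin> L \<union> U" by (auto simp: L_def U_def)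
    have cL: "card L < card J" "card U < card J"
      by (rule psubset_card_mono; use less.prems st in \<open>auto simp: L_def U_def\<close>)+
    have pw: "pairwise (\<lambda>p q. disjnt {fst p<..<snd p} {fst q<..<snd q}) L"
      "pairwise (\<lambda>p q. disjnt {fst p<..<snd p} {fst q<..<snd q}) U"
      by (rule pairwise_subset[OF less.prems(4)]; auto simp: L_def U_def)+
    have "\<exists>R. finite R \<and> (\<forall>p\<in>R. a \<le> fst p \<and> fst p < snd p \<and> snd p \<le> s) \<and>
      pairwise (\<lambda>p q. disjnt {fst p<..<snd p} {fst q<..<snd q}) R \<and>
      (\<forall>h::real\<Rightarrow>real. (\<Sum>p\<in>R. h (snd p) - h (fst p)) = h s - h a - (\<Sum>p\<in>L. h (snd p) - h (fst p)))"
      by (rule less.hyps[OF cL(1)]) (use fin ast less.prems pw in \<open>auto simp: L_def\<close>)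
    then obtain R1 where R1: "finite R1" "\<And>p. p \<in> R1 \<Longrightarrow> a \<le> fst p \<and> fst p < snd p \<and> snd p \<le> s"
      "pairwise (\<lambda>p q. disjnt {fst p<..<snd p} {fst q<..<snd q}) R1"
      "\<And>h::real\<Rightarrow>real. (\<Sum>p\<in>R1. h (snd p) - h (fst p)) = h s - h a - (\<Sum>p\<in>L. h (snd p) - h (fst p))" by metis
    have "\<exists>R. finite R \<and> (\<forall>p\<in>R. t \<le> fst p \<and> fst p < snd p \<and> snd p \<le> b) \<and>
      pairwise (\<lambda>p q. disjnt {fst p<..<snd p} {fst q<..<snd q}) R \<and>
      (\<forall>h::real\<Rightarrow>real. (\<Sum>p\<in>R. h (snd p) - h (fst p)) = h b - h t - (\<Sum>p\<in>U. h (snd p) - h (fst p)))"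
      by (rule less.hyps[OF cL(2)]) (use fin ast less.prems pw in \<open>auto simp: U_def\<close>)
    then obtain R2 where R2: "finite R2" "\<And>p. p \<in> R2 \<Longrightarrow> t \<le> fst p \<and> fst p < snd p \<and> snd p \<le> b"
      "pairwise (\<lambda>p q. disjnt {fst p<..<snd p} {fst q<..<snd q}) R2"
      "\<And>h::real\<Rightarrow>real. (\<Sum>p\<in>R2. h (snd p) - h (fst p)) = h b - h t - (\<Sum>p\<in>U. h (snd p) - h (fst p))" by metis
    have R12: "R1 \<inter> R2 = {}" using R1(2) R2(2) ast by fastforce
    show ?thesis
    proof (intro exI[of _ "R1 \<union> R2"] conjI ballI allI)
      show "finite (R1 \<union> R2)" using R1 R2 by auto
      have "disjnt {fst p<..<snd p} {fst q<..<snd q}" if "p \<in> R1" "q \<in> R2" for p q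
        using R1(2)[OF that(1)] R2(2)[OF that(2)] ast by (auto simp: disjnt_def)
      then show "pairwise (\<lambda>p q. disjnt {fst p<..<snd p} {fst q<..<snd q}) (R1 \<union> R2)"
        using R1(3) R2(3) unfolding pairwise_def by (metis UnE disjnt_sym)
      show "(\<Sum>p\<in>R1 \<union> R2. h (snd p) - h (fst p)) = h b - h a - (\<Sum>p\<in>J. h (snd p) - h (fst p))" for h :: "real \<Rightarrow> real"
        using R1 R2 R12 LU nst fin by (simp add: J sum.union_disjoint)
    qed (use R1(2) R2(2) ast in force)+
  qed
qed

text \<open>Intervals are the closed balls around their midpoints, so the Vitali covering theorem
  yields a countable disjoint subfamily that misses only a null set of \<open>E\<close>. Finitely
  many of its pieces already carry the measure of \<open>E\<close> up to
  \<open>\<eta>\<close>.\<close>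

lemma Vitali_intervals:
  fixes E :: "real set" and K :: "(real \<times> real) set"
  assumes K: "\<And>p. p \<in> K \<Longrightarrow> fst p < snd p"
    and fine: "\<And>x d. x \<in> E \<Longrightarrow> 0 < d \<Longrightarrow> \<exists>p\<in>K. fst p \<le> x \<and> x \<le> snd p \<and> snd p - fst p < d"
    and E: "E \<in> lmeasurable" and "0 < \<eta>"
  obtains F where "finite F" "F \<subseteq> K" "pairwise (\<lambda>p q. disjnt {fst p..snd p} {fst q..snd q}) F"
    "measure lebesgue E - \<eta> < (\<Sum>p\<in>F. snd p - fst p)"
proof -
  let ?a = "\<lambda>p::real\<times>real. (fst p + snd p) / 2" and ?r = "\<lambda>p::real\<times>real. (snd p - fst p) / 2"
  have cb: "cball (?a p) (?r p) = {fst p..snd p}" for p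
    by (auto simp: cball_eq_atLeastAtMost field_simps)
  obtain C where C: "countable C" "C \<subseteq> K" "pairwise (\<lambda>p q. disjnt (cball (?a p) (?r p)) (cball (?a q) (?r q))) C"
    "negligible (E - (\<Union>p\<in>C. cball (?a p) (?r p)))"
  proof (rule Vitali_covering_theorem_cballs[of K ?r E ?a])
    show "0 < ?r i" if "i \<in> K" for i using K[OF that] by simp
    show "\<exists>i. i \<in> K \<and> x \<in> cball (?a i) (?r i) \<and> ?r i < d" if "x \<in> E" "0 < d" for x d
      using fine[OF that] K unfolding cb by fastforce
  qed auto
  define D where "D = (\<lambda>p. E \<inter> {fst p..snd p}) ` C"
  have mD: "d \<in> lmeasurable" if "d \<in> D" for d
    using that E by (auto simp: D_def intro!: fmeasurable_Int_fmeasurable)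
  have ED: "measure lebesgue E = measure lebesgue (\<Union>D)"
  proof (rule measure_negligible_symdiff[OF E, symmetric])
    have "(E - \<Union> D) \<union> (\<Union> D - E) \<subseteq> E - (\<Union>p\<in>C. cball (?a p) (?r p))"
      unfolding cb D_def by auto
    then show "negligible ((E - \<Union> D) \<union> (\<Union> D - E))" by (rule negligible_subset[OF C(4)])
  qed
  have cD: "countable D" using C by (simp add: D_def)
  have bound: "measure lebesgue (\<Union> D') \<le> measure lebesgue E" if "D' \<subseteq> D" "finite D'" for D'
  proof (rule measure_mono_fmeasurable)
    show "\<Union> D' \<subseteq> E" using that by (auto simp: D_def)
    show "\<Union> D' \<in> sets lebesgue" using that mD by (intro sets.finite_Union) (auto dest: fmeasurableD)
  qed (rule E)
  obtain D' where D': "D' \<subseteq> D" "finite D'" "measure lebesgue (\<Union>D) - \<eta> < measure lebesgue (\<Union>D')"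
    using measure_countable_Union_approachable[OF cD \<open>0 < \<eta>\<close> mD bound] by blast
  obtain F where F: "F \<subseteq> C" "finite F" "D' = (\<lambda>p. E \<inter> {fst p..snd p}) ` F"
    using finite_subset_image[OF D'(2)] D'(1) unfolding D_def by blast
  have "measure lebesgue (\<Union>D') \<le> (\<Sum>p\<in>F. measure lebesgue (E \<inter> {fst p..snd p}))"
    unfolding F(3) by (rule measure_UNION_le) (use F E in \<open>auto dest: fmeasurableD\<close>)
  also have "\<dots> \<le> (\<Sum>p\<in>F. snd p - fst p)"
  proof (rule sum_mono)
    fix p assume "p \<in> F"
    then have "fst p < snd p" using F C K by auto
    have "measure lebesgue (E \<inter> {fst p..snd p}) \<le> measure lebesgue {fst p..snd p}"
      by (rule measure_mono_fmeasurable) (use E in \<open>auto dest: fmeasurableD\<close>)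
    then show "measure lebesgue (E \<inter> {fst p..snd p}) \<le> snd p - fst p" using \<open>fst p < snd p\<close> by simp
  qed
  finally have "measure lebesgue E - \<eta> < (\<Sum>p\<in>F. snd p - fst p)" using D'(3) ED by linarith
  moreover have "pairwise (\<lambda>p q. disjnt {fst p..snd p} {fst q..snd q}) F"
    using C(3) F(1) unfolding cb by (rule pairwise_subset)
  ultimately show thesis using that F C by blast
qed

text \<open>Suppose that \<open>E\<close> has measure \<open>s > 0\<close>. Disjoint short intervals
  with slope above \<open>d\<close> cover most of \<open>E\<close>. Inside each of them, intervals
  with slope below \<open>-d\<close> again cover most of \<open>E\<close>. The gaps left between the
  latter are short in total, yet \<open>g\<close> rises over them at least as much as over the outer
  intervals, which contradicts absolute continuity.\<close>

lemma oscillation_negligible: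
  fixes g :: "real \<Rightarrow> real"
  assumes ac: "abs_continuous_on 0 1 g" and d: "0 < d" and E: "E \<in> lmeasurable" "E \<subseteq> {0<..<1}"
    and up: "\<And>x \<delta>. x \<in> E \<Longrightarrow> 0 < \<delta> \<Longrightarrow> \<exists>u v. u < x \<and> x < v \<and> v - u < \<delta> \<and> d * (v - u) < g v - g u"
    and down: "\<And>x \<delta>. x \<in> E \<Longrightarrow> 0 < \<delta> \<Longrightarrow> \<exists>u v. u < x \<and> x < v \<and> v - u < \<delta> \<and> g v - g u < - d * (v - u)"
  shows "negligible E"
proof (rule ccontr)
  assume "\<not> negligible E"
  define s where "s = measure lebesgue E"
  have "s \<noteq> 0" using E \<open>\<not> negligible E\<close> by (simp add: negligible_iff_measure s_def)
  then have s: "0 < s" using measure_nonneg[of lebesgue E] s_def by linarith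
  have "0 < d * s / 2" using d s by simp
  then obtain \<delta> where \<delta>: "0 < \<delta>" and AC: "\<And>I. interval_family 0 1 I \<Longrightarrow> (\<Sum>p\<in>I. snd p - fst p) < \<delta> \<Longrightarrow>
      (\<Sum>p\<in>I. norm (g (snd p) - g (fst p))) < d * s / 2"
    using ac unfolding abs_continuous_on_iff by meson
  \<comment> \<open>The first bound keeps the total length of the gaps, below
    \<open>2 * \<eta>\<close>, under \<open>\<delta>\<close>; the second keeps the length of the
    outer intervals above \<open>s / 2\<close>.\<close>
  define \<eta> where "\<eta> = min (\<delta> / 3) (s / 2)"
  have \<eta>: "0 < \<eta>" "2 * \<eta> < \<delta>" "\<eta> \<le> s / 2" using \<delta> s by (auto simp: \<eta>_def min_def)
  obtain T where T: "open T" "E \<subseteq> T" "T - E \<in> lmeasurable" "emeasure lebesgue (T - E) < ennreal \<eta>"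
    using sets_lebesgue_outer_open[OF fmeasurableD[OF E(1)] \<eta>(1)] by metis
  have mT: "measure lebesgue (T - E) < \<eta>"
    using T(3,4) \<eta>(1) by (simp add: emeasure_eq_measure2 ennreal_less_iff)
  define G where "G = T \<inter> {0<..<1}"
  have G: "open G" "E \<subseteq> G" using T E by (auto simp: G_def)
  define K1 where "K1 = {p. fst p < snd p \<and> {fst p..snd p} \<subseteq> G \<and> d * (snd p - fst p) < g (snd p) - g (fst p)}"
  obtain F1 where F1: "finite F1" "F1 \<subseteq> K1" "pairwise (\<lambda>p q. disjnt {fst p..snd p} {fst q..snd q}) F1"
    "s - \<eta> < (\<Sum>p\<in>F1. snd p - fst p)"
    unfolding s_def
  proof (rule Vitali_intervals[of K1 E \<eta>])
    show "\<exists>p\<in>K1. fst p \<le> x \<and> x \<le> snd p \<and> snd p - fst p < r" if x: "x \<in> E" and "0 < r" for x r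
    proof -
      obtain r' where r': "0 < r'" "cball x r' \<subseteq> G"
        using G x by (meson open_contains_cball subsetD)
      obtain u v where uv: "u < x" "x < v" "v - u < min r r'" "d * (v - u) < g v - g u"
        using up[OF x, of "min r r'"] r' \<open>0 < r\<close> by auto
      have "{u..v} \<subseteq> cball x r'" using uv by (auto simp: dist_real_def)
      with uv r' have "(u, v) \<in> K1" by (auto simp: K1_def)
      with uv show ?thesis by (intro bexI[of _ "(u, v)"]) auto
    qed
  qed (use E \<eta> in \<open>auto simp: K1_def\<close>)
  have K1D: "fst p < snd p" "{fst p..snd p} \<subseteq> G" "d * (snd p - fst p) < g (snd p) - g (fst p)" if "p \<in> F1" for p
    using that F1(2) by (auto simp: K1_def)
  have K1D': "0 \<le> fst p" "snd p \<le> 1" if "p \<in> F1" for p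
    using K1D(1,2)[OF that] by (auto simp: G_def subset_iff) (meson less_eq_real_def order_refl)+
  \<comment> \<open>Each outer interval may lose \<open>\<eta> / N\<close> in its inner covering, so
    all of them together lose at most \<open>\<eta>\<close>. The 1 makes \<open>N\<close> positive
    even for an empty family.\<close>
  define N where "N = real (card F1) + 1"
  have N: "0 < \<eta> / N" using \<eta> by (simp add: N_def add_pos_nonneg)
  have gaps: "\<exists>R. finite R \<and> (\<forall>r\<in>R. fst p \<le> fst r \<and> fst r < snd r \<and> snd r \<le> snd p) \<and>
    pairwise (\<lambda>p q. disjnt {fst p<..<snd p} {fst q<..<snd q}) R \<and>
    d * (snd p - fst p) \<le> (\<Sum>r\<in>R. g (snd r) - g (fst r)) \<and>
    (\<Sum>r\<in>R. snd r - fst r) \<le> measure lebesgue ({fst p<..<snd p} - E) + \<eta> / N" if p: "p \<in> F1" for p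
  proof -
    define K2 where "K2 = {q. fst q < snd q \<and> fst p \<le> fst q \<and> snd q \<le> snd p \<and> g (snd q) - g (fst q) < - d * (snd q - fst q)}"
    have Em: "E \<inter> {fst p<..<snd p} \<in> lmeasurable" using E by (auto intro: fmeasurable_Int_fmeasurable)
    obtain F2 where F2: "finite F2" "F2 \<subseteq> K2" "pairwise (\<lambda>p q. disjnt {fst p..snd p} {fst q..snd q}) F2"
      "measure lebesgue (E \<inter> {fst p<..<snd p}) - \<eta> / N < (\<Sum>q\<in>F2. snd q - fst q)"
    proof (rule Vitali_intervals[of K2 "E \<inter> {fst p<..<snd p}" "\<eta> / N"])
      show "\<exists>p\<in>K2. fst p \<le> x \<and> x \<le> snd p \<and> snd p - fst p < r" if x: "x \<in> E \<inter> {fst p<..<snd p}" and "0 < r" for x r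
      proof -
        obtain u v where uv: "u < x" "x < v" "v - u < min r (min (x - fst p) (snd p - x))" "g v - g u < - d * (v - u)"
          using down[of x "min r (min (x - fst p) (snd p - x))"] x \<open>0 < r\<close> by auto
        then have "(u, v) \<in> K2" by (auto simp: K2_def)
        with uv show ?thesis by (intro bexI[of _ "(u, v)"]) auto
      qed
    qed (use Em N in \<open>auto simp: K2_def\<close>)
    have pw: "pairwise (\<lambda>p q. disjnt {fst p<..<snd p} {fst q<..<snd q}) F2"
      using F2(3) by (rule pairwise_mono) (auto simp: disjnt_def)
    have F2D: "fst p \<le> fst q \<and> fst q < snd q \<and> snd q \<le> snd p" if "q \<in> F2" for q
      using F2(2) that by (auto simp: K2_def)
    obtain R where R0: "finite R" "\<forall>r\<in>R. fst p \<le> fst r \<and> fst r < snd r \<and> snd r \<le> snd p"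
      "pairwise (\<lambda>p q. disjnt {fst p<..<snd p} {fst q<..<snd q}) R"
      "\<forall>h::real\<Rightarrow>real. (\<Sum>r\<in>R. h (snd r) - h (fst r)) = h (snd p) - h (fst p) - (\<Sum>q\<in>F2. h (snd q) - h (fst q))"
      using interval_gaps[OF F2(1) less_imp_le[OF K1D(1)[OF p]] F2D pw] by blast
    note R = R0(1) R0(2)[rule_format] R0(3) R0(4)[rule_format]
    \<comment> \<open>The function falls over the deleted inner intervals, so deleting them cannot
      decrease the total rise.\<close>
    have "(\<Sum>q\<in>F2. g (snd q) - g (fst q)) \<le> 0"
    proof (rule sum_nonpos)
      fix q assume "q \<in> F2"
      then have "fst q < snd q" "g (snd q) - g (fst q) < - d * (snd q - fst q)" using F2(2) by (auto simp: K2_def)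
      then show "g (snd q) - g (fst q) \<le> 0" using mult_pos_pos[OF d, of "snd q - fst q"] by linarith
    qed
    then have 1: "d * (snd p - fst p) \<le> (\<Sum>r\<in>R. g (snd r) - g (fst r))"
      unfolding R(4) using K1D(3)[OF p] by linarith
    have "measure lebesgue {fst p<..<snd p} = measure lebesgue (E \<inter> {fst p<..<snd p}) + measure lebesgue ({fst p<..<snd p} - E)"
      using measure_Un2[OF Em, of "{fst p<..<snd p}"] by (simp add: Un_absorb1 Diff_Int2 Diff_Int)
    then have 2: "(\<Sum>r\<in>R. snd r - fst r) \<le> measure lebesgue ({fst p<..<snd p} - E) + \<eta> / N"
      unfolding R(4)[of "\<lambda>x. x"] using F2(4) K1D(1)[OF p] by simp
    show ?thesis using R0(1-3) 1 2 by blast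
  qed
  then obtain R where R: "\<And>p. p \<in> F1 \<Longrightarrow> finite (R p)"
    "\<And>p r. p \<in> F1 \<Longrightarrow> r \<in> R p \<Longrightarrow> fst p \<le> fst r \<and> fst r < snd r \<and> snd r \<le> snd p"
    "\<And>p. p \<in> F1 \<Longrightarrow> pairwise (\<lambda>p q. disjnt {fst p<..<snd p} {fst q<..<snd q}) (R p)"
    "\<And>p. p \<in> F1 \<Longrightarrow> d * (snd p - fst p) \<le> (\<Sum>r\<in>R p. g (snd r) - g (fst r))"
    "\<And>p. p \<in> F1 \<Longrightarrow> (\<Sum>r\<in>R p. snd r - fst r) \<le> measure lebesgue ({fst p<..<snd p} - E) + \<eta> / N"
    using bchoice[of F1] by (metis (mono_tags, lifting))
  have dj: "disjnt {fst r<..<snd r} {fst r'<..<snd r'}" if "p \<in> F1" "p' \<in> F1" "p \<noteq> p'" "r \<in> R p" "r' \<in> R p'" for p p' r r'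
  proof -
    have "disjnt {fst p..snd p} {fst p'..snd p'}" using F1(3) that by (auto simp: pairwise_def)
    then show ?thesis
      by (rule disjnt_subset1[OF disjnt_subset2]) (use R(2)[of p r] R(2)[of p' r'] that in auto)
  qed
  have RR: "R p \<inter> R p' = {}" if "p \<in> F1" "p' \<in> F1" "p \<noteq> p'" for p p'
  proof -
    have False if "r \<in> R p" "r \<in> R p'" for r
      using dj[OF \<open>p \<in> F1\<close> \<open>p' \<in> F1\<close> \<open>p \<noteq> p'\<close> that] R(2)[OF \<open>p \<in> F1\<close> that(1)] by (auto simp: disjnt_def)
    then show ?thesis by auto
  qed
  have sumR: "(\<Sum>r\<in>(\<Union>p\<in>F1. R p). h r) = (\<Sum>p\<in>F1. \<Sum>r\<in>R p. h r)" for h :: "real \<times> real \<Rightarrow> real"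
    by (rule sum.UNION_disjoint) (use F1 R RR in auto)
  have fam: "interval_family 0 1 (\<Union>p\<in>F1. R p)"
    unfolding interval_family_def
  proof (intro conjI ballI)
    show "finite (\<Union>p\<in>F1. R p)" using F1 R by auto
    show "pairwise (\<lambda>p q. disjnt {fst p<..<snd p} {fst q<..<snd q}) (\<Union>p\<in>F1. R p)"
      using R(3) dj unfolding pairwise_def by (metis UN_E)
  qed (use R(2) K1D' in force)+
  have "(\<Sum>p\<in>F1. measure lebesgue ({fst p<..<snd p} - E)) = measure lebesgue (\<Union>p\<in>F1. {fst p<..<snd p} - E)"
  proof (rule measure_UNION'[symmetric])
    show "pairwise (\<lambda>i j. disjnt ({fst i<..<snd i} - E) ({fst j<..<snd j} - E)) F1"
      using F1(3) by (rule pairwise_mono) (auto simp: disjnt_def)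
  qed (use F1 E in \<open>auto intro!: fmeasurable_Diff dest: fmeasurableD\<close>)
  also have "\<dots> \<le> measure lebesgue (T - E)"
  proof (rule measure_mono_fmeasurable)
    show "(\<Union>p\<in>F1. {fst p<..<snd p} - E) \<subseteq> T - E" using K1D(2) unfolding G_def by fastforce
    show "(\<Union>p\<in>F1. {fst p<..<snd p} - E) \<in> sets lebesgue"
      by (intro sets.finite_UN sets.Diff) (use F1 E in \<open>auto dest: fmeasurableD\<close>)
  qed (use T in auto)
  finally have m: "(\<Sum>p\<in>F1. measure lebesgue ({fst p<..<snd p} - E)) < \<eta>" using mT by linarith
  have "(\<Sum>r\<in>(\<Union>p\<in>F1. R p). snd r - fst r) \<le> (\<Sum>p\<in>F1. measure lebesgue ({fst p<..<snd p} - E) + \<eta> / N)"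
    unfolding sumR by (intro sum_mono R)
  also have "\<dots> \<le> (\<Sum>p\<in>F1. measure lebesgue ({fst p<..<snd p} - E)) + \<eta>"
  proof -
    have "0 < N" by (simp add: N_def add_pos_nonneg)
    then have "real (card F1) * (\<eta> / N) \<le> \<eta>"
      using \<eta>(1) by (simp add: pos_divide_le_eq N_def algebra_simps)
    then show ?thesis by (simp only: sum.distrib sum_constant of_nat_id)
  qed
  also have "\<dots> < \<delta>" using m \<eta> by linarith
  finally have small: "(\<Sum>r\<in>(\<Union>p\<in>F1. R p). norm (g (snd r) - g (fst r))) < d * s / 2"
    using AC[OF fam] by blast
  have "d * s / 2 \<le> d * (s - \<eta>)" using \<eta>(3) d mult_left_mono[of "s/2" "s - \<eta>" d] by simp
  also have "\<dots> \<le> d * (\<Sum>p\<in>F1. snd p - fst p)" using F1(4) d by (intro mult_left_mono) auto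
  also have "\<dots> \<le> (\<Sum>r\<in>(\<Union>p\<in>F1. R p). g (snd r) - g (fst r))"
    unfolding sumR sum_distrib_left by (intro sum_mono R)
  also have "\<dots> \<le> (\<Sum>r\<in>(\<Union>p\<in>F1. R p). norm (g (snd r) - g (fst r)))" by (intro sum_mono) auto
  finally show False using small by linarith
qed

text \<open>Within a ball of radius \<open>\<delta> / 3\<close>, disjoint intervals have total
  length below \<open>\<delta>\<close>, hence variation below 1. If \<open>E\<close> had measure
  \<open>s > 0\<close> there, intervals of slope above \<open>2 / s\<close> and total length above
  \<open>s / 2\<close> would have variation above 1. Being locally null then gives a null
  set.\<close>

lemma infinite_slope_negligible:
  fixes g :: "real \<Rightarrow> real"
  assumes ac: "abs_continuous_on 0 1 g" and E: "E \<in> lmeasurable" "E \<subseteq> {0<..<1}"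
    and steep: "\<And>x \<delta> n. x \<in> E \<Longrightarrow> 0 < \<delta> \<Longrightarrow> \<exists>u v. u < x \<and> x < v \<and> v - u < \<delta> \<and> n * (v - u) < \<bar>g v - g u\<bar>"
  shows "negligible E"
proof -
  obtain \<delta> where \<delta>: "0 < \<delta>" and AC: "\<And>I. interval_family 0 1 I \<Longrightarrow> (\<Sum>p\<in>I. snd p - fst p) < \<delta> \<Longrightarrow>
      (\<Sum>p\<in>I. norm (g (snd p) - g (fst p))) < 1"
    using ac unfolding abs_continuous_on_iff by (meson zero_less_one)
  have "negligible (E \<inter> ball x (\<delta> / 3))" for x
  proof (rule ccontr)
    let ?E = "E \<inter> ball x (\<delta> / 3)"
    assume neg: "\<not> negligible ?E"
    have Em: "?E \<in> lmeasurable" using E by (auto intro: fmeasurable_Int_fmeasurable)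
    define s where "s = measure lebesgue ?E"
    have "s \<noteq> 0" using Em neg by (simp add: negligible_iff_measure s_def)
    then have s: "0 < s" using measure_nonneg[of lebesgue ?E] s_def by linarith
    define G where "G = ball x (\<delta> / 3) \<inter> {0<..<1}"
    have G: "open G" "?E \<subseteq> G" using E by (auto simp: G_def)
    define K where "K = {p. fst p < snd p \<and> {fst p..snd p} \<subseteq> G \<and> (2 / s) * (snd p - fst p) < \<bar>g (snd p) - g (fst p)\<bar>}"
    obtain F where F: "finite F" "F \<subseteq> K" "pairwise (\<lambda>p q. disjnt {fst p..snd p} {fst q..snd q}) F"
      "s - s / 2 < (\<Sum>p\<in>F. snd p - fst p)"
      unfolding s_def
    proof (rule Vitali_intervals[of K ?E "s / 2"])
      show "\<exists>p\<in>K. fst p \<le> x \<and> x \<le> snd p \<and> snd p - fst p < r" if x: "x \<in> ?E" and "0 < r" for x r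
      proof -
        obtain r' where r': "0 < r'" "cball x r' \<subseteq> G"
          using G x by (meson open_contains_cball subsetD)
        obtain u v where uv: "u < x" "x < v" "v - u < min r r'" "(2 / s) * (v - u) < \<bar>g v - g u\<bar>"
          using steep[of x "min r r'" "2 / s"] x r' \<open>0 < r\<close> by auto
        have "{u..v} \<subseteq> cball x r'" using uv by (auto simp: dist_real_def)
        with uv r' have "(u, v) \<in> K" by (auto simp: K_def)
        with uv show ?thesis by (intro bexI[of _ "(u, v)"]) auto
      qed
    qed (use Em s s_def in \<open>auto simp: K_def\<close>)
    have KD: "fst p < snd p" "{fst p..snd p} \<subseteq> G" "(2 / s) * (snd p - fst p) < \<bar>g (snd p) - g (fst p)\<bar>" if "p \<in> F" for p
      using that F(2) by (auto simp: K_def)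
    have KD': "0 \<le> fst p" "snd p \<le> 1" if "p \<in> F" for p
      using KD(1,2)[OF that] by (auto simp: G_def subset_iff) (meson less_eq_real_def order_refl)+
    have fam: "interval_family 0 1 F"
      unfolding interval_family_def
    proof (intro conjI ballI)
      show "pairwise (\<lambda>p q. disjnt {fst p<..<snd p} {fst q<..<snd q}) F"
        using F(3) by (rule pairwise_mono) (auto simp: disjnt_def)
    qed (use F(1) KD(1) KD' in \<open>auto simp: less_imp_le\<close>)
    have "(\<Sum>p\<in>F. snd p - fst p) = (\<Sum>p\<in>F. measure lebesgue {fst p..snd p})"
      using KD(1) by (intro sum.cong) (auto simp: less_imp_le)
    also have "\<dots> = measure lebesgue (\<Union>p\<in>F. {fst p..snd p})"
      by (rule measure_UNION'[symmetric]) (use F in auto)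
    also have "\<dots> \<le> measure lebesgue (ball x (\<delta> / 3))"
      by (rule measure_mono_fmeasurable) (use KD(2) F(1) in \<open>auto simp: G_def\<close>)
    also have "\<dots> < \<delta>" using \<delta> by (simp add: ball_eq_greaterThanLessThan)
    finally have small: "(\<Sum>p\<in>F. norm (g (snd p) - g (fst p))) < 1" using AC[OF fam] by blast
    have "1 = (2 / s) * (s / 2)" using s by simp
    also have "\<dots> < (2 / s) * (\<Sum>p\<in>F. snd p - fst p)"
      using F(4) s by (intro mult_strict_left_mono) auto
    also have "\<dots> \<le> (\<Sum>p\<in>F. norm (g (snd p) - g (fst p)))"
      unfolding sum_distrib_left using KD(3) by (intro sum_mono) (simp add: less_imp_le)
    finally show False using small by linarith
  qed
  then have "\<exists>U. openin (top_of_set E) U \<and> x \<in> U \<and> negligible U" if "x \<in> E" for x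
    using that \<delta> by (intro exI[of _ "E \<inter> ball x (\<delta> / 3)"]) (auto simp: openin_open_Int)
  then show ?thesis using locally_negligible_alt by blast
qed

text \<open>The points at which slopes over arbitrarily short intervals around the point exceed
  \<open>q\<close>. Written as a countable intersection of open sets, the set is visibly Borel, so
  no measurability of derivatives has to be discussed. Replacing \<open>g\<close> and
  \<open>q\<close> by \<open>-g\<close> and \<open>-q\<close> expresses slopes below
  \<open>q\<close>.\<close>

definition steep_points :: "(real \<Rightarrow> real) \<Rightarrow> real \<Rightarrow> real set" where
  "steep_points g q = (\<Inter>n::nat. \<Union>p\<in>{p. 0 \<le> fst p \<and> snd p \<le> 1 \<and> snd p - fst p < 1 / Suc n \<and>
     q * (snd p - fst p) < g (snd p) - g (fst p)}. {fst p<..<snd p})"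

lemma steep_points_borel: "steep_points g q \<in> sets borel"
  unfolding steep_points_def by (intro sets.countable_INT'' borel_open open_UN ballI open_greaterThanLessThan countableI_type) simp

lemma steep_points_subset: "steep_points g q \<subseteq> {0<..<1}"
proof
  fix x assume "x \<in> steep_points g q"
  then obtain p where "0 \<le> fst p" "snd p \<le> 1" "x \<in> {fst p<..<snd p}"
    unfolding steep_points_def by blast
  then show "x \<in> {0<..<1}" by simp
qed

lemma steep_pointsD:
  assumes "x \<in> steep_points g q" "0 < \<delta>"
  shows "\<exists>u v. u < x \<and> x < v \<and> v - u < \<delta> \<and> q * (v - u) < g v - g u"
proof -
  obtain n where n: "1 / Suc n < \<delta>" using assms(2) nat_approx_posE by blast
  obtain p where "snd p - fst p < 1 / Suc n" "q * (snd p - fst p) < g (snd p) - g (fst p)" "x \<in> {fst p<..<snd p}"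
    using assms(1) unfolding steep_points_def by blast
  with n show ?thesis by (intro exI[of _ "fst p"] exI[of _ "snd p"]) auto
qed

lemma not_steep_pointsD:
  assumes "x \<notin> steep_points g q" "x \<in> {0<..<1}"
  obtains \<delta> where "0 < \<delta>" "\<And>u v. u < x \<Longrightarrow> x < v \<Longrightarrow> v - u < \<delta> \<Longrightarrow> g v - g u \<le> q * (v - u)"
proof -
  obtain n :: nat where n: "\<And>p. 0 \<le> fst p \<Longrightarrow> snd p \<le> 1 \<Longrightarrow> snd p - fst p < 1 / Suc n \<Longrightarrow> x \<in> {fst p<..<snd p}
      \<Longrightarrow> g (snd p) - g (fst p) \<le> q * (snd p - fst p)"
    using assms unfolding steep_points_def by fastforce
  \<comment> \<open>Taking the length below \<open>x\<close> and \<open>1 - x\<close> as well forces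
    every interval around \<open>x\<close> into the unit interval, as \<open>steep_points\<close>
    requires.\<close>
  show thesis
  proof (rule that[of "min (1 / Suc n) (min x (1 - x))"])
    show "g v - g u \<le> q * (v - u)" if "u < x" "x < v" "v - u < min (1 / Suc n) (min x (1 - x))" for u v
      using n[of "(u, v)"] that by auto
  qed (use assms in auto)
qed

lemma steep_points_mono: "x \<in> steep_points g q \<Longrightarrow> p \<le> q \<Longrightarrow> x \<in> steep_points g p"
proof -
  assume x: "x \<in> steep_points g q" and "p \<le> q"
  then have "p * t < d" if "q * t < d" "0 < t" for t d
    using that mult_right_mono[of p q t] by linarith
  then show ?thesis using x unfolding steep_points_def by fastforce
qed

text \<open>The hypothesis controls only intervals with \<open>x\<close> strictly inside. By
  continuity at \<open>x\<close> one endpoint can be moved into \<open>x\<close>, and the estimate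
  passes to both one-sided difference quotients.\<close>

lemma real_derivative_from_straddling:
  fixes g :: "real \<Rightarrow> real"
  assumes "0 < x" "x < 1" and cont: "isCont g x"
    and str: "\<And>e. 0 < e \<Longrightarrow> \<exists>\<delta>>0. \<forall>u v. u < x \<longrightarrow> x < v \<longrightarrow> v - u < \<delta> \<longrightarrow> \<bar>g v - g u - L * (v - u)\<bar> \<le> e * (v - u)"
  shows "(g has_vector_derivative L) (at x)"
  unfolding has_real_derivative_iff_has_vector_derivative[symmetric] has_field_derivative_iff
proof (rule tendstoI)
  fix e :: real assume "0 < e"
  then obtain \<delta> where \<delta>: "0 < \<delta>" and D: "\<And>u v. u < x \<Longrightarrow> x < v \<Longrightarrow> v - u < \<delta> \<Longrightarrow> \<bar>g v - g u - L * (v - u)\<bar> \<le> e / 2 * (v - u)"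
    using str[of "e / 2"] by auto
  have right: "\<bar>g v - g x - L * (v - x)\<bar> \<le> e / 2 * (v - x)" if v: "x < v" "v - x < \<delta>" for v
  proof (rule tendsto_le[of "at_left x"])
    have "(g \<longlongrightarrow> g x) (at_left x)" using cont by (simp add: isCont_def filterlim_at_split)
    then show "((\<lambda>u. \<bar>g v - g u - L * (v - u)\<bar>) \<longlongrightarrow> \<bar>g v - g x - L * (v - x)\<bar>) (at_left x)"
      by (intro tendsto_intros)
    show "((\<lambda>u. e / 2 * (v - u)) \<longlongrightarrow> e / 2 * (v - x)) (at_left x)" by (intro tendsto_intros)
    show "\<forall>\<^sub>F u in at_left x. \<bar>g v - g u - L * (v - u)\<bar> \<le> e / 2 * (v - u)"
      unfolding eventually_at_left_field using D v by (intro exI[of _ "v - \<delta>"]) auto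
  qed simp
  have left: "\<bar>g x - g u - L * (x - u)\<bar> \<le> e / 2 * (x - u)" if u: "u < x" "x - u < \<delta>" for u
  proof (rule tendsto_le[of "at_right x"])
    have "(g \<longlongrightarrow> g x) (at_right x)" using cont by (simp add: isCont_def filterlim_at_split)
    then show "((\<lambda>v. \<bar>g v - g u - L * (v - u)\<bar>) \<longlongrightarrow> \<bar>g x - g u - L * (x - u)\<bar>) (at_right x)"
      by (intro tendsto_intros)
    show "((\<lambda>v. e / 2 * (v - u)) \<longlongrightarrow> e / 2 * (x - u)) (at_right x)" by (intro tendsto_intros)
    show "\<forall>\<^sub>F v in at_right x. \<bar>g v - g u - L * (v - u)\<bar> \<le> e / 2 * (v - u)"
      unfolding eventually_at_right_field using D u by (intro exI[of _ "u + \<delta>"]) auto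
  qed simp
  have "dist ((g y - g x) / (y - x)) L < e" if y: "y \<noteq> x" "dist y x < \<delta>" for y
  proof -
    have "\<bar>g y - g x - L * (y - x)\<bar> \<le> e / 2 * \<bar>y - x\<bar>"
    proof (cases "x < y")
      case True then show ?thesis using right[of y] y by (simp add: dist_real_def)
    next
      case False
      have "g y - g x - L * (y - x) = - (g x - g y - L * (x - y))" by (simp add: algebra_simps)
      then have "\<bar>g y - g x - L * (y - x)\<bar> = \<bar>g x - g y - L * (x - y)\<bar>" by (simp only: abs_minus_cancel)
      moreover have "\<bar>y - x\<bar> = x - y" using False by simp
      ultimately show ?thesis using left[of y] y False by (simp only: dist_real_def)
    qed
    then have "\<bar>g y - g x - L * (y - x)\<bar> / \<bar>y - x\<bar> \<le> e / 2"
      using y by (simp add: field_simps)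
    moreover have "(g y - g x) / (y - x) - L = (g y - g x - L * (y - x)) / (y - x)"
      using y by (simp add: field_simps)
    ultimately have "\<bar>(g y - g x) / (y - x) - L\<bar> \<le> e / 2" by (simp only: abs_divide)
    then show ?thesis using \<open>0 < e\<close> by (simp add: dist_real_def)
  qed
  then show "\<forall>\<^sub>F y in at x. dist ((g y - g x) / (y - x)) L < e"
    unfolding eventually_at using \<delta> by blast
qed

text \<open>Two null sets are discarded: the points with unbounded slopes, and for rational
  \<open>p < q\<close> the points with slopes both above \<open>q\<close> and below \<open>p\<close>
  at every scale. Elsewhere the supremum of the slopes recurring at every scale is the
  derivative.\<close>

lemma abs_continuous_on_real_differentiable:
  fixes g :: "real \<Rightarrow> real"
  assumes ac: "abs_continuous_on 0 1 g"
  obtains N where "negligible N" "\<And>x. x \<in> {0<..<1} - N \<Longrightarrow> \<exists>L. (g has_vector_derivative L) (at x)"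
proof -
  define E where "E p q = steep_points g q \<inter> steep_points (\<lambda>x. - g x) (- p)" for p q
  define B where "B = (\<Inter>n::nat. steep_points g n \<union> steep_points (\<lambda>x. - g x) n)"
  have unit: "{0<..<1::real} \<in> lmeasurable" by simp
  have leb: "steep_points f q \<in> sets lebesgue" for f q
    using steep_points_borel[of f q] by (simp add: sets_completionI_sets)
  have negE: "negligible (E p q)" if "p < q" for p q
  \<comment> \<open>Subtracting the mean slope \<open>(p + q) / 2\<close> turns slopes above
    \<open>q\<close> and below \<open>p\<close> into slopes beyond plus and minus
    \<open>(q - p) / 2\<close>.\<close>
  proof (rule oscillation_negligible[OF abs_continuous_on_diff_linear[OF ac, of "(p + q) / 2"], of "(q - p) / 2"])
    show "E p q \<in> lmeasurable"
      by (rule fmeasurableI2[OF unit]) (use leb steep_points_subset[of g q] in \<open>auto simp: E_def\<close>)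
    show "E p q \<subseteq> {0<..<1}" using steep_points_subset by (auto simp: E_def)
    show "\<exists>u v. u < x \<and> x < v \<and> v - u < \<delta> \<and> (q - p) / 2 * (v - u) < (g v - (p + q) / 2 * v) - (g u - (p + q) / 2 * u)"
      if xE: "x \<in> E p q" "0 < \<delta>" for x \<delta>
    proof -
      obtain u v where "u < x" "x < v" "v - u < \<delta>" "q * (v - u) < g v - g u"
        using steep_pointsD[of x g q \<delta>] xE by (auto simp: E_def)
      moreover have "(q - p) / 2 * (v - u) + (p + q) / 2 * v - (p + q) / 2 * u = q * (v - u)" by (simp add: field_simps)
      ultimately show ?thesis by (intro exI[of _ u] exI[of _ v]) linarith
    qed
    show "\<exists>u v. u < x \<and> x < v \<and> v - u < \<delta> \<and> (g v - (p + q) / 2 * v) - (g u - (p + q) / 2 * u) < - ((q - p) / 2) * (v - u)"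
      if xE: "x \<in> E p q" "0 < \<delta>" for x \<delta>
    proof -
      obtain u v where "u < x" "x < v" "v - u < \<delta>" "- p * (v - u) < - g v - - g u"
        using steep_pointsD[of x "\<lambda>x. - g x" "- p" \<delta>] xE by (auto simp: E_def)
      moreover have "- ((q - p) / 2) * (v - u) + (p + q) / 2 * v - (p + q) / 2 * u = - (- p * (v - u))" by (simp add: field_simps)
      ultimately show ?thesis by (intro exI[of _ u] exI[of _ v]) linarith
    qed
  qed (use that in auto)
  have negB: "negligible B"
  proof (rule infinite_slope_negligible[OF ac])
    have "B \<in> sets lebesgue" unfolding B_def using leb by (intro sets.countable_INT'') auto
    then show "B \<in> lmeasurable"
      by (rule fmeasurableI2[OF unit, rotated]) (use steep_points_subset in \<open>unfold B_def, blast dest: INT_D[of _ _ _ 0]\<close>)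
    show "B \<subseteq> {0<..<1}" using steep_points_subset unfolding B_def by (blast dest: INT_D[of _ _ _ 0])
    show "\<exists>u v. u < x \<and> x < v \<and> v - u < \<delta> \<and> n * (v - u) < \<bar>g v - g u\<bar>"
      if x: "x \<in> B" and \<delta>: "0 < \<delta>" for x \<delta> n
    proof -
      obtain k :: nat where k: "n \<le> real k" using real_arch_simple by blast
      have "x \<in> steep_points g k \<or> x \<in> steep_points (\<lambda>x. - g x) k" using x by (auto simp: B_def)
      then obtain u v where uv: "u < x" "x < v" "v - u < \<delta>" "real k * (v - u) < \<bar>g v - g u\<bar>"
        using steep_pointsD[OF _ \<delta>, of x g k] steep_pointsD[OF _ \<delta>, of x "\<lambda>x. - g x" k] by fastforce
      moreover have "n * (v - u) \<le> real k * (v - u)" using k uv by (intro mult_right_mono) auto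
      ultimately show ?thesis by (intro exI[of _ u] exI[of _ v]) linarith
    qed
  qed
  define N where "N = B \<union> (\<Union>z\<in>{z\<in>\<rat> \<times> \<rat>. fst z < snd z}. E (fst z) (snd z))"
  have "countable {z\<in>(\<rat>::real set) \<times> (\<rat>::real set). fst z < snd z}"
    by (rule countable_subset[of _ "\<rat> \<times> \<rat>"]) (auto intro!: countable_SIGMA countable_rat)
  then have "negligible N"
    unfolding N_def using negE negB by (intro negligible_Un negligible_countable_Union) auto
  moreover have "\<exists>L. (g has_vector_derivative L) (at x)" if x: "x \<in> {0<..<1} - N" for x
  proof -
    have x01: "x \<in> {0<..<1}" using x by auto
    obtain n :: nat where n: "x \<notin> steep_points g n" "x \<notin> steep_points (\<lambda>x. - g x) n"
      using x by (auto simp: N_def B_def)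
    define A where "A = {q. x \<in> steep_points g q}"
    have bdd: "q \<le> n" if "q \<in> A" for q
      using that n(1) steep_points_mono[of x g q n] by (auto simp: A_def) (meson linear)
    \<comment> \<open>Otherwise all short slopes around \<open>x\<close> would be at most
      \<open>-n - 1\<close>, while boundedness of the slopes of \<open>-g\<close> makes them at
      least \<open>-n\<close>. This shows that the supremum is taken over a nonempty set.\<close>
    have "- real n - 1 \<in> A"
    proof (rule ccontr)
      assume "- real n - 1 \<notin> A"
      then have ns: "x \<notin> steep_points g (- real n - 1)" by (simp add: A_def)
      obtain \<delta>1 where d1: "0 < \<delta>1" "\<And>u v. u < x \<Longrightarrow> x < v \<Longrightarrow> v - u < \<delta>1 \<Longrightarrow> g v - g u \<le> (- real n - 1) * (v - u)"
        using not_steep_pointsD[OF ns x01] by metis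
      obtain \<delta>2 where d2: "0 < \<delta>2" "\<And>u v. u < x \<Longrightarrow> x < v \<Longrightarrow> v - u < \<delta>2 \<Longrightarrow> - g v - - g u \<le> real n * (v - u)"
        using not_steep_pointsD[OF n(2) x01] by metis
      define r where "r = min \<delta>1 \<delta>2 / 3"
      have r: "0 < r" "2 * r < \<delta>1" "2 * r < \<delta>2" using d1 d2 by (auto simp: r_def)
      show False using d1(2)[of "x - r" "x + r"] d2(2)[of "x - r" "x + r"] r by (auto simp: algebra_simps)
    qed
    then have ne: "A \<noteq> {}" by auto
    have bd: "bdd_above A" using bdd by (rule bdd_aboveI)
    define L where "L = Sup A"
    have str: "\<exists>\<delta>>0. \<forall>u v. u < x \<longrightarrow> x < v \<longrightarrow> v - u < \<delta> \<longrightarrow> \<bar>g v - g u - L * (v - u)\<bar> \<le> e * (v - u)" if e: "0 < e" for e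
    proof -
      have "L + e \<notin> A" using cSup_upper[OF _ bd, of "L + e"] e by (auto simp: L_def)
      then have ns: "x \<notin> steep_points g (L + e)" by (simp add: A_def)
      obtain q' where q': "q' \<in> A" "L - e < q'" using less_cSup_iff[OF ne bd, of "L - e"] e by (auto simp: L_def)
      \<comment> \<open>Two rationals strictly between \<open>L - e\<close> and an attained slope
        are needed, because only the countably many sets \<open>E p q\<close> with rational indices
        were discarded.\<close>
      obtain p where p: "p \<in> \<rat>" "L - e < p" "p < q'" using Rats_dense_in_real[OF q'(2)] by blast
      obtain q where q: "q \<in> \<rat>" "p < q" "q < q'" using Rats_dense_in_real[OF p(3)] by blast
      have "x \<in> steep_points g q" using q' q steep_points_mono[of x g q' q] by (auto simp: A_def)
      moreover have "x \<notin> E p q" using x p q unfolding N_def by force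
      ultimately have ns2: "x \<notin> steep_points (\<lambda>x. - g x) (- p)" by (auto simp: E_def)
      obtain \<delta>1 where d1: "0 < \<delta>1" "\<And>u v. u < x \<Longrightarrow> x < v \<Longrightarrow> v - u < \<delta>1 \<Longrightarrow> g v - g u \<le> (L + e) * (v - u)"
        using not_steep_pointsD[OF ns x01] by metis
      obtain \<delta>2 where d2: "0 < \<delta>2" "\<And>u v. u < x \<Longrightarrow> x < v \<Longrightarrow> v - u < \<delta>2 \<Longrightarrow> - g v - - g u \<le> - p * (v - u)"
        using not_steep_pointsD[OF ns2 x01] by metis
      have "\<bar>g v - g u - L * (v - u)\<bar> \<le> e * (v - u)" if uv: "u < x" "x < v" "v - u < min \<delta>1 \<delta>2" for u v
      proof -
        have "(L - e) * (v - u) \<le> p * (v - u)" using p uv by (intro mult_right_mono) auto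
        then show ?thesis using d1(2)[of u v] d2(2)[of u v] uv by (simp add: algebra_simps abs_le_iff)
      qed
      with d1 d2 show ?thesis by (intro exI[of _ "min \<delta>1 \<delta>2"]) auto
    qed
    have "continuous_on {0<..<1} g"
      using abs_continuous_on_imp_continuous_on[OF ac] by (rule continuous_on_subset) auto
    then have "isCont g x" using x01 by (simp add: continuous_on_eq_continuous_at)
    then show ?thesis using real_derivative_from_straddling[of x g L] x01 str by auto
  qed
  ultimately show thesis using that by blast
qed

lemma has_vector_derivative_componentwise:
  fixes c :: "real \<Rightarrow> real^'d"
  assumes "\<And>i. ((\<lambda>t. c t $ i) has_vector_derivative (L $ i)) (at x)"
  shows "(c has_vector_derivative L) (at x)"
  unfolding has_vector_derivative_def
proof (subst has_derivative_componentwise_within, intro ballI)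
  fix b :: "real^'d" assume "b \<in> Basis"
  then obtain i where b: "b = axis i 1" by (auto simp: Basis_vec_def)
  show "((\<lambda>t. c t \<bullet> b) has_derivative (\<lambda>h. (h *\<^sub>R L) \<bullet> b)) (at x)"
    using assms[of i] by (simp add: b inner_axis has_vector_derivative_def)
qed

lemma abs_continuous_on_differentiable:
  fixes c :: "real \<Rightarrow> real^'d"
  assumes ac: "abs_continuous_on 0 1 c"
  obtains N where "negligible N" "\<And>x. x \<in> {0<..<1} - N \<Longrightarrow> \<exists>v. (c has_vector_derivative v) (at x)"
proof -
  have "abs_continuous_on 0 1 (\<lambda>t. c t $ i)" for i
    by (rule abs_continuous_on_lipschitz_compose[OF ac, of _ 1])
      (metis component_le_norm_cart mult_1 real_norm_def vector_minus_component)
  then have "\<exists>N. negligible N \<and> (\<forall>x\<in>{0<..<1} - N. \<exists>L. ((\<lambda>t. c t $ i) has_vector_derivative L) (at x))" for i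
    using abs_continuous_on_real_differentiable by metis
  then obtain N where N: "\<And>i. negligible (N i)"
    "\<And>i x. x \<in> {0<..<1} - N i \<Longrightarrow> \<exists>L. ((\<lambda>t. c t $ i) has_vector_derivative L) (at x)"
    by metis
  show thesis
  proof (rule that[of "\<Union>i\<in>UNIV. N i"])
    show "negligible (\<Union>i\<in>UNIV. N i)" using N(1) by (intro negligible_Union) auto
    fix x assume x: "x \<in> {0<..<1} - (\<Union>i\<in>UNIV. N i)"
    then obtain L where L: "\<And>i. ((\<lambda>t. c t $ i) has_vector_derivative L i) (at x)" using N(2) by (metis DiffD1 DiffD2 DiffI UN_I UNIV_I)
    have "(c has_vector_derivative (\<chi> i. L i)) (at x)"
      by (rule has_vector_derivative_componentwise) (simp add: L)
    then show "\<exists>v. (c has_vector_derivative v) (at x)" by blast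
  qed
qed

text \<open>An isolated point is the only point of \<open>T\<close> in some interval with rational
  endpoints. Hence at all but countably many times of \<open>T\<close> the set accumulates, which is
  how pattern conditions on a curve are later differentiated.\<close>

lemma countable_isolated_points:
  fixes T :: "real set"
  shows "countable {t\<in>T. \<not> t islimpt T}"
proof -
  have "\<exists>p q. p \<in> \<rat> \<and> q \<in> \<rat> \<and> T \<inter> {p<..<q} = {t}" if t: "t \<in> T" "\<not> t islimpt T" for t
  proof -
    obtain e where e: "0 < e" "\<And>y. y \<in> T \<Longrightarrow> dist y t < e \<Longrightarrow> y = t"
      using t(2) unfolding islimpt_approachable by blast
    obtain p q where "p \<in> \<rat>" "t - e < p" "p < t" "q \<in> \<rat>" "t < q" "q < t + e"
      using Rats_dense_in_real[of "t - e" t] Rats_dense_in_real[of t "t + e"] e(1) by auto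
    then show ?thesis using e t(1) by (intro exI[of _ p] exI[of _ q]) (auto simp: dist_real_def abs_if)
  qed
  then obtain P Q where PQ: "\<And>t. t \<in> T \<Longrightarrow> \<not> t islimpt T \<Longrightarrow> P t \<in> \<rat> \<and> Q t \<in> \<rat> \<and> T \<inter> {P t<..<Q t} = {t}"
    by metis
  have "inj_on (\<lambda>t. (P t, Q t)) {t\<in>T. \<not> t islimpt T}"
  proof (rule inj_onI)
    fix a b assume a: "a \<in> {t\<in>T. \<not> t islimpt T}" and b: "b \<in> {t\<in>T. \<not> t islimpt T}"
      and e: "(P a, Q a) = (P b, Q b)"
    from e have ab: "P a = P b" "Q a = Q b" by (simp_all only: prod.inject)
    have "T \<inter> {P a<..<Q a} = {a}" using PQ a by blast
    moreover have "T \<inter> {P b<..<Q b} = {b}" using PQ b by blast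
    ultimately show "a = b" unfolding ab by blast
  qed
  moreover have "countable ((\<lambda>t. (P t, Q t)) ` {t\<in>T. \<not> t islimpt T})"
    by (rule countable_subset[of _ "\<rat> \<times> \<rat>"]) (use PQ in \<open>auto intro!: countable_SIGMA countable_rat\<close>)
  ultimately show ?thesis by (rule countable_image_inj_on[rotated])
qed

text \<open>Along \<open>T\<close> all difference quotients at \<open>t\<close> vanish. An equation
  that a curve satisfies on an accumulating set of times therefore passes to its derivative.\<close>

lemma has_vector_derivative_zero_at_limpt:
  fixes g :: "real \<Rightarrow> 'a::real_normed_vector"
  assumes g: "(g has_vector_derivative v) (at t)" and T: "t islimpt T" and const: "\<And>s. s \<in> T \<Longrightarrow> g s = g t"
  shows "v = 0"
proof -
  have *: "\<exists>d>0. \<forall>y\<in>T. norm (y - t) < d \<longrightarrow> norm (g y - g t - (y - t) *\<^sub>R v) \<le> e * norm (y - t)" if "0 < e" for e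
    using has_vector_derivative_at_within[OF g, of T] that
    unfolding has_vector_derivative_def has_derivative_within_alt by blast
  have *: "\<exists>d>0. \<forall>y\<in>T. norm (y - t) < d \<longrightarrow> norm (g y - g t - (y - t) *\<^sub>R v) \<le> norm v / 2 * norm (y - t)" if "v \<noteq> 0"
    by (rule *) (use that in simp)
  show ?thesis
  proof (rule ccontr)
    assume "v \<noteq> 0"
    then obtain d where d: "0 < d" "\<And>y. y \<in> T \<Longrightarrow> norm (y - t) < d \<Longrightarrow> norm (g y - g t - (y - t) *\<^sub>R v) \<le> norm v / 2 * norm (y - t)"
      using * by blast
    obtain y where y: "y \<in> T" "y \<noteq> t" "norm (y - t) < d"
      using T d(1) unfolding islimpt_approachable dist_norm by blast
    have "norm (y - t) * norm v \<le> norm v / 2 * norm (y - t)"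
      using d(2)[OF y(1,3)] const[OF y(1)] by simp
    then show False using y(2) \<open>v \<noteq> 0\<close> by simp
  qed
qed

section \<open>Least squares and the Moore-Penrose inverse\<close>

declare transpose_matrix_vector [simp del]

lemma inner_matrix_vector_transpose: "((A::real^'n^'m) *v x) \<bullet> y = x \<bullet> (transpose A *v y)"
  by (simp add: dot_lmul_matrix transpose_matrix_vector inner_commute[of _ y] inner_commute[of x])

text \<open>Orthogonal projection onto the range of \<open>transpose B\<close>; the remainder
  \<open>z\<close> satisfies \<open>B *v z = 0\<close> because the squared norm of
  \<open>B *v z\<close> is the inner product of \<open>z\<close> with a vector of that
  range.\<close>

lemma range_transpose_decomp:
  fixes B :: "real^'n^'m"
  obtains t n where "x = transpose B *v t + n" "B *v n = 0"
proof -
  have sub: "span (range ((*v) (transpose B))) = range ((*v) (transpose B))"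
    by (rule span_eq_iff[THEN iffD2]) (rule linear_subspace_image[OF matrix_vector_mul_linear subspace_UNIV])
  obtain y z where yz: "y \<in> span (range ((*v) (transpose B)))"
    "\<And>w. w \<in> span (range ((*v) (transpose B))) \<Longrightarrow> orthogonal z w" "x = y + z"
    using orthogonal_subspace_decomp_exists by blast
  have "(B *v z) \<bullet> (B *v z) = z \<bullet> (transpose B *v (B *v z))" by (rule inner_matrix_vector_transpose)
  also have "\<dots> = 0" using yz(2)[of "transpose B *v (B *v z)"] sub by (simp add: orthogonal_def)
  finally have "B *v z = 0" by simp
  then show thesis using that yz(1,3) unfolding sub by blast
qed

lemma orthogonal_null_space_imp_range_transpose:
  fixes B :: "real^'n^'m"
  assumes "\<And>n. B *v n = 0 \<Longrightarrow> n \<bullet> x = 0"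
  obtains w where "x = transpose B *v w"
proof -
  obtain t n where tn: "x = transpose B *v t + n" "B *v n = 0" by (rule range_transpose_decomp)
  have "n \<bullet> x = (B *v n) \<bullet> t + n \<bullet> n" unfolding tn(1) inner_add_right inner_matrix_vector_transpose by simp
  then have "n = 0" using assms[OF tn(2)] tn(2) by simp
  with tn that show thesis by simp
qed

text \<open>The decomposition is used twice: once to project \<open>y\<close> onto the range of
  \<open>B\<close>, once to move the preimage into the range of \<open>transpose B\<close>. A
  solution of this shape is unique and has least norm.\<close>

lemma least_squares_exists:
  fixes B :: "real^'n^'m"
  obtains t where "transpose B *v (B *v (transpose B *v t) - y) = 0"
proof -
  obtain u w where uw: "y = transpose (transpose B) *v u + w" "transpose B *v w = 0"
    by (rule range_transpose_decomp)
  obtain t n where tn: "u = transpose B *v t + n" "B *v n = 0" by (rule range_transpose_decomp)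
  have "B *v (transpose B *v t) - y = - w"
    using uw(1) tn by (simp add: transpose_transpose matrix_vector_right_distrib)
  then have "transpose B *v (B *v (transpose B *v t) - y) = 0"
    using uw(2) by (metis linear_neg matrix_vector_mul_linear neg_equal_0_iff_equal)
  then show thesis by (rule that)
qed

lemma transpose_mult_self_eq_0:
  fixes B :: "real^'n^'m"
  assumes "transpose B *v (B *v x) = 0" shows "B *v x = 0"
  using inner_matrix_vector_transpose[of B x "B *v x"] assms by simp

lemma least_squares_unique:
  fixes B :: "real^'n^'m"
  assumes "transpose B *v (B *v (transpose B *v t)) = transpose B *v (B *v (transpose B *v t'))"
  shows "transpose B *v t = transpose B *v t'"
proof -
  have "transpose B *v (B *v (transpose B *v (t - t'))) = 0"
    using assms by (simp add: matrix_vector_mult_diff_distrib)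
  then have "B *v (transpose B *v (t - t')) = 0" by (rule transpose_mult_self_eq_0)
  then have "transpose (transpose B) *v (transpose B *v (t - t')) = 0" by (simp add: transpose_transpose)
  then have "transpose B *v (t - t') = 0" by (rule transpose_mult_self_eq_0)
  then show ?thesis by (simp add: matrix_vector_mult_diff_distrib)
qed

section \<open>Existence and uniqueness of the Moore-Penrose inverse\<close>

definition penrose :: "real^'n^'m \<Rightarrow> real^'m^'n \<Rightarrow> bool" where
  "penrose B X \<longleftrightarrow> B ** X ** B = B \<and> X ** B ** X = X \<and>
      transpose (B ** X) = B ** X \<and> transpose (X ** B) = X ** B"

lemma penrose_normal_equations:
  assumes "penrose B X" shows "transpose B ** (B ** X) = transpose B"
proof -
  have "transpose (B ** X ** B) = transpose B ** transpose (B ** X)" by (rule matrix_transpose_mul)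
  then show ?thesis using assms by (simp add: penrose_def)
qed

lemma penrose_range:
  assumes "penrose B X" shows "X = transpose B ** (transpose X ** X)"
proof -
  have "X = transpose (X ** B) ** X" using assms by (simp add: penrose_def)
  then show ?thesis by (simp add: matrix_transpose_mul matrix_mul_assoc)
qed

lemma penrose_unique:
  assumes X: "penrose B X" and Y: "penrose B Y" shows "X = Y"
proof (subst matrix_eq, intro allI)
  fix y
  have "transpose B *v (transpose X ** X *v y) = transpose B *v (transpose Y ** Y *v y)"
  proof (rule least_squares_unique)
    have "transpose B *v (B *v (transpose B *v (transpose Z ** Z *v y))) = transpose B *v y"
      if Z: "penrose B Z" for Z
      using penrose_normal_equations[OF Z] penrose_range[OF Z, symmetric]
      by (simp add: matrix_vector_mul_assoc)
    then show "transpose B *v (B *v (transpose B *v (transpose X ** X *v y))) =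
        transpose B *v (B *v (transpose B *v (transpose Y ** Y *v y)))" using X Y by simp
  qed
  then show "X *v y = Y *v y"
    using penrose_range[OF X, symmetric] penrose_range[OF Y, symmetric] by (simp add: matrix_vector_mul_assoc)
qed

lemma penrose_exists:
  fixes B :: "real^'n^'m"
  obtains X where "penrose B X"
proof -
  have "\<exists>t. transpose B *v (B *v (transpose B *v t) - y) = 0" for y
    using least_squares_exists[of B y] by blast
  then obtain s where s: "\<And>y. transpose B *v (B *v (transpose B *v s y) - y) = 0" by metis
  define x where "x y = transpose B *v s y" for y
  have nx: "transpose B *v (B *v x y) = transpose B *v y" for y
    using s[of y] by (simp add: x_def matrix_vector_mult_diff_distrib)
  have uniq: "x y = transpose B *v t" if "transpose B *v (B *v (transpose B *v t)) = transpose B *v y" for y t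
    unfolding x_def by (rule least_squares_unique) (use nx[of y] that in \<open>simp add: x_def\<close>)
  \<comment> \<open>The choice \<open>s\<close> need not be linear; \<open>x\<close> is, since the
    normal equations have only one solution in the range of \<open>transpose B\<close>.\<close>
  have "linear x"
  proof (rule linearI)
    fix y z :: "real^'m" and c :: real
    have "x (y + z) = transpose B *v (s y + s z)"
      by (rule uniq) (use nx[of y] nx[of z] in \<open>simp add: matrix_vector_right_distrib x_def\<close>)
    then show "x (y + z) = x y + x z" by (simp add: x_def matrix_vector_right_distrib)
    have "x (c *\<^sub>R y) = transpose B *v (c *\<^sub>R s y)"
      by (rule uniq) (use nx[of y] in \<open>simp add: matrix_vector_mult_scaleR x_def\<close>)
    then show "x (c *\<^sub>R y) = c *\<^sub>R x y" by (simp add: x_def matrix_vector_mult_scaleR)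
  qed
  define X where "X = matrix x"
  have X: "X *v y = x y" for y unfolding X_def using \<open>linear x\<close> by (simp add: matrix_works)
  have BtBX: "transpose B ** (B ** X) = transpose B"
    by (subst matrix_eq) (simp add: matrix_vector_mul_assoc[symmetric] X nx)
  have BXB: "B ** X ** B = B"
  proof (subst matrix_eq, intro allI)
    fix z
    have "transpose B *v (B *v (x (B *v z) - z)) = 0"
      using nx[of "B *v z"] by (simp add: matrix_vector_mult_diff_distrib)
    then have "B *v (x (B *v z) - z) = 0" by (rule transpose_mult_self_eq_0)
    then show "(B ** X ** B) *v z = B *v z"
      by (simp add: matrix_vector_mul_assoc[symmetric] X matrix_vector_mult_diff_distrib)
  qed
  have XBX: "X ** B ** X = X"
  proof (subst matrix_eq, intro allI)
    fix y
    have "x (B *v x y) = x y"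
      unfolding x_def[of y] by (rule uniq) (simp add: x_def)
    then show "(X ** B ** X) *v y = X *v y" by (simp add: matrix_vector_mul_assoc[symmetric] X)
  qed
  \<comment> \<open>The right-hand side is a Gram matrix and hence symmetric, so
    \<open>B ** X\<close> is symmetric too.\<close>
  have e: "transpose (B ** X) = transpose (B ** X) ** (B ** X)"
    by (simp add: matrix_transpose_mul matrix_mul_assoc[symmetric] BtBX)
  then have "transpose (transpose (B ** X)) = transpose (transpose (B ** X) ** (B ** X))" by simp
  then have sBX: "transpose (B ** X) = B ** X"
    using e by (simp add: matrix_transpose_mul transpose_transpose)
  have BXid: "B *v x (B *v w) = B *v w" for w
    using BXB by (metis X matrix_vector_mul_assoc)
  \<comment> \<open>The map \<open>X ** B\<close> is the orthogonal projection onto the range of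
    \<open>transpose B\<close>: its values lie there, and \<open>w - x (B *v w)\<close> lies in the
    null space of \<open>B\<close>. Symmetry follows.\<close>
  have "(x (B *v z)) \<bullet> w = (x (B *v z)) \<bullet> (x (B *v w))" for z w
  proof -
    have "(x (B *v z)) \<bullet> (w - x (B *v w)) = (B *v (w - x (B *v w))) \<bullet> s (B *v z)"
      using inner_matrix_vector_transpose[of B "w - x (B *v w)" "s (B *v z)"]
      by (simp add: x_def[of "B *v z"] inner_commute)
    then show ?thesis using BXid[of w] by (simp add: matrix_vector_mult_diff_distrib inner_diff_right)
  qed
  then have sym: "(x (B *v z)) \<bullet> w = z \<bullet> (x (B *v w))" for z w
    by (metis inner_commute)
  have "transpose (X ** B) = X ** B"
  proof (subst matrix_eq, intro allI)
    fix w
    have "z \<bullet> (transpose (X ** B) *v w) = z \<bullet> ((X ** B) *v w)" for z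
      unfolding inner_matrix_vector_transpose[symmetric]
      by (simp add: matrix_vector_mul_assoc[symmetric] X sym)
    then show "transpose (X ** B) *v w = (X ** B) *v w" by (metis vector_eq_rdot inner_commute)
  qed
  then show thesis using that BXB XBX sBX by (simp add: penrose_def)
qed

lemma penrose_pseudoinverse: "penrose B (pseudoinverse B)"
proof -
  obtain X where X: "penrose B X" by (rule penrose_exists)
  then have "penrose B (THE X. penrose B X)" by (rule theI) (rule penrose_unique[OF _ X])
  moreover have "pseudoinverse B = (THE X. penrose B X)"
    unfolding pseudoinverse_def penrose_def by (rule refl)
  ultimately show ?thesis by (simp only:)
qed

text \<open>Both vectors solve the normal equations, so they differ by an element of the null space
  of \<open>B\<close>. The pseudoinverse solution is orthogonal to that space, and Pythagoras
  applies.\<close>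

lemma pseudoinverse_least_norm:
  assumes z: "transpose B *v (B *v z - y) = 0"
  shows "norm (pseudoinverse B *v y) \<le> norm z"
proof -
  let ?X = "pseudoinverse B"
  note P = penrose_pseudoinverse[of B]
  have "transpose B *v (B *v (?X *v y)) = transpose B *v y"
    using penrose_normal_equations[OF P] by (simp add: matrix_vector_mul_assoc)
  then have "transpose B *v (B *v (z - ?X *v y)) = 0"
    using z by (simp add: matrix_vector_mult_diff_distrib)
  then have "B *v (z - ?X *v y) = 0" by (rule transpose_mult_self_eq_0)
  then have "(z - ?X *v y) \<bullet> (transpose B *v ((transpose ?X ** ?X) *v y)) = 0"
    by (simp add: inner_matrix_vector_transpose[symmetric])
  then have "(z - ?X *v y) \<bullet> (?X *v y) = 0"
    using penrose_range[OF P, symmetric] by (simp add: matrix_vector_mul_assoc)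
  then have "orthogonal (?X *v y) (z - ?X *v y)" by (simp add: orthogonal_def inner_commute)
  then have "(norm (?X *v y + (z - ?X *v y)))\<^sup>2 = (norm (?X *v y))\<^sup>2 + (norm (z - ?X *v y))\<^sup>2"
    by (rule norm_add_Pythagorean)
  then have "(norm (?X *v y))\<^sup>2 \<le> (norm z)\<^sup>2" by simp
  then show ?thesis by (rule power2_le_imp_le) simp
qed

section \<open>Diagonal matrices and positive semidefinite square roots\<close>

definition diag_mat :: "real^'m \<Rightarrow> real^'m^'m" where
  "diag_mat q = (\<chi> i j. if i = j then q $ i else 0)"

lemma diag_mat_component: "diag_mat q $ i $ j = (if i = j then q $ i else 0)"
  by (simp add: diag_mat_def)

lemma diag_mat_vector: "(diag_mat q *v x) $ i = q $ i * x $ i"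
  by (simp add: diag_mat_def matrix_vector_mult_def if_distrib[of "\<lambda>c. c * _"] cong: if_cong)

lemma transpose_diag_mat: "transpose (diag_mat q) = diag_mat q"
  by (auto simp: transpose_def diag_mat_def vec_eq_iff)

lemma diag_mat_mult: "diag_mat p ** diag_mat q = diag_mat (\<chi> i. p $ i * q $ i)"
  by (subst matrix_eq) (simp add: vec_eq_iff matrix_vector_mul_assoc[symmetric] diag_mat_vector)

lemma inner_diag_mat: "x \<bullet> (diag_mat q *v y) = (\<Sum>i\<in>UNIV. q $ i * (x $ i * y $ i))"
  unfolding inner_vec_def diag_mat_vector by (rule sum.cong) auto

lemma sym_psd_diag_mat: "(\<And>i. 0 \<le> q $ i) \<Longrightarrow> sym_psd (diag_mat q)"
  unfolding sym_psd_def inner_diag_mat by (simp add: transpose_diag_mat sum_nonneg)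

text \<open>Moving from \<open>w\<close> against \<open>R *v w\<close> by a small step
  \<open>t\<close> changes the quadratic form by \<open>-2 * t\<close> times the squared norm of
  \<open>R *v w\<close>, up to second order. Were that norm positive, the form would become
  negative.\<close>

lemma psd_kernel:
  assumes R: "sym_psd R" and w: "w \<bullet> (R *v w) = 0"
  shows "R *v w = 0"
proof (rule ccontr)
  let ?r = "R *v w"
  assume "?r \<noteq> 0"
  then have a: "0 < ?r \<bullet> ?r" by simp
  define b where "b = ?r \<bullet> (R *v ?r)"
  have b: "0 \<le> b" using R by (simp add: b_def sym_psd_def)
  have sym: "w \<bullet> (R *v ?r) = ?r \<bullet> ?r"
    using inner_matrix_vector_transpose[of R w ?r] R by (simp add: sym_psd_def)
  have "0 \<le> (w - t *\<^sub>R ?r) \<bullet> (R *v (w - t *\<^sub>R ?r))" for t using R by (simp add: sym_psd_def)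
  also have "(w - t *\<^sub>R ?r) \<bullet> (R *v (w - t *\<^sub>R ?r)) = t * (t * b) - 2 * t * (?r \<bullet> ?r)" for t
    using w sym by (simp add: matrix_vector_mult_diff_distrib matrix_vector_mult_scaleR inner_diff_left inner_diff_right b_def algebra_simps)
  finally have q: "0 \<le> t * (t * b) - 2 * t * (?r \<bullet> ?r)" for t .
  define t where "t = (?r \<bullet> ?r) / (b + 1)"
  have t: "0 < t" using a b by (simp add: t_def)
  have "t * b \<le> t * (b + 1)" using t by (intro mult_left_mono) auto
  also have "\<dots> = ?r \<bullet> ?r" using b by (simp add: t_def)
  finally have "t * (t * b) \<le> t * (?r \<bullet> ?r)" using t by (intro mult_left_mono) auto
  then have "0 \<le> - (t * (?r \<bullet> ?r))" using q[of t] by simp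
  then show False using mult_pos_pos[OF t a] by linarith
qed

text \<open>For uniqueness, a root \<open>R\<close> commutes with its square and therefore with
  \<open>?D\<close>, so \<open>(R + ?D) ** (R - ?D)\<close> is zero. Positive semidefiniteness lets
  both \<open>R\<close> and \<open>?D\<close> annihilate the range of \<open>R - ?D\<close>, and by
  symmetry this range is zero.\<close>

lemma psd_sqrt_diag_mat:
  fixes q :: "real^'m"
  assumes q: "\<And>i. 0 \<le> q $ i"
  shows "psd_sqrt (diag_mat q) = diag_mat (\<chi> i. sqrt (q $ i))"
  unfolding psd_sqrt_def
proof (rule the_equality)
  let ?D = "diag_mat (\<chi> i. sqrt (q $ i))"
  have D: "sym_psd ?D" using q by (intro sym_psd_diag_mat) simp
  have DD: "?D ** ?D = diag_mat q" using q by (simp add: diag_mat_mult)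
  show "sym_psd ?D \<and> ?D ** ?D = diag_mat q" using D DD by simp
  fix R assume R: "sym_psd R \<and> R ** R = diag_mat q"
  have "R ** diag_mat q = diag_mat q ** R"
    using R by (metis matrix_mul_assoc)
  then have "(R ** diag_mat q) $ i $ j = (diag_mat q ** R) $ i $ j" for i j by simp
  then have comm: "R $ i $ j * q $ j = q $ i * R $ i $ j" for i j
    by (simp add: matrix_matrix_mult_def diag_mat_def if_distrib[of "\<lambda>c. c * _"] if_distrib[of "\<lambda>c. _ * c"] cong: if_cong)
  \<comment> \<open>A nonzero entry of \<open>R\<close> forces \<open>q $ i = q $ j\<close>, so the
    two square roots agree as well.\<close>
  have comm': "R $ i $ j * sqrt (q $ j) = sqrt (q $ i) * R $ i $ j" for i j
    using comm[of i j] by (cases "R $ i $ j = 0") auto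
  have RD: "R ** ?D = ?D ** R"
    using comm' by (simp add: vec_eq_iff matrix_matrix_mult_def diag_mat_def if_distrib[of "\<lambda>c. c * _"] if_distrib[of "\<lambda>c. _ * c"] cong: if_cong)
  show "R = ?D"
  proof (subst matrix_eq, intro allI)
    fix v
    define w where "w = R *v v - ?D *v v"
    have RDv: "R *v (?D *v v) = ?D *v (R *v v)" using RD by (metis matrix_vector_mul_assoc)
    have RRv: "R *v (R *v v) = ?D *v (?D *v v)" using R DD by (metis matrix_vector_mul_assoc)
    have "R *v w + ?D *v w = 0"
      using RDv RRv by (simp add: w_def matrix_vector_mult_diff_distrib)
    then have "w \<bullet> (R *v w) + w \<bullet> (?D *v w) = 0" by (metis inner_add_right inner_zero_right)
    then have "w \<bullet> (R *v w) = 0" "w \<bullet> (?D *v w) = 0"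
      using R D unfolding sym_psd_def by (smt (verit))+
    then have k: "R *v w = 0" "?D *v w = 0" using R D psd_kernel by blast+
    have sR: "(R *v v) \<bullet> w = v \<bullet> (R *v w)"
      using inner_matrix_vector_transpose[of R v w] R by (simp add: sym_psd_def)
    have sD: "(?D *v v) \<bullet> w = v \<bullet> (?D *v w)"
      using inner_matrix_vector_transpose[of ?D v w] by (simp add: transpose_diag_mat)
    have "w \<bullet> w = (R *v v - ?D *v v) \<bullet> w" by (simp add: w_def)
    also have "\<dots> = 0" unfolding inner_diff_left sR sD k by simp
    finally have "w = 0" by simp
    then show "R *v v = ?D *v v" by (simp add: w_def)
  qed
qed

section \<open>Weighted least squares and the number \<open>\<chi>\<close>\<close>

lemma norm_le_op_norm: "norm ((B::real^'n^'m) *v x) \<le> op_norm B * norm x"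
  unfolding op_norm_def by (rule onorm) simp

lemma op_norm_le: "(\<And>x. norm ((B::real^'n^'m) *v x) \<le> c * norm x) \<Longrightarrow> op_norm B \<le> c"
  unfolding op_norm_def by (rule onorm_le)

lemma op_norm_nonneg: "0 \<le> op_norm (B::real^'n^'m)"
  unfolding op_norm_def by (rule onorm_pos_le) simp

lemma partial_id_vector: "(partial_id R *v x) $ i = (if i \<in> R then x $ i else 0)"
  by (simp add: partial_id_def matrix_vector_mult_def if_distrib[of "\<lambda>c. c * _"] conj_commute cong: if_cong conj_cong)
    (simp add: if_distrib[of "\<lambda>c. c * _"] flip: if_if_eq_conj cong: if_cong)

lemma submatrix_of_vector: "(submatrix_of A R C *v x) $ i = (if i \<in> R then (A *v (partial_id C *v x)) $ i else 0)"
proof -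
  have "A $ i $ j * (if j \<in> C then x $ j else 0) = (if j \<in> C then A $ i $ j else 0) * x $ j" for j by simp
  then show ?thesis by (simp add: submatrix_of_def matrix_vector_mult_def[of A] partial_id_vector)
    (simp add: matrix_vector_mult_def)
qed

text \<open>The support condition makes the partial identities act as units on \<open>B\<close>, so
  the usual computation \<open>B = B (M B') = (B M) B' = B'\<close> goes through for matrices
  extended by zero.\<close>

lemma submatrix_inverse_unique:
  assumes B: "submatrix_inverse A R C B" and B': "submatrix_inverse A R C B'"
  shows "B = B'"
proof -
  let ?M = "submatrix_of A R C"
  have supp: "partial_id C ** D = D" "D ** partial_id R = D" if "submatrix_inverse A R C D" for D
  proof -
    have z: "D $ j $ i = 0" if "\<not> (j \<in> C \<and> i \<in> R)" for i j
      using that \<open>submatrix_inverse A R C D\<close> unfolding submatrix_inverse_def by blast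
    show "partial_id C ** D = D"
    proof (subst matrix_eq, intro allI, subst vec_eq_iff, intro allI)
      fix x j
      have "(D *v x) $ j = 0" if "j \<notin> C" using z that by (simp add: matrix_vector_mult_def)
      then show "(partial_id C ** D *v x) $ j = (D *v x) $ j"
        by (simp add: matrix_vector_mul_assoc[symmetric] partial_id_vector)
    qed
    show "D ** partial_id R = D"
    proof (subst matrix_eq, intro allI, subst vec_eq_iff, intro allI)
      fix x j
      have "D $ j $ i * (partial_id R *v x) $ i = D $ j $ i * x $ i" for i
        using z[of j i] by (auto simp: partial_id_vector)
      then have "(D *v (partial_id R *v x)) $ j = (D *v x) $ j"
        unfolding matrix_vector_mult_def[of D] by (simp only: vec_lambda_beta)
      then show "(D ** partial_id R *v x) $ j = (D *v x) $ j"
        by (simp add: matrix_vector_mul_assoc)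
    qed
  qed
  have "B = B ** (?M ** B')" using supp(2)[OF B] B' by (simp add: submatrix_inverse_def)
  also have "\<dots> = (B ** ?M) ** B'" by (rule matrix_mul_assoc)
  also have "\<dots> = B'" using supp(1)[OF B'] B by (simp add: submatrix_inverse_def)
  finally show ?thesis .
qed

text \<open>The two products of the submatrix with its inverse have equal traces, and these traces
  count \<open>R\<close> and \<open>C\<close>.\<close>

lemma submatrix_inverse_card:
  assumes "submatrix_inverse A R C B" shows "card R = card C"
proof -
  have tr: "trace (partial_id (S::'k set) :: real^'k^'k) = real (card S)" for S
    by (simp add: trace_def partial_id_def sum.If_cases)
  have "trace (submatrix_of A R C ** B) = trace (B ** submatrix_of A R C)" by (rule trace_mul_sym)
  then show ?thesis using assms by (simp add: submatrix_inverse_def tr)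
qed

text \<open>By uniqueness each of the finitely many pairs \<open>(R, C)\<close> contributes at most
  one norm; this makes the \<open>Max\<close> in \<open>chi_number\<close> meaningful.\<close>

lemma chi_number_set_finite:
  "finite {op_norm B |B R C. card R = card C \<and> card R \<ge> 1 \<and> submatrix_inverse (A::real^'n^'m) R C B}"
proof (rule finite_subset)
  show "{op_norm B |B R C. card R = card C \<and> card R \<ge> 1 \<and> submatrix_inverse A R C B}
    \<subseteq> (\<lambda>(R, C). op_norm (THE B. submatrix_inverse A R C B)) ` UNIV"
  proof clarify
    fix B R C assume B: "submatrix_inverse A R C B"
    then have "(THE B. submatrix_inverse A R C B) = B" using submatrix_inverse_unique by blast
    then show "op_norm B \<in> range (\<lambda>(R, C). op_norm (THE B. submatrix_inverse A R C B))"
      by (intro image_eqI[of _ _ "(R, C)"]) auto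
  qed
qed simp

lemma op_norm_submatrix_inverse_le_chi_number:
  assumes "submatrix_inverse A R C B" "R \<noteq> {}"
  shows "op_norm B \<le> chi_number A"
proof -
  obtain r where r: "r \<in> R" using assms(2) by blast
  have "A \<noteq> 0"
  proof
    assume "A = 0"
    then have "submatrix_of A R C = 0" by (simp add: submatrix_of_def vec_eq_iff)
    then have "partial_id R = (0 :: real^'b^'b)" using assms(1) by (simp add: submatrix_inverse_def)
    then have "partial_id R $ r $ r = (0::real)" by simp
    then show False using r by (simp add: partial_id_def)
  qed
  have "card R \<ge> 1" using r by (simp add: Suc_le_eq card_gt_0_iff) blast
  then have "op_norm B \<in> {op_norm B |B R C. card R = card C \<and> card R \<ge> 1 \<and> submatrix_inverse A R C B}"
    using assms(1) submatrix_inverse_card[OF assms(1)] by blast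
  then show ?thesis
    unfolding chi_number_def if_not_P[OF \<open>A \<noteq> 0\<close>] by (rule Max_ge[OF chi_number_set_finite])
qed

lemma chi_number_nonneg: "0 \<le> chi_number (A::real^'n^'m)"
proof (cases "A = 0")
  case True then show ?thesis by (simp add: chi_number_def)
next
  case False
  then obtain r c where rc: "A $ r $ c \<noteq> 0" by (auto simp: vec_eq_iff)
  define B :: "real^'m^'n" where "B = (\<chi> j i. if j = c \<and> i = r then inverse (A $ r $ c) else 0)"
  have "submatrix_inverse A {r} {c} B"
    using rc by (auto simp: submatrix_inverse_def B_def submatrix_of_def partial_id_def vec_eq_iff
        matrix_matrix_mult_def if_distrib[of "\<lambda>x. _ * x"] cong: if_cong)
  then show ?thesis
    using op_norm_submatrix_inverse_le_chi_number order_trans[OF op_norm_nonneg] by blast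
qed

text \<open>Among the row sets inside \<open>R\<close> that still determine vectors supported in
  \<open>C\<close>, one of least cardinality is taken. Minimality supplies the columns of the
  inverse directly, so neither ranks nor determinants are needed.\<close>

lemma submatrix_inverse_exists:
  fixes A :: "real^'n^'m"
  assumes inj: "\<And>y. (\<And>j. j \<notin> C \<Longrightarrow> y $ j = 0) \<Longrightarrow> (\<And>i. i \<in> R \<Longrightarrow> (A *v y) $ i = 0) \<Longrightarrow> y = 0"
  obtains R' B where "R' \<subseteq> R" "submatrix_inverse A R' C B"
proof -
  define W where "W = {y::real^'n. \<forall>j. j \<notin> C \<longrightarrow> y $ j = 0}"
  define P where "P S \<longleftrightarrow> (\<forall>y\<in>W. (\<forall>i\<in>S. (A *v y) $ i = 0) \<longrightarrow> y = 0)" for S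
  have "P R" using inj by (auto simp: P_def W_def)
  then have "\<exists>S. (S \<subseteq> R \<and> P S) \<and> (\<forall>T. T \<subseteq> R \<and> P T \<longrightarrow> card S \<le> card T)"
    by (intro ex_has_least_nat) auto
  then obtain S where S: "S \<subseteq> R" "P S" "\<And>T. T \<subseteq> R \<Longrightarrow> P T \<Longrightarrow> card S \<le> card T" by blast
  \<comment> \<open>Dropping \<open>s\<close> from a minimal \<open>S\<close> destroys injectivity.
    A vector witnessing this is killed by all rows but \<open>s\<close>; scaled, it is the column
    belonging to \<open>s\<close>.\<close>
  have "\<exists>y\<in>W. (\<forall>i\<in>S - {s}. (A *v y) $ i = 0) \<and> (A *v y) $ s = 1" if s: "s \<in> S" for s
  proof -
    have "card (S - {s}) < card S" using s by (intro card_Diff1_less) auto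
    then have "\<not> P (S - {s})" using S(1) S(3)[of "S - {s}"] by auto
    then obtain y where y: "y \<in> W" "\<forall>i\<in>S - {s}. (A *v y) $ i = 0" "y \<noteq> 0" by (auto simp: P_def)
    then have "(A *v y) $ s \<noteq> 0" using S(2) unfolding P_def by blast
    then show ?thesis using y
      by (intro bexI[of _ "inverse ((A *v y) $ s) *\<^sub>R y"])
        (auto simp: W_def matrix_vector_mult_scaleR)
  qed
  then obtain Y where Y: "\<And>s. s \<in> S \<Longrightarrow> Y s \<in> W" "\<And>s i. s \<in> S \<Longrightarrow> i \<in> S \<Longrightarrow> (A *v Y s) $ i = (if i = s then 1 else 0)"
    by (metis DiffI singletonD)
  define B :: "real^'m^'n" where "B = (\<chi> j i. if i \<in> S then Y i $ j else 0)"
  let ?M = "submatrix_of A S C"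
  have Bv: "B *v x = (\<Sum>i\<in>S. x $ i *\<^sub>R Y i)" for x
  proof (subst vec_eq_iff, intro allI)
    fix j
    have "(B *v x) $ j = (\<Sum>i\<in>UNIV. if i \<in> S then x $ i * Y i $ j else 0)"
      unfolding B_def matrix_vector_mult_def by (simp only: vec_lambda_beta) (rule sum.cong, auto)
    also have "\<dots> = (\<Sum>i\<in>S. x $ i * Y i $ j)" by (simp add: sum.If_cases)
    finally show "(B *v x) $ j = (\<Sum>i\<in>S. x $ i *\<^sub>R Y i) $ j" by simp
  qed
  have BW: "B *v x \<in> W" for x
    unfolding Bv using Y(1) by (auto simp: W_def intro!: sum.neutral)
  have idW: "partial_id C *v y = y" if "y \<in> W" for y
    using that by (auto simp: vec_eq_iff partial_id_vector W_def)
  have MB: "?M *v (B *v x) = partial_id S *v x" for x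
  proof (subst vec_eq_iff, intro allI)
    fix i
    have "(A *v (B *v x)) $ i = x $ i" if i: "i \<in> S"
    proof -
      have "A *v (B *v x) = (\<Sum>s\<in>S. x $ s *\<^sub>R (A *v Y s))"
        unfolding Bv by (simp add: matrix_vector_mult_scaleR linear_sum[OF matrix_vector_mul_linear])
      then have "(A *v (B *v x)) $ i = (\<Sum>s\<in>S. x $ s * (A *v Y s) $ i)" by simp
      also have "\<dots> = (\<Sum>s\<in>S. if s = i then x $ s else 0)"
        using Y(2) i by (intro sum.cong) auto
      also have "\<dots> = x $ i" using i by simp
      finally show ?thesis .
    qed
    then show "(?M *v (B *v x)) $ i = (partial_id S *v x) $ i"
      by (simp add: submatrix_of_vector idW[OF BW] partial_id_vector)
  qed
  have BM: "B *v (?M *v x) = partial_id C *v x" for x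
  proof -
    let ?d = "B *v (?M *v x) - partial_id C *v x"
    have "?d \<in> W" using BW[of "?M *v x"] by (simp add: W_def partial_id_vector)
    moreover have "(A *v ?d) $ i = 0" if i: "i \<in> S" for i
    proof -
      have "(A *v (B *v (?M *v x))) $ i = (?M *v (B *v (?M *v x))) $ i"
        using i by (simp add: submatrix_of_vector idW[OF BW])
      also have "\<dots> = (A *v (partial_id C *v x)) $ i"
        using i by (simp add: MB partial_id_vector) (simp add: submatrix_of_vector)
      finally show ?thesis by (simp add: matrix_vector_mult_diff_distrib)
    qed
    ultimately have "?d = 0" using S(2) unfolding P_def by blast
    then show ?thesis by simp
  qed
  have "submatrix_inverse A S C B"
    unfolding submatrix_inverse_def
  proof (intro conjI allI impI)
    fix j i assume "\<not> (j \<in> C \<and> i \<in> S)"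
    then show "B $ j $ i = 0" using Y(1)[of i] by (auto simp: B_def W_def)
  qed (subst matrix_eq, simp add: matrix_vector_mul_assoc[symmetric] MB BM)+
  then show thesis using that S(1) by blast
qed

lemma closed_finite_forall_cart: "closed {z::real^'n. \<forall>i. P i z}" if "\<And>i. closed {z. P i z}" for P :: "'i \<Rightarrow> real^'n \<Rightarrow> bool"
  using closed_INT[of UNIV "\<lambda>i. {z. P i z}"] that by (simp add: Collect_all_eq)

text \<open>
  A least squares solution \<open>u\<close> of minimal support \<open>C\<close> lies in the polytope of the points supported
  in \<open>C\<close> whose residuals have the same signs as those of \<open>u\<close>; the vertices of this polytope are the
  solutions of the invertible square subsystems.
\<close>

lemma weighted_least_squares_bound:
  fixes A :: "real^'n^'m"
  assumes q: "\<And>i. 0 \<le> q $ i"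
  obtains u where "transpose A *v (diag_mat q *v (A *v u - v)) = 0" "norm u \<le> chi_number A * norm v"
proof -
  define LS where "LS u \<longleftrightarrow> transpose A *v (diag_mat q *v (A *v u - v)) = 0" for u
  define D where "D = diag_mat (\<chi> i. sqrt (q $ i))"
  have DD: "D ** D = diag_mat q" using q by (simp add: D_def diag_mat_mult)
  obtain u0 where "transpose (D ** A) *v ((D ** A) *v u0 - D *v v) = 0"
    using least_squares_exists[of "D ** A" "D *v v"] by blast
  moreover have "(D ** A) *v u0 - D *v v = D *v (A *v u0 - v)"
    by (simp add: matrix_vector_mult_diff_distrib matrix_vector_mul_assoc)
  moreover have "transpose (D ** A) = transpose A ** D"
    by (simp add: matrix_transpose_mul D_def transpose_diag_mat)
  ultimately have "LS u0"
    unfolding LS_def DD[symmetric] by (simp add: matrix_vector_mul_assoc matrix_mul_assoc)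
  define supp where "supp u = {j. u $ j \<noteq> 0}" for u :: "real^'n"
  have "\<exists>u. LS u \<and> (\<forall>u'. LS u' \<longrightarrow> card (supp u) \<le> card (supp u'))"
    using \<open>LS u0\<close> by (rule ex_has_least_nat)
  then obtain u where u: "LS u" "\<And>u'. LS u' \<Longrightarrow> card (supp u) \<le> card (supp u')" by blast
  define C where "C = supp u"
  define W where "W = {y::real^'n. \<forall>j. j \<notin> C \<longrightarrow> y $ j = 0}"
  define I0 where "I0 = {i. 0 < q $ i}"
  define r where "r = A *v u - v"
  have inj0: "z = 0" if z: "z \<in> W" "\<And>i. i \<in> I0 \<Longrightarrow> (A *v z) $ i = 0" for z
  proof (rule ccontr)
    assume "z \<noteq> 0"
    then obtain j where j: "z $ j \<noteq> 0" by (auto simp: vec_eq_iff)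
    then have "j \<in> C" using z(1) by (auto simp: W_def)
    \<comment> \<open>Subtracting this multiple of \<open>z\<close> removes coordinate
      \<open>j\<close> from the support without altering the weighted residual, against the
      minimality of the support of \<open>u\<close>.\<close>
    define u' where "u' = u - (u $ j / z $ j) *\<^sub>R z"
    have "q $ i * (A *v z) $ i = 0" for i
      using z(2)[of i] q[of i] by (cases "i \<in> I0") (auto simp: I0_def not_less)
    then have "diag_mat q *v (A *v z) = 0" by (simp add: vec_eq_iff diag_mat_vector)
    then have "LS u'"
      using u(1) by (simp add: LS_def u'_def matrix_vector_mult_diff_distrib matrix_vector_mult_scaleR)
    moreover have "supp u' \<subset> supp u"
    proof
      show "supp u' \<subseteq> supp u" using z(1) by (auto simp: supp_def u'_def W_def C_def)
      have "j \<notin> supp u'" using j by (simp add: supp_def u'_def)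
      then show "supp u' \<noteq> supp u" using \<open>j \<in> C\<close> by (auto simp: C_def)
    qed
    then have "card (supp u') < card (supp u)" by (rule psubset_card_mono[rotated]) simp
    ultimately show False using u(2) by fastforce
  qed
  \<comment> \<open>A product with \<open>r $ i\<close> says that the residuals have compatible
    signs without splitting into cases. It is void where \<open>r $ i = 0\<close>, so these
    coordinates need an equation of their own.\<close>
  define P where "P = {z. (\<forall>j. j \<notin> C \<longrightarrow> z $ j = 0) \<and>
      (\<forall>i. i \<in> I0 \<longrightarrow> 0 \<le> ((A *v z) $ i - v $ i) * r $ i) \<and>
      (\<forall>i. i \<in> I0 \<and> r $ i = 0 \<longrightarrow> (A *v z) $ i - v $ i = 0)}"
  have sgn: "0 \<le> ((A *v z) $ i - v $ i) * r $ i" if "z \<in> P" "i \<in> I0" for z i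
    using that by (simp add: P_def)
  have uP: "u \<in> P" by (auto simp: P_def C_def supp_def r_def)
  have convP: "convex P"
  proof (rule convexI)
    fix x y :: "real^'n" and s t :: real
    assume x: "x \<in> P" and y: "y \<in> P" and st: "0 \<le> s" "0 \<le> t" "s + t = 1"
    have e: "(A *v (s *\<^sub>R x + t *\<^sub>R y)) $ i - v $ i = s * ((A *v x) $ i - v $ i) + t * ((A *v y) $ i - v $ i)" for i
    proof -
      have "v $ i = (s + t) * v $ i" using st by simp
      then show ?thesis by (simp add: matrix_vector_right_distrib matrix_vector_mult_scaleR algebra_simps)
    qed
    have "0 \<le> ((A *v (s *\<^sub>R x + t *\<^sub>R y)) $ i - v $ i) * r $ i" if "i \<in> I0" for i
    proof -
      have "0 \<le> s * (((A *v x) $ i - v $ i) * r $ i) + t * (((A *v y) $ i - v $ i) * r $ i)"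
        by (intro add_nonneg_nonneg mult_nonneg_nonneg[OF st(1) sgn[OF x that]] mult_nonneg_nonneg[OF st(2) sgn[OF y that]])
      then show ?thesis unfolding e by (simp add: algebra_simps)
    qed
    moreover have "(A *v (s *\<^sub>R x + t *\<^sub>R y)) $ i - v $ i = 0" if "i \<in> I0" "r $ i = 0" for i
      unfolding e using x y that by (simp add: P_def)
    ultimately show "s *\<^sub>R x + t *\<^sub>R y \<in> P" using x y by (auto simp: P_def)
  qed
  have contA: "continuous_on S (\<lambda>z. (A *v z) $ i)" for S i
    by (intro continuous_on_component linear_continuous_on) simp
  have "closed {z::real^'n. j \<notin> C \<longrightarrow> z $ j = 0}" for j
    by (cases "j \<in> C") (auto intro!: closed_Collect_eq continuous_intros)
  moreover have "closed {z. i \<in> I0 \<longrightarrow> 0 \<le> ((A *v z) $ i - v $ i) * r $ i}" for i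
    by (cases "i \<in> I0") (auto intro!: closed_Collect_le continuous_intros contA)
  moreover have "closed {z. i \<in> I0 \<and> r $ i = 0 \<longrightarrow> (A *v z) $ i - v $ i = 0}" for i
    by (cases "i \<in> I0 \<and> r $ i = 0") (auto intro!: closed_Collect_eq continuous_intros contA)
  ultimately have closedP: "closed P"
    unfolding P_def by (intro closed_Collect_conj closed_finite_forall_cart)
  have "subspace W" by (auto simp: W_def subspace_def)
  \<comment> \<open>The positively weighted rows of \<open>A\<close> are injective on the subspace
    \<open>W\<close>, hence bounded below there.\<close>
  then obtain e where e: "0 < e" "\<And>z. z \<in> W \<Longrightarrow> e * norm z \<le> norm (partial_id I0 *v (A *v z))"
  proof -
    have "\<exists>e>0. \<forall>x\<in>W. norm ((partial_id I0 ** A) *v x) \<ge> e * norm x"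
    proof (rule injective_imp_isometric)
      show "closed W" using \<open>subspace W\<close> by (rule closed_subspace)
      show "\<forall>x\<in>W. (partial_id I0 ** A) *v x = 0 \<longrightarrow> x = 0"
      proof (intro ballI impI)
        fix x assume x: "x \<in> W" "(partial_id I0 ** A) *v x = 0"
        then have "(partial_id I0 *v (A *v x)) $ i = 0" for i by (simp add: matrix_vector_mul_assoc)
        then show "x = 0" using inj0[OF x(1)] unfolding partial_id_vector by metis
      qed
    qed (use \<open>subspace W\<close> in auto)
    then show thesis using that by (auto simp: matrix_vector_mul_assoc)
  qed
  \<comment> \<open>\<open>K\<close> is the weighted squared residual of \<open>u\<close>. In
    \<open>b\<close>, a quotient with zero denominator is 0 by convention, so one sum covers all
    coordinates.\<close>
  define K where "K = (\<Sum>i\<in>UNIV. q $ i * (r $ i * r $ i))"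
  define b where "b = (\<Sum>i\<in>UNIV. \<bar>v $ i\<bar> + K / (q $ i * \<bar>r $ i\<bar>))"
  have "norm z \<le> b / e" if z: "z \<in> P" for z
  proof -
    have zW: "z \<in> W" using z by (simp add: P_def W_def)
    \<comment> \<open>Testing the normal equation of \<open>u\<close> with \<open>z - u\<close>
      shows that the weighted residual products of \<open>z\<close> and \<open>u\<close> sum to
      \<open>K\<close>. By the sign conditions all summands are nonnegative, so each is at most
      \<open>K\<close>, which bounds the polytope.\<close>
    have "0 = (z - u) \<bullet> (transpose A *v (diag_mat q *v r))" using u(1) by (simp add: LS_def r_def)
    also have "\<dots> = (A *v z - A *v u) \<bullet> (diag_mat q *v r)"
      by (simp add: inner_matrix_vector_transpose[symmetric] matrix_vector_mult_diff_distrib)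
    also have "\<dots> = (\<Sum>i\<in>UNIV. q $ i * (((A *v z) $ i - v $ i) * r $ i)) - K"
      unfolding inner_diag_mat K_def sum_subtractf[symmetric] by (rule sum.cong) (auto simp: r_def algebra_simps)
    finally have K: "(\<Sum>i\<in>UNIV. q $ i * (((A *v z) $ i - v $ i) * r $ i)) = K" by simp
    have nn: "0 \<le> q $ i * (((A *v z) $ i - v $ i) * r $ i)" for i
      using z q[of i] by (cases "i \<in> I0") (auto simp: P_def I0_def)
    have le: "q $ i * (((A *v z) $ i - v $ i) * r $ i) \<le> K" for i
      unfolding K[symmetric] by (rule member_le_sum) (use nn in auto)
    \<comment> \<open>Here \<open>undefined\<close> serves as an arbitrary coordinate; an index type
      is never empty.\<close>
    have K0: "0 \<le> K" using le[of undefined] nn[of undefined] by linarith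
    have comp: "\<bar>(partial_id I0 *v (A *v z)) $ i\<bar> \<le> \<bar>v $ i\<bar> + K / (q $ i * \<bar>r $ i\<bar>)" for i
    proof (cases "i \<in> I0")
      case True
      show ?thesis
      proof (cases "r $ i = 0")
        case True
        then show ?thesis using \<open>i \<in> I0\<close> z by (simp add: partial_id_vector P_def)
      next
        case False
        have qi: "0 < q $ i" using True by (simp add: I0_def)
        have "((A *v z) $ i - v $ i) * r $ i = \<bar>(A *v z) $ i - v $ i\<bar> * \<bar>r $ i\<bar>"
          using z True by (simp add: P_def abs_mult[symmetric])
        then have "\<bar>(A *v z) $ i - v $ i\<bar> * (q $ i * \<bar>r $ i\<bar>) \<le> K" using le[of i] by (simp add: mult_ac)
        then have "\<bar>(A *v z) $ i - v $ i\<bar> \<le> K / (q $ i * \<bar>r $ i\<bar>)"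
          using False qi by (simp add: pos_le_divide_eq)
        then show ?thesis using True by (simp add: partial_id_vector)
      qed
    next
      case False
      then show ?thesis using K0 q[of i] by (simp add: partial_id_vector)
    qed
    have "e * norm z \<le> norm (partial_id I0 *v (A *v z))" by (rule e(2)[OF zW])
    also have "\<dots> \<le> (\<Sum>i\<in>UNIV. \<bar>(partial_id I0 *v (A *v z)) $ i\<bar>)" by (rule norm_le_l1_cart)
    also have "\<dots> \<le> b" unfolding b_def by (rule sum_mono) (rule comp)
    finally show ?thesis using e(1) by (simp add: pos_le_divide_eq mult.commute)
  qed
  then have "bounded P" unfolding bounded_iff by blast
  then have "P = convex hull {z. z extreme_point_of P}"
    using closedP convP by (intro Krein_Milman_Minkowski) (auto simp: compact_eq_bounded_closed)
  moreover have "norm z \<le> chi_number A * norm v" if ext: "z extreme_point_of P" for z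
  proof -
    have z: "z \<in> P" using ext by (simp add: extreme_point_of_def)
    have zW: "z \<in> W" using z by (simp add: P_def W_def)
    \<comment> \<open>The active rows at the vertex \<open>z\<close>: those whose residual vanishes.
      A nonzero direction supported in \<open>C\<close> and killed by all of them could be followed
      a little both ways inside \<open>P\<close>.\<close>
    define R0 where "R0 = {i\<in>I0. (A *v z) $ i - v $ i = 0}"
    have inj: "y = 0" if y: "\<And>j. j \<notin> C \<Longrightarrow> y $ j = 0" "\<And>i. i \<in> R0 \<Longrightarrow> (A *v y) $ i = 0" for y
    proof (rule ccontr)
      assume "y \<noteq> 0"
      define a where "a i = ((A *v z) $ i - v $ i) * r $ i" for i
      have a: "0 < a i" if "i \<in> I0 - R0" for i
        using that z by (auto simp: R0_def a_def P_def less_le)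
      \<comment> \<open>The step is so small that no residual at an inactive row changes sign; the
        sum dominates every individual ratio.\<close>
      define s where "s = inverse (1 + (\<Sum>i\<in>I0 - R0. \<bar>(A *v y) $ i * r $ i\<bar> / a i))"
      have sum0: "0 \<le> (\<Sum>i\<in>I0 - R0. \<bar>(A *v y) $ i * r $ i\<bar> / a i)"
        using a by (intro sum_nonneg divide_nonneg_pos) auto
      have s: "0 < s" using sum0 by (simp add: s_def)
      have sb: "s * \<bar>(A *v y) $ i * r $ i\<bar> \<le> a i" if i: "i \<in> I0 - R0" for i
      proof -
        have "\<bar>(A *v y) $ i * r $ i\<bar> / a i \<le> (\<Sum>i\<in>I0 - R0. \<bar>(A *v y) $ i * r $ i\<bar> / a i)"
          using a by (intro member_le_sum i) (auto intro!: divide_nonneg_pos)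
        also have "\<dots> \<le> inverse s" by (simp add: s_def)
        finally have "\<bar>(A *v y) $ i * r $ i\<bar> \<le> inverse s * a i"
          using a[OF i] by (simp add: pos_divide_le_eq)
        then have "s * \<bar>(A *v y) $ i * r $ i\<bar> \<le> s * (inverse s * a i)"
          using s by (intro mult_left_mono) auto
        also have "\<dots> = a i" using s by simp
        finally show ?thesis .
      qed
      have mem: "z + t *\<^sub>R y \<in> P" if t: "\<bar>t\<bar> = s" for t
      proof -
        have ev: "(A *v (z + t *\<^sub>R y)) $ i - v $ i = ((A *v z) $ i - v $ i) + t * (A *v y) $ i" for i
          by (simp add: matrix_vector_right_distrib matrix_vector_mult_scaleR)
        have "0 \<le> ((A *v (z + t *\<^sub>R y)) $ i - v $ i) * r $ i" if i: "i \<in> I0" for i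
        proof (cases "i \<in> R0")
          case True
          then show ?thesis unfolding ev using y(2)[of i] z i by (simp add: P_def)
        next
          case False
          have "\<bar>t * ((A *v y) $ i * r $ i)\<bar> \<le> a i" using sb[of i] i False t by (simp add: abs_mult)
          moreover have "((A *v (z + t *\<^sub>R y)) $ i - v $ i) * r $ i = a i + t * ((A *v y) $ i * r $ i)"
            unfolding ev a_def by (simp add: algebra_simps)
          ultimately show ?thesis by linarith
        qed
        moreover have "(A *v (z + t *\<^sub>R y)) $ i - v $ i = 0" if i: "i \<in> I0" "r $ i = 0" for i
        proof -
          have "(A *v z) $ i - v $ i = 0" using z i by (simp add: P_def)
          then show ?thesis unfolding ev using y(2)[of i] i by (simp add: R0_def)
        qed
        moreover have "(z + t *\<^sub>R y) $ j = 0" if "j \<notin> C" for j using z y(1) that by (simp add: P_def)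
        ultimately show ?thesis by (simp add: P_def)
      qed
      have "z - s *\<^sub>R y \<in> P" "z + s *\<^sub>R y \<in> P" using mem[of "- s"] mem[of s] s by auto
      moreover have "z \<in> open_segment (z - s *\<^sub>R y) (z + s *\<^sub>R y)"
      proof -
        have "z = midpoint (z - s *\<^sub>R y) (z + s *\<^sub>R y)" by (simp add: midpoint_def vec_eq_iff)
        moreover have "z - s *\<^sub>R y \<noteq> z + s *\<^sub>R y"
        proof
          assume eq: "z - s *\<^sub>R y = z + s *\<^sub>R y"
          have "y $ i = 0" for i using arg_cong[OF eq, of "\<lambda>w. w $ i"] s by simp
          then show False using \<open>y \<noteq> 0\<close> by (simp add: vec_eq_iff)
        qed
        ultimately show ?thesis using midpoint_in_open_segment by metis
      qed
      ultimately show False using ext unfolding extreme_point_of_def by blast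
    qed
    obtain R B where RB: "R \<subseteq> R0" "submatrix_inverse A R C B"
      using submatrix_inverse_exists[OF inj] by blast
    show ?thesis
    proof (cases "R = {}")
      case True
      \<comment> \<open>The maximum in \<open>chi_number\<close> ranges over nonempty row sets only.
        For an empty one the vertex itself is 0.\<close>
      then have "C = {}" using submatrix_inverse_card[OF RB(2)] by (simp add: card_eq_0_iff)
      then have "z = 0" using z by (simp add: P_def vec_eq_iff)
      then show ?thesis using chi_number_nonneg[of A] by simp
    next
      case False
      have idz: "partial_id C *v z = z" using zW by (auto simp: vec_eq_iff partial_id_vector W_def)
      have "B *v (submatrix_of A R C *v z) = z"
        using RB(2) idz by (simp add: matrix_vector_mul_assoc submatrix_inverse_def)
      moreover have "submatrix_of A R C *v z = partial_id R *v v"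
        using RB(1) by (auto simp: vec_eq_iff submatrix_of_vector partial_id_vector idz R0_def)
      ultimately have "norm z \<le> op_norm B * norm (partial_id R *v v)" by (metis norm_le_op_norm)
      also have "\<dots> \<le> chi_number A * norm v"
      proof (rule mult_mono)
        show "op_norm B \<le> chi_number A" by (rule op_norm_submatrix_inverse_le_chi_number[OF RB(2) False])
        show "norm (partial_id R *v v) \<le> norm v"
          by (rule norm_le_componentwise_cart) (simp add: partial_id_vector)
      qed (use chi_number_nonneg in auto)
      finally show ?thesis .
    qed
  qed
  then have "convex hull {z. z extreme_point_of P} \<subseteq> cball 0 (chi_number A * norm v)"
    by (intro hull_minimal) auto
  ultimately have "norm u \<le> chi_number A * norm v" using uP by auto
  then show thesis using that u(1) by (simp add: LS_def)
qed

text \<open>With \<open>H = A\<^sup>T diag(q) A\<close>, the equation says \<open>(H + \<epsilon>) \<xi> = H u\<close> for a least squares solution \<open>u\<close>.\<close>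

lemma regularized_least_squares_bound:
  fixes A :: "real^'n^'m"
  assumes q: "\<And>i. 0 \<le> q $ i" and "0 < \<epsilon>"
    and eq: "transpose A *v (diag_mat q *v (A *v \<xi> - v)) + \<epsilon> *\<^sub>R \<xi> = 0"
  shows "norm \<xi> \<le> chi_number A * norm v"
proof -
  obtain u where u: "transpose A *v (diag_mat q *v (A *v u - v)) = 0" "norm u \<le> chi_number A * norm v"
    by (rule weighted_least_squares_bound[OF q])
  have "\<epsilon> *\<^sub>R \<xi> = transpose A *v (diag_mat q *v (A *v (u - \<xi>)))"
    using eq u(1) by (simp add: matrix_vector_mult_diff_distrib algebra_simps add_eq_0_iff)
  then have "\<epsilon> * ((u - \<xi>) \<bullet> \<xi>) = (A *v (u - \<xi>)) \<bullet> (diag_mat q *v (A *v (u - \<xi>)))"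
    by (metis inner_matrix_vector_transpose inner_scaleR_right)
  moreover have "0 \<le> (A *v (u - \<xi>)) \<bullet> (diag_mat q *v (A *v (u - \<xi>)))"
    using sym_psd_diag_mat[of q] q by (simp add: sym_psd_def)
  ultimately have "0 \<le> \<epsilon> * ((u - \<xi>) \<bullet> \<xi>)" by simp
  \<comment> \<open>Together with Cauchy-Schwarz this gives \<open>norm \<xi> \<le> norm u\<close>:
    regularization never exceeds a given least squares solution in norm.\<close>
  then have "0 \<le> (u - \<xi>) \<bullet> \<xi>" using \<open>0 < \<epsilon>\<close> by (simp add: zero_le_mult_iff)
  then have "norm \<xi> * norm \<xi> \<le> u \<bullet> \<xi>" by (simp add: inner_diff_left norm_eq_square[symmetric] power2_norm_eq_inner[symmetric] power2_eq_square)
  also have "\<dots> \<le> norm u * norm \<xi>" by (rule norm_cauchy_schwarz)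
  finally have "norm \<xi> \<le> norm u" by (cases "\<xi> = 0") auto
  then show ?thesis using u(2) by simp
qed

text \<open>With \<open>D\<close> the square root of the weights, this is the normal equation of the
  pseudoinverse of \<open>D ** A\<close>, multiplied by \<open>D\<close> from the right.\<close>

lemma huber_range_factor_eq:
  fixes A :: "real^'n^'m"
  assumes q: "\<And>i. 0 \<le> q $ i"
  shows "- (transpose A ** diag_mat q) = (transpose A ** diag_mat q ** A) ** huber_range_factor A (diag_mat q)"
proof -
  define D where "D = diag_mat (\<chi> i. sqrt (q $ i))"
  have sq: "psd_sqrt (diag_mat q) = D" unfolding D_def by (rule psd_sqrt_diag_mat[OF q])
  have DD: "D ** D = diag_mat q" using q by (simp add: D_def diag_mat_mult)
  have t: "transpose (D ** A) = transpose A ** D"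
    by (simp add: matrix_transpose_mul D_def transpose_diag_mat)
  let ?X = "pseudoinverse (D ** A)"
  have n: "transpose A ** D ** (D ** A ** ?X) = transpose A ** D"
    using penrose_normal_equations[OF penrose_pseudoinverse[of "D ** A"]] by (simp add: t)
  have neg: "M ** (- N) = - (M ** N)" for M :: "real^'p^'q" and N :: "real^'r^'p"
    by (simp add: matrix_matrix_mult_def vec_eq_iff sum_negf)
  have "transpose A ** diag_mat q ** A ** (?X ** D) = (transpose A ** D ** (D ** A ** ?X)) ** D"
    unfolding DD[symmetric] by (simp add: matrix_mul_assoc)
  also have "\<dots> = transpose A ** diag_mat q" unfolding n DD[symmetric] by (simp add: matrix_mul_assoc)
  finally show ?thesis unfolding huber_range_factor_def sq neg by simp
qed

text \<open>Weighted least squares for \<open>A\<close> and \<open>v\<close> is ordinary least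
  squares for \<open>D ** A\<close> and \<open>D *v v\<close>. The pseudoinverse picks the solution
  of least norm there, so it inherits the bound of any other solution.\<close>

lemma op_norm_huber_range_factor:
  fixes A :: "real^'n^'m"
  assumes q: "\<And>i. 0 \<le> q $ i"
  shows "op_norm (huber_range_factor A (diag_mat q)) \<le> chi_number A"
proof (rule op_norm_le)
  fix v
  define D where "D = diag_mat (\<chi> i. sqrt (q $ i))"
  have sq: "psd_sqrt (diag_mat q) = D" unfolding D_def by (rule psd_sqrt_diag_mat[OF q])
  have DD: "D ** D = diag_mat q" using q by (simp add: D_def diag_mat_mult)
  obtain u where u: "transpose A *v (diag_mat q *v (A *v u - v)) = 0" "norm u \<le> chi_number A * norm v"
    by (rule weighted_least_squares_bound[OF q])
  have "transpose (D ** A) *v ((D ** A) *v u - D *v v) = transpose A *v (diag_mat q *v (A *v u - v))"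
    unfolding DD[symmetric]
    by (simp add: matrix_transpose_mul D_def transpose_diag_mat matrix_vector_mul_assoc matrix_mul_assoc
        matrix_vector_mult_diff_distrib)
  then have "norm (pseudoinverse (D ** A) *v (D *v v)) \<le> norm u"
    using u(1) by (intro pseudoinverse_least_norm) simp
  moreover have "(- M) *v v = - (M *v v)" for M :: "real^'m^'n"
    by (simp add: matrix_vector_mult_def vec_eq_iff sum_negf)
  ultimately show "norm (huber_range_factor A (diag_mat q) *v v) \<le> chi_number A * norm v"
    using u(2) by (simp add: huber_range_factor_def sq matrix_vector_mul_assoc)
qed

section \<open>Definable sets and maps\<close>

locale o_minimal_expansion =
  fixes S :: "nat \<Rightarrow> real list set set"
  assumes o_minimal: "o_minimal_expansion_of_real_field S"
begin

section \<open>Closure properties of a structure on tuples\<close>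

lemma S_structure: "structure_on_reals S"
  using o_minimal by (simp add: o_minimal_expansion_of_real_field_def)

lemma S_subset: "X \<in> S n \<Longrightarrow> X \<subseteq> tuples n"
  using S_structure unfolding structure_on_reals_def by blast

lemma S_Compl: "X \<in> S n \<Longrightarrow> tuples n - X \<in> S n"
  using S_structure unfolding structure_on_reals_def by blast

lemma S_Un: "X \<in> S n \<Longrightarrow> Y \<in> S n \<Longrightarrow> X \<union> Y \<in> S n"
  using S_structure unfolding structure_on_reals_def by blast

lemma S_Int:
  assumes "X \<in> S n" "Y \<in> S n" shows "X \<inter> Y \<in> S n"
proof -
  have "X \<inter> Y = tuples n - ((tuples n - X) \<union> (tuples n - Y))" using S_subset assms by blast
  then show ?thesis using assms by (simp add: S_Compl S_Un)
qed

lemma S_tuples: "tuples n \<in> S n"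
proof -
  have "{} \<in> S n" using S_structure unfolding structure_on_reals_def by blast
  from S_Compl[OF this] show ?thesis by simp
qed

lemma S_INT:
  assumes "finite I" "\<And>i. i \<in> I \<Longrightarrow> X i \<in> S n"
  shows "{xs \<in> tuples n. \<forall>i\<in>I. xs \<in> X i} \<in> S n"
  using assms
proof (induction I rule: finite_induct)
  case empty then show ?case by (simp add: S_tuples)
next
  case (insert i I)
  have "{xs \<in> tuples n. \<forall>i\<in>insert i I. xs \<in> X i} = X i \<inter> {xs \<in> tuples n. \<forall>i\<in>I. xs \<in> X i}"
    using S_subset insert.prems by blast
  then show ?case using insert by (simp add: S_Int)
qed

lemma S_drop:
  assumes "X \<in> S n" shows "{xs \<in> tuples (k + n). drop k xs \<in> X} \<in> S (k + n)"
proof (induction k)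
  case 0
  have "{xs \<in> tuples n. xs \<in> X} = X" using S_subset assms by blast
  then show ?case using assms by simp
next
  case (Suc k)
  have "{x # xs |x xs. xs \<in> {xs \<in> tuples (k + n). drop k xs \<in> X}} \<in> S (Suc (k + n))"
    using S_structure Suc unfolding structure_on_reals_def by blast
  moreover have "{x # xs |x xs. xs \<in> {xs \<in> tuples (k + n). drop k xs \<in> X}} = {xs \<in> tuples (Suc k + n). drop (Suc k) xs \<in> X}"
    by (auto simp: tuples_def length_Suc_conv)
  ultimately show ?case by simp
qed

lemma S_take:
  assumes "X \<in> S n" shows "{xs \<in> tuples (n + k). take n xs \<in> X} \<in> S (n + k)"
proof (induction k)
  case 0
  have "xs \<in> tuples n \<and> take n xs \<in> X \<longleftrightarrow> xs \<in> X" for xs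
  proof (cases "xs \<in> tuples n")
    case True then show ?thesis by (simp add: tuples_def)
  next
    case False then show ?thesis using S_subset[OF assms] by blast
  qed
  then have "{xs \<in> tuples n. take n xs \<in> X} = X" by blast
  then show ?case using assms by simp
next
  case (Suc k)
  have "{xs @ [x] |x xs. xs \<in> {xs \<in> tuples (n + k). take n xs \<in> X}} \<in> S (Suc (n + k))"
    using S_structure Suc unfolding structure_on_reals_def by blast
  moreover have "{xs @ [x] |x xs. xs \<in> {xs \<in> tuples (n + k). take n xs \<in> X}} = {xs \<in> tuples (n + Suc k). take n xs \<in> X}"
    by (auto simp: tuples_def length_Suc_conv_rev)
  ultimately show ?case by simp
qed

text \<open>The axiom only equates the first and the last entry. It is applied to the block from
  \<open>i\<close> to \<open>j\<close>, and the remaining coordinates are added before and after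
  that block.\<close>

lemma S_diagonal:
  assumes "i < n" "j < n" shows "{xs \<in> tuples n. xs ! i = xs ! j} \<in> S n"
proof -
  have le: "{xs \<in> tuples n. xs ! i = xs ! j} \<in> S n" if "i \<le> j" "j < n" for i j
  proof -
    define m where "m = Suc (j - i)"
    have D: "{xs \<in> tuples m. hd xs = last xs} \<in> S m"
      using S_structure unfolding structure_on_reals_def m_def by auto
    define k where "k = n - Suc j"
    have n: "n = i + m + k" using that by (simp add: m_def k_def)
    have "{xs \<in> tuples (i + m + k). take (i + m) xs \<in> {xs \<in> tuples (i + m). drop i xs \<in> {xs \<in> tuples m. hd xs = last xs}}} \<in> S (i + m + k)"
      by (intro S_take S_drop D)
    moreover have "hd (drop i (take (i + m) xs)) = xs ! i" "last (drop i (take (i + m) xs)) = xs ! j"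
      if "length xs = i + m + k" for xs :: "real list"
      using that \<open>i \<le> j\<close> by (simp_all add: m_def hd_drop_conv_nth last_conv_nth)
    then have "{xs \<in> tuples (i + m + k). take (i + m) xs \<in> {xs \<in> tuples (i + m). drop i xs \<in> {xs \<in> tuples m. hd xs = last xs}}}
      = {xs \<in> tuples n. xs ! i = xs ! j}"
      unfolding n by (auto simp: tuples_def)
    ultimately show ?thesis by (simp add: n)
  qed
  show ?thesis
  proof (cases "i \<le> j")
    case True then show ?thesis using le assms by blast
  next
    case False
    then have "{xs \<in> tuples n. xs ! j = xs ! i} \<in> S n" using le assms by simp
    then show ?thesis by (simp add: eq_commute)
  qed
qed

lemma S_projection: "X \<in> S (n + k) \<Longrightarrow> take n ` X \<in> S n"
proof (induction k arbitrary: X)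
  case 0
  then have "take n ` X = X" using S_subset[OF 0] by (force simp: tuples_def)
  with 0 show ?case by simp
next
  case (Suc k)
  then have "butlast ` X \<in> S (n + k)" using S_structure unfolding structure_on_reals_def by simp
  then have "take n ` butlast ` X \<in> S n" by (rule Suc.IH)
  moreover have "take n (butlast xs) = take n xs" if "xs \<in> X" for xs
    using S_subset[OF Suc.prems] that by (auto simp: tuples_def take_butlast)
  then have "take n ` butlast ` X = take n ` X" by (simp add: image_image cong: image_cong)
  ultimately show ?case by simp
qed

text \<open>Fresh coordinates carrying the point of \<open>X\<close> are appended, tied to the
  selected entries by diagonals, and projected away. Permuting, repeating and ignoring variables are
  all covered.\<close>

lemma S_substitution:
  assumes X: "X \<in> S k" and ns: "length ns = k" "\<And>i. i \<in> set ns \<Longrightarrow> i < n"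
  shows "{xs \<in> tuples n. map ((!) xs) ns \<in> X} \<in> S n"
proof -
  define Z where "Z = {zs \<in> tuples (n + k). drop n zs \<in> X} \<inter>
     {zs \<in> tuples (n + k). \<forall>j\<in>{..<k}. zs \<in> {zs \<in> tuples (n + k). zs ! (n + j) = zs ! (ns ! j)}}"
  have "ns ! j < n + k" if "j < k" for j using ns(2)[of "ns ! j"] that ns(1) by simp
  then have "Z \<in> S (n + k)" unfolding Z_def by (intro S_Int S_drop X S_INT S_diagonal) auto
  then have "take n ` Z \<in> S n" by (rule S_projection)
  moreover have "take n ` Z = {xs \<in> tuples n. map ((!) xs) ns \<in> X}"
  proof (intro equalityI subsetI)
    fix xs assume "xs \<in> take n ` Z"
    then obtain zs where zs: "length zs = n + k" "drop n zs \<in> X" "\<And>j. j < k \<Longrightarrow> zs ! (n + j) = zs ! (ns ! j)" "xs = take n zs"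
      by (auto simp: Z_def tuples_def)
    have "map ((!) xs) ns = drop n zs"
      using zs ns by (intro nth_equalityI) auto
    then show "xs \<in> {xs \<in> tuples n. map ((!) xs) ns \<in> X}" using zs by (simp add: tuples_def)
  next
    fix xs assume xs: "xs \<in> {xs \<in> tuples n. map ((!) xs) ns \<in> X}"
    then have "xs @ map ((!) xs) ns \<in> Z"
      using ns by (auto simp: Z_def tuples_def nth_append)
    moreover have "take n (xs @ map ((!) xs) ns) = xs" using xs by (simp add: tuples_def)
    ultimately show "xs \<in> take n ` Z" by (metis imageI)
  qed
  ultimately show ?thesis by simp
qed

section \<open>Definable subsets of Euclidean spaces\<close>

definition coords :: "'a::euclidean_space list \<Rightarrow> 'a \<Rightarrow> real list" where
  "coords bs x = map (\<lambda>b. x \<bullet> b) bs"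

definition basis_list :: "'a::euclidean_space list \<Rightarrow> bool" where
  "basis_list bs \<longleftrightarrow> distinct bs \<and> set bs = Basis"

lemma basis_list_length: "basis_list (bs :: 'a::euclidean_space list) \<Longrightarrow> length bs = DIM('a)"
  by (metis basis_list_def distinct_card)

lemma basis_list_exists: obtains bs :: "'a::euclidean_space list" where "basis_list bs"
  using finite_distinct_list[OF finite_Basis] by (metis basis_list_def)

lemma coords_eq_iff:
  assumes "basis_list bs" shows "coords bs x = coords bs y \<longleftrightarrow> x = y"
  using assms by (auto simp: coords_def basis_list_def intro: euclidean_eqI)

lemma coords_surj:
  assumes bs: "basis_list bs" and xs: "length xs = length bs"
  obtains x where "coords bs x = xs"
proof
  let ?x = "\<Sum>i<length bs. xs ! i *\<^sub>R bs ! i"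
  have "?x \<bullet> bs ! j = xs ! j" if j: "j < length bs" for j
  proof -
    have "?x \<bullet> bs ! j = (\<Sum>i<length bs. xs ! i * (bs ! i \<bullet> bs ! j))" by (simp add: inner_sum_left)
    also have "\<dots> = (\<Sum>i<length bs. if i = j then xs ! i else 0)"
    proof (rule sum.cong)
      fix i assume "i \<in> {..<length bs}"
      then have "i < length bs" by simp
      then have "bs ! i \<in> set bs" "bs ! j \<in> set bs" using j nth_mem by blast+
      moreover have "bs ! i = bs ! j \<longleftrightarrow> i = j"
        using bs j \<open>i < length bs\<close> unfolding basis_list_def by (simp only: nth_eq_iff_index_eq)
      ultimately have "bs ! i \<in> Basis" "bs ! j \<in> Basis" "bs ! i = bs ! j \<longleftrightarrow> i = j"
        using bs unfolding basis_list_def by blast+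
      then show "xs ! i * (bs ! i \<bullet> bs ! j) = (if i = j then xs ! i else 0)" by (simp add: inner_Basis)
    qed simp
    finally show ?thesis using j by simp
  qed
  then show "coords bs ?x = xs" using xs by (intro nth_equalityI) (auto simp: coords_def)
qed

lemma definable_alt: "definable S (X::'a::euclidean_space set) \<longleftrightarrow> (\<forall>bs. basis_list bs \<longrightarrow> coords bs ` X \<in> S DIM('a))"
  by (simp add: definable_def basis_list_def coords_def[abs_def])

text \<open>These are the substitutions of variables: every output coordinate is some input
  coordinate. Preimages under them need only \<open>S_substitution\<close>, before any arithmetic is
  available.\<close>

definition coordinate_map :: "('a::euclidean_space \<Rightarrow> 'b::euclidean_space) \<Rightarrow> bool" where
  "coordinate_map T \<longleftrightarrow> (\<forall>b\<in>Basis. \<exists>b'\<in>Basis. \<forall>x. T x \<bullet> b = x \<bullet> b')"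

lemma coordinate_map_id: "coordinate_map (\<lambda>x. x)"
  by (auto simp: coordinate_map_def)

lemma coordinate_map_fst: "coordinate_map f \<Longrightarrow> coordinate_map (\<lambda>x. fst (f x))"
  by (force simp: coordinate_map_def Basis_prod_def inner_prod_def)

lemma coordinate_map_snd: "coordinate_map f \<Longrightarrow> coordinate_map (\<lambda>x. snd (f x))"
  by (force simp: coordinate_map_def Basis_prod_def inner_prod_def)

lemma coordinate_map_Pair: "coordinate_map f \<Longrightarrow> coordinate_map g \<Longrightarrow> coordinate_map (\<lambda>x. (f x, g x))"
  by (auto simp: coordinate_map_def Basis_prod_def inner_prod_def)

lemma coordinate_map_inner: "coordinate_map f \<Longrightarrow> b \<in> Basis \<Longrightarrow> coordinate_map (\<lambda>x. f x \<bullet> b)"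
  by (simp add: coordinate_map_def)

lemmas coordinate_map_intros =
  coordinate_map_id coordinate_map_fst coordinate_map_snd coordinate_map_Pair coordinate_map_inner

lemma coords_coordinate_map:
  fixes Y :: "'b::euclidean_space set" and T :: "'a::euclidean_space \<Rightarrow> 'b"
  assumes cs: "basis_list cs" and Y: "coords cs ` Y \<in> S DIM('b)" and T: "coordinate_map T" and bs: "basis_list bs"
  shows "coords bs ` {x. T x \<in> Y} \<in> S DIM('a)"
proof -
  have "\<exists>i<length bs. \<forall>x. T x \<bullet> b = x \<bullet> bs ! i" if "b \<in> set cs" for b
    using T that cs bs unfolding coordinate_map_def basis_list_def by (metis in_set_conv_nth)
  then obtain f where f: "\<And>b. b \<in> set cs \<Longrightarrow> f b < length bs" "\<And>b x. b \<in> set cs \<Longrightarrow> T x \<bullet> b = x \<bullet> bs ! f b"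
    by metis
  have m: "map ((!) (coords bs x)) (map f cs) = coords cs (T x)" for x
    using f by (simp add: coords_def)
  have "{xs \<in> tuples DIM('a). map ((!) xs) (map f cs) \<in> coords cs ` Y} \<in> S DIM('a)"
    by (rule S_substitution[OF Y]) (use f basis_list_length[OF bs] basis_list_length[OF cs] in auto)
  moreover have "{xs \<in> tuples DIM('a). map ((!) xs) (map f cs) \<in> coords cs ` Y} = coords bs ` {x. T x \<in> Y}"
  proof (intro equalityI subsetI)
    fix xs assume xs: "xs \<in> {xs \<in> tuples DIM('a). map ((!) xs) (map f cs) \<in> coords cs ` Y}"
    then obtain x where x: "coords bs x = xs"
      using coords_surj[OF bs, of xs] basis_list_length[OF bs] by (auto simp: tuples_def)
    have "coords cs (T x) \<in> coords cs ` Y" using xs m[of x] x by auto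
    then have "T x \<in> Y" by (auto simp: coords_eq_iff[OF cs])
    then show "xs \<in> coords bs ` {x. T x \<in> Y}" using x by auto
  next
    fix xs assume "xs \<in> coords bs ` {x. T x \<in> Y}"
    then obtain x where x: "T x \<in> Y" "xs = coords bs x" by auto
    then show "xs \<in> {xs \<in> tuples DIM('a). map ((!) xs) (map f cs) \<in> coords cs ` Y}"
      using m[of x] basis_list_length[OF bs] by (auto simp: tuples_def coords_def)
  qed
  ultimately show ?thesis by simp
qed

text \<open>Changing the enumeration of the basis is a substitution of variables by the identity
  map, so checking one enumeration is enough.\<close>

lemma definableI:
  assumes "basis_list bs" "coords bs ` (X::'a::euclidean_space set) \<in> S DIM('a)"
  shows "definable S X"
proof -
  have "coordinate_map (\<lambda>x::'a. x)" by (auto simp: coordinate_map_def)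
  from coords_coordinate_map[OF assms this] show ?thesis by (simp add: definable_alt)
qed

lemma definableD: "definable S (X::'a::euclidean_space set) \<Longrightarrow> basis_list bs \<Longrightarrow> coords bs ` X \<in> S DIM('a)"
  by (simp add: definable_alt)

lemma definable_coordinate_map:
  fixes Y :: "'b::euclidean_space set"
  assumes "definable S Y" "coordinate_map T" shows "definable S {x. T x \<in> Y}"
proof -
  obtain cs :: "'b list" where cs: "basis_list cs" by (rule basis_list_exists)
  show ?thesis
    unfolding definable_alt using coords_coordinate_map[OF cs definableD[OF assms(1) cs] assms(2)] by blast
qed

lemma definable_Compl:
  assumes "definable S {x::'a::euclidean_space. P x}" shows "definable S {x. \<not> P x}"
proof -
  obtain bs :: "'a list" where bs: "basis_list bs" by (rule basis_list_exists)
  have "coords bs ` {x. \<not> P x} = tuples DIM('a) - coords bs ` {x. P x}"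
  proof (intro equalityI subsetI)
    fix xs assume xs: "xs \<in> tuples DIM('a) - coords bs ` {x. P x}"
    then obtain x where x: "coords bs x = xs"
      using coords_surj[OF bs, of xs] basis_list_length[OF bs] by (auto simp: tuples_def)
    with xs show "xs \<in> coords bs ` {x. \<not> P x}" by auto
  qed (auto simp: coords_eq_iff[OF bs] tuples_def basis_list_length[OF bs, symmetric], simp add: coords_def)
  then show ?thesis using definableI[OF bs] S_Compl[OF definableD[OF assms bs]] by simp
qed

lemma definable_disj:
  assumes "definable S {x::'a::euclidean_space. P x}" "definable S {x. Q x}" shows "definable S {x. P x \<or> Q x}"
proof -
  obtain bs :: "'a list" where bs: "basis_list bs" by (rule basis_list_exists)
  have "coords bs ` {x. P x \<or> Q x} = coords bs ` {x. P x} \<union> coords bs ` {x. Q x}" by blast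
  then have "coords bs ` {x. P x \<or> Q x} \<in> S DIM('a)"
    by (simp only:) (intro S_Un definableD[OF _ bs] assms)
  then show ?thesis by (rule definableI[OF bs])
qed

lemma definable_conj:
  assumes "definable S {x::'a::euclidean_space. P x}" "definable S {x. Q x}" shows "definable S {x. P x \<and> Q x}"
  using definable_Compl[OF definable_disj[OF definable_Compl[OF assms(1)] definable_Compl[OF assms(2)]]] by simp

lemma definable_imp:
  assumes "definable S {x::'a::euclidean_space. P x}" "definable S {x. Q x}" shows "definable S {x. P x \<longrightarrow> Q x}"
  using definable_disj[OF definable_Compl[OF assms(1)] assms(2)] by (simp only: imp_conv_disj)

lemma definable_UNIV: "definable S (UNIV::'a::euclidean_space set)"
proof -
  obtain bs :: "'a list" where bs: "basis_list bs" by (rule basis_list_exists)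
  have "coords bs ` UNIV = tuples DIM('a)"
  proof (intro equalityI subsetI)
    fix xs assume "xs \<in> tuples DIM('a)"
    then have "length xs = length bs" using basis_list_length[OF bs] by (simp add: tuples_def)
    then obtain x where "coords bs x = xs" by (rule coords_surj[OF bs])
    then show "xs \<in> range (coords bs)" by blast
  qed (use basis_list_length[OF bs] in \<open>auto simp: tuples_def coords_def\<close>)
  then have "coords bs ` UNIV \<in> S DIM('a)" by (simp only: S_tuples)
  then show ?thesis by (rule definableI[OF bs])
qed

lemma definable_ball:
  assumes "finite I" "\<And>i. i \<in> I \<Longrightarrow> definable S {x::'a::euclidean_space. P i x}"
  shows "definable S {x. \<forall>i\<in>I. P i x}"
  using assms by (induction I rule: finite_induct) (simp_all add: definable_UNIV definable_conj)

lemma definable_all_finite: "(\<And>i. definable S {x::'a::euclidean_space. P i x}) \<Longrightarrow> definable S {x. \<forall>i::'i::finite. P i x}"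
  using definable_ball[of UNIV P] by simp

lemma basis_list_prod:
  assumes "basis_list as" "basis_list bs" shows "basis_list (map (\<lambda>a. (a, 0)) as @ map (\<lambda>b. (0, b)) bs)"
  using assms unfolding basis_list_def Basis_prod_def
  by (auto simp: distinct_map inj_on_def nonzero_Basis)

text \<open>The basis of the product is enumerated with the coordinates of \<open>y\<close> last, so
  that the projection axiom eliminates exactly these.\<close>

lemma definable_ex:
  assumes "definable S {p::'a::euclidean_space \<times> 'b::euclidean_space. P (fst p) (snd p)}"
  shows "definable S {x. \<exists>y. P x y}"
proof -
  obtain as :: "'a list" where as: "basis_list as" by (rule basis_list_exists)
  obtain bs :: "'b list" where bs: "basis_list bs" by (rule basis_list_exists)
  let ?cs = "map (\<lambda>a. (a, 0)) as @ map (\<lambda>b. (0, b)) bs"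
  have c: "coords ?cs (x, y) = coords as x @ coords bs y" for x y by (simp add: coords_def)
  have t: "take DIM('a) (coords as x @ coords bs y) = coords as x" for x y
    using basis_list_length[OF as] by (simp add: coords_def)
  have "coords ?cs ` {p. P (fst p) (snd p)} \<in> S (DIM('a) + DIM('b))"
    using definableD[OF assms basis_list_prod[OF as bs]] by simp
  then have "take DIM('a) ` coords ?cs ` {p. P (fst p) (snd p)} \<in> S DIM('a)" by (rule S_projection)
  moreover have "take DIM('a) ` coords ?cs ` {p. P (fst p) (snd p)} = coords as ` {x. \<exists>y. P x y}"
  proof (intro equalityI subsetI)
    fix xs assume "xs \<in> coords as ` {x. \<exists>y. P x y}"
    then obtain x y where xy: "P x y" "xs = coords as x" by auto
    have "xs = take DIM('a) (coords ?cs (x, y))" unfolding c t xy(2) ..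
    moreover have "(x, y) \<in> {p. P (fst p) (snd p)}" using xy(1) by simp
    ultimately show "xs \<in> take DIM('a) ` coords ?cs ` {p. P (fst p) (snd p)}" by blast
  next
    fix xs assume "xs \<in> take DIM('a) ` coords ?cs ` {p. P (fst p) (snd p)}"
    then obtain x y where xy: "P x y" "xs = take DIM('a) (coords ?cs (x, y))" by force
    then show "xs \<in> coords as ` {x. \<exists>y. P x y}" unfolding c t by blast
  qed
  ultimately show ?thesis using definableI[OF as] by simp
qed

lemma definable_all:
  assumes "definable S {p::'a::euclidean_space \<times> 'b::euclidean_space. P (fst p) (snd p)}"
  shows "definable S {x. \<forall>y. P x y}"
  using definable_Compl[OF definable_ex[OF definable_Compl[OF assms]]] by simp

text \<open>Only graphs of scalar components occur. Terms can thus be assembled one coordinate at a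
  time from the scalar operations of the structure.\<close>

definition definable_map :: "('a::euclidean_space \<Rightarrow> 'b::euclidean_space) \<Rightarrow> bool" where
  "definable_map f \<longleftrightarrow> (\<forall>b\<in>Basis. definable S {p::'a \<times> real. snd p = f (fst p) \<bullet> b})"

text \<open>Substituting a term into a formula amounts to quantifying over its value:
  \<open>Q (f x)\<close> holds iff some \<open>y\<close> agrees with \<open>f x\<close> in every
  coordinate and satisfies \<open>Q\<close>.\<close>

lemma definable_comp:
  assumes Y: "definable S {y::'b::euclidean_space. Q y}" and f: "definable_map (f::'a::euclidean_space \<Rightarrow> 'b)"
  shows "definable S {x. Q (f x)}"
proof -
  have "definable S {p::'a \<times> 'b. \<forall>b\<in>Basis. snd p \<bullet> b = f (fst p) \<bullet> b}"
  proof (rule definable_ball)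
    fix b :: 'b assume b: "b \<in> Basis"
    have "coordinate_map (\<lambda>p::'a \<times> 'b. (fst p, snd p \<bullet> b))"
      using b by (intro coordinate_map_intros)
    from definable_coordinate_map[OF _ this, of "{p. snd p = f (fst p) \<bullet> b}"]
    show "definable S {p::'a \<times> 'b. snd p \<bullet> b = f (fst p) \<bullet> b}"
      using f b by (simp add: definable_map_def)
  qed simp
  moreover have "coordinate_map (\<lambda>p::'a \<times> 'b. snd p)"
    by (intro coordinate_map_intros)
  from definable_coordinate_map[OF Y this] have "definable S {p::'a \<times> 'b. Q (snd p)}" by simp
  ultimately have "definable S {p::'a \<times> 'b. (\<forall>b\<in>Basis. snd p \<bullet> b = f (fst p) \<bullet> b) \<and> Q (snd p)}"
    by (rule definable_conj)
  then have "definable S {x. \<exists>y. (\<forall>b\<in>Basis. y \<bullet> b = f x \<bullet> b) \<and> Q y}" by (rule definable_ex)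
  moreover have "(\<exists>y. (\<forall>b\<in>Basis. y \<bullet> b = f x \<bullet> b) \<and> Q y) \<longleftrightarrow> Q (f x)" for x
    using euclidean_eq_iff by metis
  ultimately show ?thesis by simp
qed

lemma definable_eq_real: "definable S {p::real \<times> real. fst p = snd p}"
proof (rule definableI[of "[(1, 0), (0, 1)]"])
  show "basis_list [(1::real, 0::real), (0, 1)]" by (auto simp: basis_list_def Basis_prod_def)
  have "{xs \<in> tuples 2. hd xs = last xs} \<in> S 2" using S_structure unfolding structure_on_reals_def by auto
  moreover have "coords [(1, 0), (0, 1)] ` {p::real \<times> real. fst p = snd p} = {xs \<in> tuples 2. hd xs = last xs}"
    by (auto simp: coords_def tuples_def numeral_2_eq_2 length_Suc_conv inner_prod_def image_iff)
  ultimately show "coords [(1, 0), (0, 1)] ` {p::real \<times> real. fst p = snd p} \<in> S DIM(real \<times> real)"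
      by (simp add: numeral_2_eq_2)
qed

section \<open>Terms built from definable maps\<close>

lemma definable_map_id: "definable_map (\<lambda>x::'a::euclidean_space. x)"
  unfolding definable_map_def
proof
  fix b :: 'a assume b: "b \<in> Basis"
  have "coordinate_map (\<lambda>p::'a \<times> real. (snd p, fst p \<bullet> b))"
    using b by (intro coordinate_map_intros)
  from definable_coordinate_map[OF definable_eq_real this]
  show "definable S {p::'a \<times> real. snd p = fst p \<bullet> b}" by simp
qed

lemma definable_map_fst: "definable_map f \<Longrightarrow> definable_map (\<lambda>x. fst (f x))"
  unfolding definable_map_def by (force simp: Basis_prod_def inner_prod_def)

lemma definable_map_snd: "definable_map f \<Longrightarrow> definable_map (\<lambda>x. snd (f x))"
  unfolding definable_map_def by (force simp: Basis_prod_def inner_prod_def)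

lemma definable_map_Pair: "definable_map f \<Longrightarrow> definable_map g \<Longrightarrow> definable_map (\<lambda>x. (f x, g x))"
  unfolding definable_map_def by (auto simp: Basis_prod_def inner_prod_def)

lemma definable_map_comp_fst:
  assumes "definable_map (f::'a::euclidean_space \<Rightarrow> 'b::euclidean_space)"
  shows "definable_map (\<lambda>p::'a \<times> 'c::euclidean_space. f (fst p))"
  unfolding definable_map_def
proof
  fix b :: 'b assume b: "b \<in> Basis"
  have "coordinate_map (\<lambda>p::('a \<times> 'c) \<times> real. (fst (fst p), snd p))"
    by (intro coordinate_map_intros)
  from definable_coordinate_map[OF _ this, of "{p. snd p = f (fst p) \<bullet> b}"]
  show "definable S {p::('a \<times> 'c) \<times> real. snd p = f (fst (fst p)) \<bullet> b}"
    using assms b by (simp add: definable_map_def)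
qed

lemma definable_map_real: "definable_map (f::'a::euclidean_space \<Rightarrow> real) \<longleftrightarrow> definable S {p. snd p = f (fst p)}"
  by (simp add: definable_map_def)

lemma definable_eq:
  assumes f: "definable_map (f::'a::euclidean_space \<Rightarrow> 'b::euclidean_space)" and g: "definable_map g"
  shows "definable S {x. f x = g x}"
proof -
  have "definable S {x. g x \<bullet> b = f x \<bullet> b}" if b: "b \<in> Basis" for b
  proof -
    have "coordinate_map (\<lambda>p::'a \<times> 'b. (fst p, snd p \<bullet> b))"
      using b by (intro coordinate_map_intros)
    from definable_coordinate_map[OF _ this, of "{p. snd p = f (fst p) \<bullet> b}"]
    have "definable S {p. snd p \<bullet> b = f (fst p) \<bullet> b}" using f b by (simp add: definable_map_def)
    from definable_comp[OF this definable_map_Pair[OF definable_map_id g]]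
    show ?thesis by simp
  qed
  then have "definable S {x. \<forall>b\<in>Basis. g x \<bullet> b = f x \<bullet> b}" by (intro definable_ball) auto
  moreover have "{x. \<forall>b\<in>Basis. g x \<bullet> b = f x \<bullet> b} = {x. f x = g x}" using euclidean_eq_iff by metis
  ultimately show ?thesis by simp
qed

lemma definable_triple:
  assumes "{[x, y, F x y] |x y. True} \<in> S 3"
  shows "definable S {p::real \<times> real \<times> real. snd (snd p) = F (fst p) (fst (snd p))}"
proof (rule definableI[of "[(1, 0, 0), (0, 1, 0), (0, 0, 1)]"])
  show "basis_list [(1::real, 0::real, 0::real), (0, 1, 0), (0, 0, 1)]"
    by (auto simp: basis_list_def Basis_prod_def zero_prod_def)
  have "coords [(1, 0, 0), (0, 1, 0), (0, 0, 1)] ` {p::real \<times> real \<times> real. snd (snd p) = F (fst p) (fst (snd p))}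
     = {[x, y, F x y] |x y. True}"
    by (auto simp: coords_def inner_prod_def image_iff)
  then show "coords [(1, 0, 0), (0, 1, 0), (0, 0, 1)] ` {p::real \<times> real \<times> real. snd (snd p) = F (fst p) (fst (snd p))}
     \<in> S DIM(real \<times> real \<times> real)"
    using assms by (simp add: numeral_3_eq_3)
qed

lemma definable_map_binary:
  fixes f g :: "'a::euclidean_space \<Rightarrow> real"
  assumes F: "{[x, y, F x y] |x y. True} \<in> S 3" and f: "definable_map f" and g: "definable_map g"
  shows "definable_map (\<lambda>x. F (f x) (g x))"
  using definable_comp[OF definable_triple[OF F] definable_map_Pair[OF definable_map_comp_fst[OF f]
      definable_map_Pair[OF definable_map_comp_fst[OF g] definable_map_snd[OF definable_map_id]]]]
  by (simp add: definable_map_real)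

lemma definable_map_add:
  fixes f g :: "'a::euclidean_space \<Rightarrow> real"
  assumes "definable_map f" "definable_map g" shows "definable_map (\<lambda>x. f x + g x)"
  by (rule definable_map_binary[of "\<lambda>x y. x + y", OF _ assms])
    (use o_minimal in \<open>simp add: o_minimal_expansion_of_real_field_def\<close>)

lemma definable_map_mult:
  fixes f g :: "'a::euclidean_space \<Rightarrow> real"
  assumes "definable_map f" "definable_map g" shows "definable_map (\<lambda>x. f x * g x)"
  by (rule definable_map_binary[of "\<lambda>x y. x * y", OF _ assms])
    (use o_minimal in \<open>simp add: o_minimal_expansion_of_real_field_def\<close>)

lemma definable_map_const: "definable_map (\<lambda>x::'a::euclidean_space. c::'b::euclidean_space)"
  unfolding definable_map_def
proof
  fix b :: 'b
  have "definable S {c \<bullet> b}"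
  proof (rule definableI[of "[1]"])
    have "(\<lambda>x. [x]) ` (\<Union>{{c \<bullet> b}}) \<in> {(\<lambda>x. [x]) ` (\<Union>I) |I::real set set. finite I \<and> (\<forall>i\<in>I. is_interval i)}"
      by (intro CollectI exI[of _ "{{c \<bullet> b}}"]) (simp add: is_interval_1)
    then have "(\<lambda>x. [x]) ` {c \<bullet> b} \<in> S 1"
      using o_minimal unfolding o_minimal_expansion_of_real_field_def by simp
    then show "coords [1] ` {c \<bullet> b} \<in> S DIM(real)" by (simp add: coords_def)
  qed (simp add: basis_list_def)
  then have "definable S {y. y = c \<bullet> b}" by simp
  from definable_comp[OF this definable_map_snd[OF definable_map_id]]
  show "definable S {p::'a \<times> real. snd p = c \<bullet> b}" by simp
qed

lemma definable_map_minus: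
  fixes f :: "'a::euclidean_space \<Rightarrow> real"
  assumes "definable_map f" shows "definable_map (\<lambda>x. - f x)"
proof -
  have "definable_map (\<lambda>x. (-1) * f x)" by (intro definable_map_mult definable_map_const assms)
  then show ?thesis by simp
qed

lemma definable_map_diff:
  fixes f g :: "'a::euclidean_space \<Rightarrow> real"
  assumes "definable_map f" "definable_map g" shows "definable_map (\<lambda>x. f x - g x)"
proof -
  have "definable_map (\<lambda>x. f x + (- g x))" by (intro definable_map_add definable_map_minus assms)
  then show ?thesis by simp
qed

lemma definable_map_sum:
  fixes f :: "'i \<Rightarrow> 'a::euclidean_space \<Rightarrow> real"
  assumes "\<And>i. i \<in> I \<Longrightarrow> definable_map (f i)"
  shows "definable_map (\<lambda>x. \<Sum>i\<in>I. f i x)"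
  using assms
proof (induction I rule: infinite_finite_induct)
  case (insert i I)
  then have "definable_map (\<lambda>x. f i x + (\<Sum>i\<in>I. f i x))" by (intro definable_map_add) auto
  then show ?case using insert.hyps by simp
qed (simp_all add: definable_map_const)

lemma definable_map_nth:
  fixes f :: "'a::euclidean_space \<Rightarrow> 'b::euclidean_space^'n"
  assumes "definable_map f" shows "definable_map (\<lambda>x. f x $ i)"
  unfolding definable_map_def
proof
  fix b :: 'b assume "b \<in> Basis"
  then have "axis i b \<in> Basis" by (auto simp: Basis_vec_def)
  with assms have "definable S {p. snd p = f (fst p) \<bullet> axis i b}" by (simp add: definable_map_def)
  then show "definable S {p. snd p = f (fst p) $ i \<bullet> b}" by (simp add: inner_axis)
qed

lemma definable_map_vec:
  assumes "\<And>i. definable_map (\<lambda>x. f x i)"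
  shows "definable_map (\<lambda>x::'a::euclidean_space. (\<chi> i. f x i) :: 'b::euclidean_space^'n)"
  using assms by (auto simp: definable_map_def Basis_vec_def inner_axis)

lemma definable_less:
  fixes f g :: "'a::euclidean_space \<Rightarrow> real"
  assumes f: "definable_map f" and g: "definable_map g"
  shows "definable S {x. f x < g x}"
proof -
  have "definable S {p::real \<times> real. fst p < snd p}"
  proof (rule definableI[of "[(1, 0), (0, 1)]"])
    show "basis_list [(1::real, 0::real), (0, 1)]" by (auto simp: basis_list_def Basis_prod_def)
    have "{[x, y] |x y. x < y} \<in> S 2" using o_minimal by (simp add: o_minimal_expansion_of_real_field_def)
    moreover have "coords [(1, 0), (0, 1)] ` {p::real \<times> real. fst p < snd p} = {[x, y] |x y. x < y}"
      by (auto simp: coords_def inner_prod_def image_iff)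
    ultimately show "coords [(1, 0), (0, 1)] ` {p::real \<times> real. fst p < snd p} \<in> S DIM(real \<times> real)"
      by (simp add: numeral_2_eq_2)
  qed
  from definable_comp[OF this definable_map_Pair[OF f g]] show ?thesis by simp
qed

lemma definable_le:
  fixes f g :: "'a::euclidean_space \<Rightarrow> real"
  shows "definable_map f \<Longrightarrow> definable_map g \<Longrightarrow> definable S {x. f x \<le> g x}"
  using definable_Compl[OF definable_less[of g f]] by (simp add: not_less)

lemmas definable_intros = definable_conj definable_disj definable_imp definable_all_finite definable_Compl
  definable_ex definable_all definable_eq definable_less definable_le
  definable_map_id definable_map_fst definable_map_snd definable_map_Pair definable_map_add definable_map_mult
  definable_map_diff definable_map_minus definable_map_const definable_map_sum definable_map_nth definable_map_vec

lemma definable_map_if: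
  fixes f g :: "'a::euclidean_space \<Rightarrow> real"
  assumes "definable S {x. P x}" "definable_map f" "definable_map g"
  shows "definable_map (\<lambda>x. if P x then f x else g x)"
proof -
  have P: "definable S {p::'a \<times> real. P (fst p)}"
    using definable_comp[OF assms(1) definable_map_fst[OF definable_map_id]] by simp
  have "definable S {p. (P (fst p) \<longrightarrow> snd p = f (fst p)) \<and> (\<not> P (fst p) \<longrightarrow> snd p = g (fst p))}"
    by (intro definable_intros P definable_map_comp_fst assms)
  moreover have "{p. (P (fst p) \<longrightarrow> snd p = f (fst p)) \<and> (\<not> P (fst p) \<longrightarrow> snd p = g (fst p))}
    = {p. snd p = (if P (fst p) then f (fst p) else g (fst p))}" by auto
  ultimately show ?thesis by (simp add: definable_map_real)
qed

end

section \<open>The Huber loss and its regularized solutions\<close>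

definition clip :: "real \<Rightarrow> real" where
  "clip t = max (-1) (min 1 t)"

definition clip_vec :: "real^'m \<Rightarrow> real^'m" where
  "clip_vec y = (\<chi> i. clip (y $ i))"

lemma clip_lipschitz: "\<bar>clip s - clip t\<bar> \<le> \<bar>s - t\<bar>"
  by (auto simp: clip_def max_def min_def)

text \<open>The Huber function is the supremum of the affine functions
  \<open>a * s - a^2 / 2\<close> over slopes \<open>a\<close> in [-1, 1], attained at
  \<open>a = clip s\<close>. Convexity and the subgradient inequality follow from this form.\<close>

lemma huber_ge:
  assumes a: "\<bar>a\<bar> \<le> 1" shows "a * s - a\<^sup>2 / 2 \<le> huber s"
proof (cases "\<bar>s\<bar> \<le> 1")
  case True
  have "0 \<le> (s - a)\<^sup>2" by simp
  then show ?thesis using True by (simp add: huber_def power2_diff algebra_simps)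
next
  case False
  have "0 \<le> (1 - \<bar>a\<bar>) * (\<bar>s\<bar> - (1 + \<bar>a\<bar>) / 2)" using a False by (intro mult_nonneg_nonneg) auto
  then have "0 \<le> \<bar>s\<bar> - 1 / 2 - \<bar>a\<bar> * \<bar>s\<bar> + \<bar>a\<bar> * \<bar>a\<bar> / 2" by (simp add: field_simps)
  moreover have "a * s \<le> \<bar>a\<bar> * \<bar>s\<bar>" by (simp add: abs_mult[symmetric])
  moreover have "\<bar>a\<bar> * \<bar>a\<bar> = a\<^sup>2" by (simp add: power2_eq_square)
  ultimately show ?thesis using False by (simp add: huber_def)
qed

lemma huber_eq: "huber t = clip t * t - (clip t)\<^sup>2 / 2"
  by (auto simp: huber_def clip_def max_def min_def power2_eq_square)

lemma huber_convex_bound: "huber t + clip t * (s - t) \<le> huber s"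
proof -
  have "\<bar>clip t\<bar> \<le> 1" by (simp add: clip_def)
  from huber_ge[OF this, of s] show ?thesis by (simp add: huber_eq[of t] algebra_simps)
qed

text \<open>Swapping the two points in the subgradient inequality leaves a difference of values of
  \<open>clip\<close>, which is at most the distance of the points. The constant 1 is not optimal,
  but any finite one serves.\<close>

lemma huber_smooth_bound: "huber s \<le> huber t + clip t * (s - t) + (s - t)\<^sup>2"
proof -
  have "huber s \<le> huber t + clip t * (s - t) + (clip s - clip t) * (s - t)"
    using huber_convex_bound[of s t] by (simp add: algebra_simps)
  also have "(clip s - clip t) * (s - t) \<le> \<bar>clip s - clip t\<bar> * \<bar>s - t\<bar>" by (simp add: abs_mult[symmetric])
  also have "\<dots> \<le> \<bar>s - t\<bar> * \<bar>s - t\<bar>" by (intro mult_right_mono clip_lipschitz) simp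
  finally show ?thesis by (simp add: power2_eq_square abs_mult[symmetric])
qed

lemma huber_loss_convex_bound: "huber_loss y + clip_vec y \<bullet> (z - y) \<le> huber_loss z"
  unfolding huber_loss_def clip_vec_def inner_vec_def sum.distrib[symmetric]
  by (rule sum_mono) (use huber_convex_bound in simp)

lemma huber_loss_smooth_bound: "huber_loss z \<le> huber_loss y + clip_vec y \<bullet> (z - y) + (norm (z - y))\<^sup>2"
  unfolding huber_loss_def clip_vec_def power2_norm_eq_inner inner_vec_def sum.distrib[symmetric]
  by (rule sum_mono) (use huber_smooth_bound in \<open>simp add: power2_eq_square\<close>)

text \<open>A linear lower and a quadratic upper bound at every point. They yield differentiability,
  convexity and the description of minimizers as zeros of \<open>D\<close>, and they survive
  composition with \<open>A\<close> and adding the regularizer.\<close>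

definition smooth_convex :: "('a::real_inner \<Rightarrow> real) \<Rightarrow> ('a \<Rightarrow> 'a) \<Rightarrow> bool" where
  "smooth_convex g D \<longleftrightarrow> (\<exists>K\<ge>0. \<forall>x z. g x + D x \<bullet> (z - x) \<le> g z \<and>
      g z \<le> g x + D x \<bullet> (z - x) + K * (norm (z - x))\<^sup>2)"

lemma smooth_convex_GDERIV:
  assumes "smooth_convex g D" shows "GDERIV g x :> D x"
proof -
  obtain K where K: "0 \<le> K" "\<And>z. g x + D x \<bullet> (z - x) \<le> g z"
    "\<And>z. g z \<le> g x + D x \<bullet> (z - x) + K * (norm (z - x))\<^sup>2"
    using assms unfolding smooth_convex_def by blast
  show ?thesis
    unfolding gderiv_def has_derivative_at_alt
  proof (intro conjI allI impI)
    show "bounded_linear (\<lambda>h. h \<bullet> D x)" by (rule bounded_linear_inner_left)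
    fix e :: real assume e: "0 < e"
    have "norm (g y - g x - (y - x) \<bullet> D x) \<le> e * norm (y - x)" if y: "norm (y - x) < e / (K + 1)" for y
    proof -
      have "norm (g y - g x - (y - x) \<bullet> D x) \<le> K * norm (y - x) * norm (y - x)"
        using K(2,3)[of y] by (simp add: inner_commute power2_eq_square mult.assoc)
      also have "\<dots> \<le> e * norm (y - x)"
      proof (rule mult_right_mono)
        have "K * norm (y - x) \<le> (K + 1) * norm (y - x)" by (intro mult_right_mono) auto
        also have "\<dots> \<le> e" using y K(1) by (simp add: pos_less_divide_eq mult.commute)
        finally show "K * norm (y - x) \<le> e" .
      qed simp
      finally show ?thesis .
    qed
    then show "\<exists>d>0. \<forall>y. norm (y - x) < d \<longrightarrow> norm (g y - g x - (y - x) \<bullet> D x) \<le> e * norm (y - x)"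
      using e K(1) by (intro exI[of _ "e / (K + 1)"]) auto
  qed
qed

lemma gradient_eqI: "GDERIV g x :> D \<Longrightarrow> gradient g x = D"
  unfolding gradient_def
proof (rule the_equality)
  fix D' assume "GDERIV g x :> D" "GDERIV g x :> D'"
  then have "(\<lambda>h. h \<bullet> D') = (\<lambda>h. h \<bullet> D)" unfolding gderiv_def by (rule has_derivative_unique[rotated])
  then show "D' = D" by (metis vector_eq_ldot)
qed

lemma smooth_convex_gradient: "smooth_convex g D \<Longrightarrow> gradient g = D"
  by (rule ext) (rule gradient_eqI[OF smooth_convex_GDERIV])

lemma smooth_convex_continuous_on: "smooth_convex g D \<Longrightarrow> continuous_on X g"
  using smooth_convex_GDERIV[of g D] unfolding gderiv_def
  by (meson has_derivative_continuous continuous_at_imp_continuous_on)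

lemma smooth_convex_convex_on:
  fixes g :: "'a::real_inner \<Rightarrow> real"
  assumes "smooth_convex g D" shows "convex_on UNIV g"
proof (rule convex_onI)
  fix t :: real and x y :: 'a assume t: "0 < t" "t < 1"
  let ?w = "(1 - t) *\<^sub>R x + t *\<^sub>R y"
  have lb: "g ?w + D ?w \<bullet> (z - ?w) \<le> g z" for z using assms unfolding smooth_convex_def by blast
  have "(1 - t) * (g ?w + D ?w \<bullet> (x - ?w)) + t * (g ?w + D ?w \<bullet> (y - ?w)) \<le> (1 - t) * g x + t * g y"
    using t by (intro add_mono mult_left_mono lb) auto
  moreover have "(1 - t) * (g ?w + D ?w \<bullet> (x - ?w)) + t * (g ?w + D ?w \<bullet> (y - ?w))
      = g ?w + D ?w \<bullet> ((1 - t) *\<^sub>R (x - ?w) + t *\<^sub>R (y - ?w))"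
    unfolding inner_add_right inner_scaleR_right by (simp add: algebra_simps)
  moreover have "(1 - t) *\<^sub>R (x - ?w) + t *\<^sub>R (y - ?w) = 0"
    by (simp add: algebra_simps)
  ultimately show "g ?w \<le> (1 - t) * g x + t * g y" by simp
qed simp

lemma smooth_convex_argmin_set:
  assumes "smooth_convex g D" shows "argmin_set g = {x. D x = 0}"
proof -
  obtain K where K: "0 \<le> K" "\<And>x z. g x + D x \<bullet> (z - x) \<le> g z"
    "\<And>x z. g z \<le> g x + D x \<bullet> (z - x) + K * (norm (z - x))\<^sup>2"
    using assms unfolding smooth_convex_def by blast
  have "x \<in> argmin_set g \<longleftrightarrow> D x = 0" for x
  proof
    assume "D x = 0"
    then have "g x \<le> g z" for z using K(2)[of x z] by simp
    then show "x \<in> argmin_set g" by (simp add: argmin_set_def is_arg_min_linorder)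
  next
    assume x: "x \<in> argmin_set g"
    show "D x = 0"
    proof (rule ccontr)
      assume "D x \<noteq> 0"
      then have n: "0 < (norm (D x))\<^sup>2" by simp
      \<comment> \<open>The step length of a gradient step: \<open>K * t < 1\<close> makes the
        linear decrease beat the quadratic error.\<close>
      define t where "t = 1 / (2 * (K + 1))"
      have t: "0 < t" "K * t < 1" using K(1) by (auto simp: t_def field_simps)
      have "g x \<le> g (x - t *\<^sub>R D x)" using x by (simp add: argmin_set_def is_arg_min_linorder)
      also have "\<dots> \<le> g x - t * (norm (D x))\<^sup>2 + K * (t * norm (D x))\<^sup>2"
        using K(3)[of "x - t *\<^sub>R D x" x] t(1) by (simp add: power2_norm_eq_inner)
      finally have "t * (norm (D x))\<^sup>2 \<le> (K * t) * (t * (norm (D x))\<^sup>2)"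
        by (simp add: power_mult_distrib power2_eq_square[of t] algebra_simps)
      moreover have "(K * t) * (t * (norm (D x))\<^sup>2) < 1 * (t * (norm (D x))\<^sup>2)"
        using t n by (intro mult_strict_right_mono) auto
      ultimately show False by simp
    qed
  qed
  then show ?thesis by blast
qed

lemma smooth_convex_huber_loss: "smooth_convex huber_loss clip_vec"
  unfolding smooth_convex_def
  using huber_loss_convex_bound huber_loss_smooth_bound by (intro exI[of _ 1]) auto

section \<open>Regularized and minimal-norm solutions\<close>

definition regularized_gradient :: "real^'n^'m \<Rightarrow> real \<Rightarrow> real^'m \<Rightarrow> real^'n \<Rightarrow> real^'n" where
  "regularized_gradient A \<epsilon> \<theta> x = transpose A *v clip_vec (A *v x - \<theta>) + \<epsilon> *\<^sub>R x"

lemma smooth_convex_regularized: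
  fixes A :: "real^'n^'m"
  assumes "0 \<le> \<epsilon>"
  shows "smooth_convex (\<lambda>x. huber_objective A x \<theta> + \<epsilon> / 2 * (norm x)\<^sup>2) (regularized_gradient A \<epsilon> \<theta>)"
  unfolding smooth_convex_def
proof (intro exI[of _ "(op_norm A)\<^sup>2 + \<epsilon> / 2"] conjI allI)
  fix x z :: "real^'n"
  have sq: "\<epsilon> / 2 * (norm z)\<^sup>2 = \<epsilon> / 2 * (norm x)\<^sup>2 + (\<epsilon> *\<^sub>R x) \<bullet> (z - x) + \<epsilon> / 2 * (norm (z - x))\<^sup>2"
    by (simp add: power2_norm_eq_inner inner_diff_left inner_diff_right inner_commute[of z x] algebra_simps)
  have zx: "A *v z - \<theta> - (A *v x - \<theta>) = A *v (z - x)" by (simp add: matrix_vector_mult_diff_distrib)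
  have ip: "regularized_gradient A \<epsilon> \<theta> x \<bullet> (z - x) = clip_vec (A *v x - \<theta>) \<bullet> (A *v (z - x)) + (\<epsilon> *\<^sub>R x) \<bullet> (z - x)"
    unfolding regularized_gradient_def inner_add_left
    using inner_matrix_vector_transpose[of A "z - x" "clip_vec (A *v x - \<theta>)"]
    by (simp add: inner_commute)
  have e: "0 \<le> \<epsilon> / 2 * (norm (z - x))\<^sup>2" using assms by simp
  show "huber_objective A x \<theta> + \<epsilon> / 2 * (norm x)\<^sup>2 + regularized_gradient A \<epsilon> \<theta> x \<bullet> (z - x)
      \<le> huber_objective A z \<theta> + \<epsilon> / 2 * (norm z)\<^sup>2"
    unfolding sq ip huber_objective_def
    using huber_loss_convex_bound[of "A *v x - \<theta>" "A *v z - \<theta>"] e unfolding zx by linarith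
  have "(norm (A *v (z - x)))\<^sup>2 \<le> (op_norm A * norm (z - x))\<^sup>2"
    by (rule power_mono[OF norm_le_op_norm]) simp
  then have "(norm (A *v (z - x)))\<^sup>2 + \<epsilon> / 2 * (norm (z - x))\<^sup>2 \<le> ((op_norm A)\<^sup>2 + \<epsilon> / 2) * (norm (z - x))\<^sup>2"
    by (simp add: power_mult_distrib algebra_simps)
  then show "huber_objective A z \<theta> + \<epsilon> / 2 * (norm z)\<^sup>2
      \<le> huber_objective A x \<theta> + \<epsilon> / 2 * (norm x)\<^sup>2 + regularized_gradient A \<epsilon> \<theta> x \<bullet> (z - x)
        + ((op_norm A)\<^sup>2 + \<epsilon> / 2) * (norm (z - x))\<^sup>2"
    unfolding sq ip huber_objective_def
    using huber_loss_smooth_bound[of "A *v z - \<theta>" "A *v x - \<theta>"] unfolding zx by linarith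
qed (use assms in simp)

lemma smooth_convex_huber_objective:
  "smooth_convex (\<lambda>x. huber_objective A x \<theta>) (\<lambda>x. transpose A *v clip_vec (A *v x - \<theta>))"
  using smooth_convex_regularized[of 0 A \<theta>] by (simp add: regularized_gradient_def[abs_def])

text \<open>The weights are difference quotients of \<open>clip\<close>, nonnegative by monotonicity
  and 0 by convention where coordinates coincide. As the identity is exact, estimates for linear
  weighted problems carry over to the nonlinear one.\<close>

lemma clip_vec_chord:
  obtains q :: "real^'m" where "\<And>i. 0 \<le> q $ i" "clip_vec y - clip_vec y' = diag_mat q *v (y - y')"
proof
  let ?q = "\<chi> i. (clip (y $ i) - clip (y' $ i)) / (y $ i - y' $ i)"
  show "0 \<le> ?q $ i" for i
    by (cases "y $ i \<le> y' $ i") (auto intro: divide_nonpos_nonpos divide_nonneg_nonneg simp: clip_def max_def min_def)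
  show "clip_vec y - clip_vec y' = diag_mat ?q *v (y - y')"
    by (simp add: vec_eq_iff clip_vec_def diag_mat_vector)
qed

lemma clip_vec_lipschitz: "norm (clip_vec y - clip_vec y') \<le> norm (y - y')"
  by (rule norm_le_componentwise_cart) (simp add: clip_vec_def clip_lipschitz)

text \<open>The difference of two optimality conditions is, with chord weights, a regularized
  weighted least squares equation with data \<open>\<theta> - \<theta>'\<close>. The constant is the
  same for all \<open>\<epsilon>\<close>; with equal parameters the estimate also gives
  uniqueness.\<close>

lemma regularized_solution_lipschitz:
  fixes A :: "real^'n^'m"
  assumes "0 < \<epsilon>" "regularized_gradient A \<epsilon> \<theta> x = 0" "regularized_gradient A \<epsilon> \<theta>' x' = 0"
  shows "norm (x - x') \<le> chi_number A * norm (\<theta> - \<theta>')"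
proof -
  obtain q where q: "\<And>i. 0 \<le> q $ i" "clip_vec (A *v x - \<theta>) - clip_vec (A *v x' - \<theta>')
      = diag_mat q *v (A *v x - \<theta> - (A *v x' - \<theta>'))"
    using clip_vec_chord[of "A *v x - \<theta>" "A *v x' - \<theta>'"] by blast
  have "transpose A *v (clip_vec (A *v x - \<theta>) - clip_vec (A *v x' - \<theta>')) + \<epsilon> *\<^sub>R (x - x') = 0"
    using assms(2,3) by (simp add: regularized_gradient_def matrix_vector_mult_diff_distrib scaleR_diff_right algebra_simps add_eq_0_iff)
  moreover have "A *v x - \<theta> - (A *v x' - \<theta>') = A *v (x - x') - (\<theta> - \<theta>')" by (simp add: matrix_vector_mult_diff_distrib)
  ultimately show ?thesis using q by (intro regularized_least_squares_bound[OF q(1) assms(1)]) simp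
qed

lemma regularized_argmin_nonempty:
  fixes A :: "real^'n^'m"
  assumes "0 < \<epsilon>"
  shows "argmin_set (\<lambda>x. huber_objective A x \<theta> + \<epsilon> / 2 * (norm x)\<^sup>2) \<noteq> {}"
proof -
  define g where "g x = huber_objective A x \<theta> + \<epsilon> / 2 * (norm x)\<^sup>2" for x
  have nn: "\<epsilon> / 2 * (norm x)\<^sup>2 \<le> g x" for x
    using huber_ge[of 0] by (auto simp: g_def huber_objective_def huber_loss_def intro!: sum_nonneg)
  then have g0: "0 \<le> g 0" using nn[of 0] by simp
  \<comment> \<open>Outside this ball the regularizer alone is at least \<open>g 0\<close>, so a
    minimizer over the ball is global.\<close>
  define r where "r = sqrt (2 * g 0 / \<epsilon>)"
  have r: "0 \<le> r" "\<epsilon> / 2 * r\<^sup>2 = g 0" using g0 assms by (auto simp: r_def)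
  have "continuous_on (cball 0 r) g"
    unfolding g_def by (rule smooth_convex_continuous_on[OF smooth_convex_regularized[OF less_imp_le[OF assms]]])
  then obtain x where x: "x \<in> cball 0 r" "\<And>y. y \<in> cball 0 r \<Longrightarrow> g x \<le> g y"
    using continuous_attains_inf[of "cball 0 r" g] r(1) by (auto simp: compact_cball)
  have "g x \<le> g y" for y
  proof (cases "y \<in> cball 0 r")
    case False
    then have "r\<^sup>2 \<le> (norm y)\<^sup>2" using r(1) by (intro power_mono) auto
    then have "\<epsilon> / 2 * r\<^sup>2 \<le> \<epsilon> / 2 * (norm y)\<^sup>2" using assms by (intro mult_left_mono) auto
    then show ?thesis using nn[of y] r x(2)[of 0] by simp
  qed (rule x(2))
  then show ?thesis unfolding g_def[symmetric] argmin_set_def is_arg_min_linorder by blast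
qed

lemma x_reg_gradient:
  assumes "0 < \<epsilon>" shows "regularized_gradient A \<epsilon> \<theta> (x_reg (huber_objective A) \<epsilon> \<theta>) = 0"
proof -
  have S: "argmin_set (\<lambda>x. huber_objective A x \<theta> + \<epsilon> / 2 * (norm x)\<^sup>2) = {x. regularized_gradient A \<epsilon> \<theta> x = 0}"
    using assms by (intro smooth_convex_argmin_set smooth_convex_regularized) simp
  obtain x where x: "regularized_gradient A \<epsilon> \<theta> x = 0"
    using regularized_argmin_nonempty[OF assms, of A \<theta>] unfolding S by blast
  have uniq: "y = x" if "regularized_gradient A \<epsilon> \<theta> y = 0" for y
    using regularized_solution_lipschitz[OF assms that x] by simp
  have "(THE x. regularized_gradient A \<epsilon> \<theta> x = 0) = x"
    using x uniq by (rule the_equality)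
  then show ?thesis unfolding x_reg_def S mem_Collect_eq using x by (simp only:)
qed

lemma x_reg_unique:
  assumes "0 < \<epsilon>" "regularized_gradient A \<epsilon> \<theta> x = 0" shows "x_reg (huber_objective A) \<epsilon> \<theta> = x"
  using regularized_solution_lipschitz[OF assms(1) x_reg_gradient[OF assms(1), of A \<theta>] assms(2)] by simp

lemma x_reg_lipschitz:
  assumes "0 < \<epsilon>"
  shows "norm (x_reg (huber_objective A) \<epsilon> \<theta> - x_reg (huber_objective A) \<epsilon> \<theta>') \<le> chi_number A * norm (\<theta> - \<theta>')"
  using regularized_solution_lipschitz[OF assms x_reg_gradient[OF assms] x_reg_gradient[OF assms]] .

lemma continuous_regularized_gradient:
  fixes A :: "real^'n^'m"
  assumes "\<epsilon>s \<longlonglongrightarrow> \<epsilon>" "\<theta>s \<longlonglongrightarrow> \<theta>" "xs \<longlonglongrightarrow> x"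
  shows "(\<lambda>k. regularized_gradient A (\<epsilon>s k) (\<theta>s k) (xs k)) \<longlonglongrightarrow> regularized_gradient A \<epsilon> \<theta> x"
proof -
  have "continuous_on UNIV (clip_vec :: real^'m \<Rightarrow> real^'m)"
  proof (rule lipschitz_on_continuous_on[of 1])
    show "1-lipschitz_on UNIV (clip_vec :: real^'m \<Rightarrow> real^'m)" using clip_vec_lipschitz by (auto simp: lipschitz_on_def dist_norm)
  qed
  then have "isCont clip_vec (A *v x - \<theta>)" by (simp add: continuous_on_eq_continuous_at)
  moreover have mv: "(\<lambda>k. M *v ys k) \<longlonglongrightarrow> M *v y" if "ys \<longlonglongrightarrow> y" for ys y and M :: "real^'p^'q"
    using that by (rule bounded_linear.tendsto[rotated]) simp
  ultimately have "(\<lambda>k. clip_vec (A *v xs k - \<theta>s k)) \<longlonglongrightarrow> clip_vec (A *v x - \<theta>)"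
    by (intro isCont_tendsto_compose[of _ clip_vec] tendsto_intros mv assms)
  then show ?thesis unfolding regularized_gradient_def by (intro tendsto_intros mv assms)
qed

lemma x_reg_limit:
  fixes A :: "real^'n^'m"
  assumes es: "\<epsilon>s \<longlonglongrightarrow> 0" "\<And>k. 0 < \<epsilon>s k" and bd: "\<And>k. norm (x_reg (huber_objective A) (\<epsilon>s k) \<theta>) \<le> B"
  obtains r x where "strict_mono (r :: nat \<Rightarrow> nat)" "(\<lambda>k. x_reg (huber_objective A) (\<epsilon>s (r k)) \<theta>) \<longlonglongrightarrow> x"
    "transpose A *v clip_vec (A *v x - \<theta>) = 0" "norm x \<le> B"
proof -
  let ?x = "\<lambda>k. x_reg (huber_objective A) (\<epsilon>s k) \<theta>"
  obtain x r where x: "x \<in> cball 0 B" and r: "strict_mono (r :: nat \<Rightarrow> nat)" "(?x \<circ> r) \<longlonglongrightarrow> x"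
    using compact_cball[of "0 :: real^'n" B] bd unfolding compact_def by (metis dist_0_norm mem_cball)
  have er: "(\<lambda>k. \<epsilon>s (r k)) \<longlonglongrightarrow> 0" using LIMSEQ_subseq_LIMSEQ[OF es(1) r(1)] by (simp add: o_def)
  have "(\<lambda>k. regularized_gradient A (\<epsilon>s (r k)) \<theta> (?x (r k))) \<longlonglongrightarrow> regularized_gradient A 0 \<theta> x"
    using er r(2) by (intro continuous_regularized_gradient) (auto simp: o_def)
  moreover have "regularized_gradient A (\<epsilon>s (r k)) \<theta> (?x (r k)) = 0" for k by (rule x_reg_gradient[OF es(2)])
  ultimately have "regularized_gradient A 0 \<theta> x = 0" by (simp add: LIMSEQ_const_iff)
  then have "transpose A *v clip_vec (A *v x - \<theta>) = 0" by (simp add: regularized_gradient_def)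
  then show thesis using that r x by (simp add: o_def)
qed

lemma huber_argmin_set:
  "argmin_set (\<lambda>x. huber_objective A x \<theta>) = {x. transpose A *v clip_vec (A *v x - \<theta>) = 0}"
  by (rule smooth_convex_argmin_set[OF smooth_convex_huber_objective])

text \<open>The objective need not be coercive. Instead, 0 is the regularized solution at parameter
  0, so the Lipschitz estimate bounds all regularized solutions at \<open>\<theta>\<close>, and a
  limit point as \<open>\<epsilon>\<close> tends to 0 is a minimizer.\<close>

lemma huber_argmin_nonempty: "argmin_set (\<lambda>x. huber_objective A x \<theta>) \<noteq> {}"
proof -
  have "norm (x_reg (huber_objective A) \<epsilon> \<theta>) \<le> chi_number A * norm \<theta>" if "0 < \<epsilon>" for \<epsilon>
  proof -
    have "clip_vec (A *v 0 - 0) = 0" by (simp add: clip_vec_def vec_eq_iff clip_def)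
    then have "regularized_gradient A \<epsilon> 0 0 = 0" by (simp add: regularized_gradient_def)
    from regularized_solution_lipschitz[OF that x_reg_gradient[OF that] this] show ?thesis by simp
  qed
  then obtain x where "transpose A *v clip_vec (A *v x - \<theta>) = 0"
    using x_reg_limit[OF LIMSEQ_inverse_real_of_nat, of A \<theta> "chi_number A * norm \<theta>"] by auto
  then show ?thesis unfolding huber_argmin_set by blast
qed

lemma x_min_spec:
  fixes A :: "real^'n^'m"
  shows "transpose A *v clip_vec (A *v x_min (huber_objective A) \<theta> - \<theta>) = 0" (is ?sol)
    and "transpose A *v clip_vec (A *v z - \<theta>) = 0 \<Longrightarrow> norm (x_min (huber_objective A) \<theta>) \<le> norm z"
    and "transpose A *v clip_vec (A *v z - \<theta>) = 0 \<Longrightarrow> norm z \<le> norm (x_min (huber_objective A) \<theta>)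
      \<Longrightarrow> z = x_min (huber_objective A) \<theta>"
proof -
  let ?g = "\<lambda>x. huber_objective A x \<theta>"
  let ?S = "argmin_set ?g"
  have conv: "convex ?S"
  proof (rule convexI)
    fix x y :: "real^'n" and u v :: real
    assume x: "x \<in> ?S" and y: "y \<in> ?S" and uv: "0 \<le> u" "0 \<le> v" "u + v = 1"
    have "?g (u *\<^sub>R x + v *\<^sub>R y) \<le> u * ?g x + v * ?g y"
      using smooth_convex_convex_on[OF smooth_convex_huber_objective[of A \<theta>]] uv unfolding convex_on_def by blast
    also have "\<dots> \<le> u * ?g z + v * ?g z" for z
      using x y uv by (intro add_mono mult_left_mono) (auto simp: argmin_set_def is_arg_min_linorder)
    also have "u * ?g z + v * ?g z = ?g z" for z using uv by (simp flip: distrib_right)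
    finally show "u *\<^sub>R x + v *\<^sub>R y \<in> ?S" by (simp add: argmin_set_def is_arg_min_linorder)
  qed
  have closed: "closed ?S"
    unfolding closed_sequential_limits
  proof (intro allI impI, elim conjE)
    fix xs x assume xs: "\<forall>n. xs n \<in> ?S" "xs \<longlonglongrightarrow> x"
    then have "(\<lambda>k. regularized_gradient A 0 \<theta> (xs k)) \<longlonglongrightarrow> regularized_gradient A 0 \<theta> x"
      by (intro continuous_regularized_gradient) auto
    moreover have "regularized_gradient A 0 \<theta> (xs k) = 0" for k
      using xs(1) by (simp add: huber_argmin_set regularized_gradient_def)
    ultimately have "regularized_gradient A 0 \<theta> x = 0" by (simp add: LIMSEQ_const_iff)
    then show "x \<in> ?S" by (simp add: huber_argmin_set regularized_gradient_def)
  qed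
  obtain x where x: "x \<in> ?S" "\<And>y. y \<in> ?S \<Longrightarrow> norm x \<le> norm y"
    using distance_attains_inf[OF closed huber_argmin_nonempty, of 0] by auto
  have uniq: "z = x" if z: "z \<in> ?S" "norm z \<le> norm x" for z
    by (rule any_closest_point_unique[OF conv closed z(1) x(1), of 0]) (use x(2) z(2) in \<open>force+\<close>)
  have "x_min (huber_objective A) \<theta> = x"
    unfolding x_min_def
  proof (rule the_equality)
    show "is_arg_min norm (\<lambda>x. x \<in> ?S) x" using x by (simp add: is_arg_min_linorder)
    fix z assume "is_arg_min norm (\<lambda>x. x \<in> ?S) z"
    then show "z = x" using x uniq by (simp add: is_arg_min_linorder)
  qed
  then show ?sol
    and "transpose A *v clip_vec (A *v z - \<theta>) = 0 \<Longrightarrow> norm (x_min (huber_objective A) \<theta>) \<le> norm z"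
    and "transpose A *v clip_vec (A *v z - \<theta>) = 0 \<Longrightarrow> norm z \<le> norm (x_min (huber_objective A) \<theta>)
      \<Longrightarrow> z = x_min (huber_objective A) \<theta>"
    using x uniq by (auto simp: huber_argmin_set)
qed

lemma clip_vec_monotone: "0 \<le> (clip_vec y - clip_vec y') \<bullet> (y - y')"
proof -
  obtain q where q: "\<And>i. 0 \<le> q $ i" "clip_vec y - clip_vec y' = diag_mat q *v (y - y')"
    using clip_vec_chord[of y y'] by blast
  then show ?thesis using sym_psd_diag_mat[of q] by (simp add: sym_psd_def inner_commute)
qed

text \<open>Monotonicity of the gradient between the two points shows that \<open>?z - ?x\<close>
  makes a nonnegative inner product with \<open>?x\<close>.\<close>

lemma norm_x_reg_le_norm_x_min:
  fixes A :: "real^'n^'m"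
  assumes "0 < \<epsilon>"
  shows "norm (x_reg (huber_objective A) \<epsilon> \<theta>) \<le> norm (x_min (huber_objective A) \<theta>)"
proof -
  let ?x = "x_reg (huber_objective A) \<epsilon> \<theta>" and ?z = "x_min (huber_objective A) \<theta>"
  have x: "transpose A *v clip_vec (A *v ?x - \<theta>) = - (\<epsilon> *\<^sub>R ?x)"
    using x_reg_gradient[OF assms, of A \<theta>] by (simp add: regularized_gradient_def add_eq_0_iff)
  have "0 \<le> (clip_vec (A *v ?x - \<theta>) - clip_vec (A *v ?z - \<theta>)) \<bullet> (A *v (?x - ?z))"
    using clip_vec_monotone[of "A *v ?x - \<theta>" "A *v ?z - \<theta>"] by (simp add: matrix_vector_mult_diff_distrib)
  also have "\<dots> = (?x - ?z) \<bullet> (transpose A *v (clip_vec (A *v ?x - \<theta>) - clip_vec (A *v ?z - \<theta>)))"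
    by (simp add: inner_matrix_vector_transpose[symmetric] inner_commute)
  also have "\<dots> = \<epsilon> * ((?z - ?x) \<bullet> ?x)"
    by (simp add: matrix_vector_mult_diff_distrib x x_min_spec(1) inner_diff_left algebra_simps)
  finally have "0 \<le> (?z - ?x) \<bullet> ?x" using assms by (simp add: zero_le_mult_iff)
  then have "norm ?x * norm ?x \<le> ?z \<bullet> ?x" by (simp add: inner_diff_left power2_norm_eq_inner[symmetric] power2_eq_square)
  also have "\<dots> \<le> norm ?z * norm ?x" by (rule norm_cauchy_schwarz)
  finally show ?thesis by (cases "?x = 0") auto
qed

text \<open>For fixed \<open>\<theta>\<close>, every limit point is a minimizer of norm at most that
  of \<open>x_min\<close>, hence equal to it. The Lipschitz bound, uniform in
  \<open>\<epsilon>\<close>, extends the convergence to moving parameters.\<close>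

lemma x_reg_tendsto_x_min:
  fixes A :: "real^'n^'m"
  assumes es: "\<epsilon>s \<longlonglongrightarrow> 0" "\<And>k::nat. 0 < \<epsilon>s k" and \<theta>s: "\<theta>s \<longlonglongrightarrow> \<theta>"
  shows "(\<lambda>k. x_reg (huber_objective A) (\<epsilon>s k) (\<theta>s k)) \<longlonglongrightarrow> x_min (huber_objective A) \<theta>"
proof -
  let ?z = "x_min (huber_objective A) \<theta>"
  have "(\<lambda>k. x_reg (huber_objective A) (\<epsilon>s k) \<theta>) \<longlonglongrightarrow> ?z"
  proof (rule ccontr)
    assume "\<not> ?thesis"
    then obtain e where e: "0 < e" "\<exists>\<^sub>F k in sequentially. e \<le> dist (x_reg (huber_objective A) (\<epsilon>s k) \<theta>) ?z"
      unfolding tendsto_iff by (auto simp: not_eventually not_less)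
    define T where "T = {k. e \<le> dist (x_reg (huber_objective A) (\<epsilon>s k) \<theta>) ?z}"
    have "infinite T" using e(2) by (simp add: T_def cofinite_eq_sequentially[symmetric] frequently_cofinite)
    then obtain s where s: "strict_mono (s :: nat \<Rightarrow> nat)" "\<And>k. s k \<in> T" by (metis infinite_enumerate)
    have es': "(\<lambda>k. \<epsilon>s (s k)) \<longlonglongrightarrow> 0" using LIMSEQ_subseq_LIMSEQ[OF es(1) s(1)] by (simp add: o_def)
    obtain r x where rx: "strict_mono (r :: nat \<Rightarrow> nat)" "(\<lambda>k. x_reg (huber_objective A) (\<epsilon>s (s (r k))) \<theta>) \<longlonglongrightarrow> x"
      "transpose A *v clip_vec (A *v x - \<theta>) = 0" "norm x \<le> norm ?z"
      using x_reg_limit[OF es' es(2) norm_x_reg_le_norm_x_min[OF es(2)]] by metis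
    have "x = ?z" by (rule x_min_spec(3)[OF rx(3,4)])
    have "(\<lambda>k. dist (x_reg (huber_objective A) (\<epsilon>s (s (r k))) \<theta>) ?z) \<longlonglongrightarrow> dist x ?z"
      by (intro tendsto_intros rx)
    then have "e \<le> dist x ?z" by (rule LIMSEQ_le_const) (use s(2) in \<open>auto simp: T_def\<close>)
    then show False using e(1) \<open>x = ?z\<close> by simp
  qed
  moreover have "(\<lambda>k. x_reg (huber_objective A) (\<epsilon>s k) (\<theta>s k) - x_reg (huber_objective A) (\<epsilon>s k) \<theta>) \<longlonglongrightarrow> 0"
  proof (rule Lim_null_comparison)
    show "\<forall>\<^sub>F k in sequentially. norm (x_reg (huber_objective A) (\<epsilon>s k) (\<theta>s k) - x_reg (huber_objective A) (\<epsilon>s k) \<theta>)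
        \<le> chi_number A * norm (\<theta>s k - \<theta>)" by (intro always_eventually allI x_reg_lipschitz es)
    have "(\<lambda>k. chi_number A * norm (\<theta>s k - \<theta>)) \<longlonglongrightarrow> chi_number A * norm (\<theta> - \<theta>)"
      by (intro tendsto_intros \<theta>s)
    then show "(\<lambda>k. chi_number A * norm (\<theta>s k - \<theta>)) \<longlonglongrightarrow> 0" by simp
  qed
  ultimately show ?thesis using tendsto_add by fastforce
qed

lemma x_min_lipschitz:
  "norm (x_min (huber_objective A) \<theta> - x_min (huber_objective A) \<theta>') \<le> chi_number A * norm (\<theta> - \<theta>')"
proof -
  let ?e = "\<lambda>k. inverse (real (Suc k))"
  have "(\<lambda>k. norm (x_reg (huber_objective A) (?e k) \<theta> - x_reg (huber_objective A) (?e k) \<theta>'))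
      \<longlonglongrightarrow> norm (x_min (huber_objective A) \<theta> - x_min (huber_objective A) \<theta>')"
    by (intro tendsto_norm tendsto_diff x_reg_tendsto_x_min LIMSEQ_inverse_real_of_nat tendsto_const) simp_all
  then show ?thesis by (rule LIMSEQ_le_const2) (intro exI[of _ 0] allI impI x_reg_lipschitz, simp)
qed

section \<open>The Clarke Jacobian of the gradient of the Huber loss\<close>

definition huber_weights :: "real^'m \<Rightarrow> real^'m \<Rightarrow> bool" where
  "huber_weights q y \<longleftrightarrow> (\<forall>i. 0 \<le> q $ i \<and> q $ i \<le> 1 \<and>
      (\<bar>y $ i\<bar> < 1 \<longrightarrow> q $ i = 1) \<and> (1 < \<bar>y $ i\<bar> \<longrightarrow> q $ i = 0))"

definition smooth_weights :: "real^'m \<Rightarrow> real^'m" where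
  "smooth_weights y = (\<chi> i. if \<bar>y $ i\<bar> < 1 then 1 else 0)"

lemma clip_derivative:
  assumes "\<bar>t\<bar> \<noteq> 1" shows "(clip has_real_derivative (if \<bar>t\<bar> < 1 then 1 else 0)) (at t)"
proof -
  consider "\<bar>t\<bar> < 1" | "1 < t" | "t < -1" using assms by linarith
  then show ?thesis
  proof cases
    case 1
    then have "((\<lambda>t. t) has_real_derivative 1) (at t)" by simp
    then have "(clip has_real_derivative 1) (at t)"
      by (rule has_field_derivative_transform_within_open[of _ _ _ "{-1<..<1}"]) (use 1 in \<open>auto simp: clip_def\<close>)
    then show ?thesis using 1 by simp
  next
    case 2
    have "((\<lambda>t. 1) has_real_derivative 0) (at t)" by simp
    then have "(clip has_real_derivative 0) (at t)"
      by (rule has_field_derivative_transform_within_open[of _ _ _ "{1<..}"]) (use 2 in \<open>auto simp: clip_def\<close>)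
    then show ?thesis using 2 by simp
  next
    case 3
    have "((\<lambda>t. -1) has_real_derivative 0) (at t)" by simp
    then have "(clip has_real_derivative 0) (at t)"
      by (rule has_field_derivative_transform_within_open[of _ _ _ "{..<-1}"]) (use 3 in \<open>auto simp: clip_def\<close>)
    then show ?thesis using 3 by simp
  qed
qed

lemma clip_vec_derivative:
  fixes y :: "real^'m"
  assumes "\<And>i. \<bar>y $ i\<bar> \<noteq> 1"
  shows "(clip_vec has_derivative (\<lambda>h. diag_mat (smooth_weights y) *v h)) (at y)"
proof (subst has_derivative_componentwise_within, intro ballI)
  fix b :: "real^'m" assume "b \<in> Basis"
  then obtain i where b: "b = axis i 1" by (auto simp: Basis_vec_def)
  have "(clip has_derivative (\<lambda>h. smooth_weights y $ i * h)) (at (y $ i))"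
    using clip_derivative[OF assms[of i]] by (simp add: has_field_derivative_def smooth_weights_def)
  moreover have "((\<lambda>y. y $ i) has_derivative (\<lambda>h. h $ i)) (at y)"
    by (rule bounded_linear_imp_has_derivative) (rule bounded_linear_vec_nth)
  ultimately have "((\<lambda>y. clip (y $ i)) has_derivative (\<lambda>h. smooth_weights y $ i * h $ i)) (at y)"
    using has_derivative_compose by blast
  then show "((\<lambda>y. clip_vec y \<bullet> b) has_derivative (\<lambda>h. (diag_mat (smooth_weights y) *v h) \<bullet> b)) (at y)"
    by (simp add: b inner_axis clip_vec_def diag_mat_vector)
qed

lemma jacobian_clip_vec:
  fixes y :: "real^'m"
  assumes "\<And>i. \<bar>y $ i\<bar> \<noteq> 1"
  shows "jacobian clip_vec (at y) = diag_mat (smooth_weights y)"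
proof -
  have "frechet_derivative clip_vec (at y) = (\<lambda>h. diag_mat (smooth_weights y) *v h)"
    by (rule frechet_derivative_at[symmetric, OF clip_vec_derivative[OF assms]])
  then show ?thesis by (simp add: jacobian_def matrix_of_matrix_vector_mul)
qed

text \<open>Near a kink \<open>clip\<close> is constant on the outer side and has slope 1 on the
  inner side, and 0 is a limit point of both sides; a derivative would be both 0 and 1.\<close>

lemma clip_not_differentiable:
  assumes t: "\<bar>t\<bar> = 1" and D: "((\<lambda>s. clip (t + s)) has_vector_derivative D) (at 0)"
  shows False
proof -
  have out: "(0::real) islimpt {s. 0 \<le> t * s}" and inn: "0 islimpt {s. t * s \<le> 0 \<and> -1 \<le> t * s}"
  proof -
    have "\<exists>s. 0 \<le> t * s \<and> s \<noteq> 0 \<and> dist s 0 < e" "\<exists>s. t * s \<le> 0 \<and> -1 \<le> t * s \<and> s \<noteq> 0 \<and> dist s 0 < e" if "0 < e" for e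
    proof -
      define h where "h = min e 1 / 2"
      have h: "0 < h" "h \<le> 1" "h < e" using that by (auto simp: h_def min_def)
      have t': "t = 1 \<or> t = -1" using t by linarith
      have "0 \<le> t * (t * h) \<and> t * h \<noteq> 0 \<and> dist (t * h) 0 < e" using t' h by (auto simp: dist_real_def)
      then show "\<exists>s. 0 \<le> t * s \<and> s \<noteq> 0 \<and> dist s 0 < e" by blast
      have "t * (- t * h) \<le> 0 \<and> -1 \<le> t * (- t * h) \<and> - t * h \<noteq> 0 \<and> dist (- t * h) 0 < e"
        using t' h by (auto simp: dist_real_def)
      then show "\<exists>s. t * s \<le> 0 \<and> -1 \<le> t * s \<and> s \<noteq> 0 \<and> dist s 0 < e" by blast
    qed
    then show "(0::real) islimpt {s. 0 \<le> t * s}" and "0 islimpt {s. t * s \<le> 0 \<and> -1 \<le> t * s}"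
      unfolding islimpt_approachable by blast+
  qed
  have "D = 0"
    by (rule has_vector_derivative_zero_at_limpt[OF D out]) (use t in \<open>auto simp: clip_def abs_if split: if_splits\<close>)
  have "((\<lambda>s. clip (t + s) - s) has_vector_derivative (D - 1)) (at 0)"
    by (intro has_vector_derivative_diff D) (rule has_vector_derivative_id)
  then have "D - 1 = 0"
    by (rule has_vector_derivative_zero_at_limpt[OF _ inn]) (use t in \<open>auto simp: clip_def abs_if split: if_splits\<close>)
  with \<open>D = 0\<close> show False by simp
qed

lemma clip_vec_differentiable_imp:
  fixes y :: "real^'m"
  assumes "clip_vec differentiable (at y)" shows "\<bar>y $ i\<bar> \<noteq> 1"
proof
  assume i: "\<bar>y $ i\<bar> = 1"
  obtain f where f: "(clip_vec has_derivative f) (at y)" using assms by (auto simp: differentiable_def)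
  have "((\<lambda>s. y + s *\<^sub>R axis i 1) has_derivative (\<lambda>s. s *\<^sub>R axis i 1)) (at 0)"
    by (auto intro!: derivative_eq_intros)
  from has_derivative_compose[OF this, of clip_vec f] f
  have "((\<lambda>s. clip_vec (y + s *\<^sub>R axis i 1)) has_derivative (\<lambda>s. f (s *\<^sub>R axis i 1))) (at 0)" by simp
  from has_derivative_compose[OF this bounded_linear_imp_has_derivative[OF bounded_linear_vec_nth[of i]]]
  have "((\<lambda>s. clip (y $ i + s)) has_derivative (\<lambda>s. f (s *\<^sub>R axis i 1) $ i)) (at 0)"
    by (simp add: clip_vec_def axis_def)
  moreover have "f (s *\<^sub>R axis i 1) $ i = s *\<^sub>R (f (axis i 1) $ i)" for s
    using linear_scale[OF has_derivative_linear[OF f]] by simp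
  ultimately have "((\<lambda>s. clip (y $ i + s)) has_vector_derivative (f (axis i 1) $ i)) (at 0)"
    by (simp add: has_vector_derivative_def)
  then show False by (rule clip_not_differentiable[OF i])
qed

lemma diag_mat_add: "diag_mat (a *\<^sub>R p + b *\<^sub>R q) = a *\<^sub>R diag_mat p + b *\<^sub>R diag_mat q"
  by (simp add: vec_eq_iff diag_mat_component)

text \<open>One inclusion holds because limits of 0/1 weights at smooth points satisfy the closed
  convex conditions on \<open>q\<close>. For the other, a weight vector is a convex combination of
  0/1 vectors, and each such vertex is a limit of Jacobians.\<close>

lemma huber_hessians_eq:
  fixes y :: "real^'m"
  shows "huber_hessians y = {diag_mat q |q. huber_weights q y}"
proof -
  define G where "G = {V. \<exists>z. (\<forall>k::nat. clip_vec differentiable (at (z k))) \<and> z \<longlonglongrightarrow> y \<and>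
           (\<lambda>k. jacobian clip_vec (at (z k))) \<longlonglongrightarrow> V}"
  have H: "huber_hessians y = convex hull G"
    unfolding huber_hessians_def clarke_jacobian_def G_def
    by (simp only: smooth_convex_gradient[OF smooth_convex_huber_loss])
  have conv: "convex {diag_mat q |q. huber_weights q y}"
  proof (rule convexI)
    fix V W and a b :: real
    assume V: "V \<in> {diag_mat q |q. huber_weights q y}" and W: "W \<in> {diag_mat q |q. huber_weights q y}"
      and ab: "0 \<le> a" "0 \<le> b" "a + b = 1"
    then obtain p q where pq: "V = diag_mat p" "huber_weights p y" "W = diag_mat q" "huber_weights q y" by blast
    have "huber_weights (a *\<^sub>R p + b *\<^sub>R q) y"
      unfolding huber_weights_def
    proof (intro allI conjI impI)
      fix i
      have p: "0 \<le> p $ i" "p $ i \<le> 1" and q: "0 \<le> q $ i" "q $ i \<le> 1" using pq by (auto simp: huber_weights_def)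
      show "0 \<le> (a *\<^sub>R p + b *\<^sub>R q) $ i" using p q ab by simp
      have "a * p $ i + b * q $ i \<le> a * 1 + b * 1" using p q ab by (intro add_mono mult_left_mono) auto
      then show "(a *\<^sub>R p + b *\<^sub>R q) $ i \<le> 1" using ab by simp
      show "(a *\<^sub>R p + b *\<^sub>R q) $ i = 1" if "\<bar>y $ i\<bar> < 1" using pq ab that by (simp add: huber_weights_def)
      show "(a *\<^sub>R p + b *\<^sub>R q) $ i = 0" if "1 < \<bar>y $ i\<bar>" using pq ab that by (simp add: huber_weights_def)
    qed
    then show "a *\<^sub>R V + b *\<^sub>R W \<in> {diag_mat q |q. huber_weights q y}"
      unfolding pq(1,3) diag_mat_add[symmetric] by blast
  qed
  have "G \<subseteq> {diag_mat q |q. huber_weights q y}"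
  proof
    fix V assume "V \<in> G"
    then obtain z where z: "\<And>k::nat. clip_vec differentiable (at (z k))" "z \<longlonglongrightarrow> y"
      "(\<lambda>k. jacobian clip_vec (at (z k))) \<longlonglongrightarrow> V" by (auto simp: G_def)
    have "jacobian clip_vec (at (z k)) = diag_mat (smooth_weights (z k))" for k
      by (rule jacobian_clip_vec[OF clip_vec_differentiable_imp[OF z(1)]])
    with z(3) have lim: "(\<lambda>k. diag_mat (smooth_weights (z k)) $ i $ j) \<longlonglongrightarrow> V $ i $ j" for i j
      by (auto intro!: tendsto_vec_nth)
    have zi: "(\<lambda>k. \<bar>z k $ i\<bar>) \<longlonglongrightarrow> \<bar>y $ i\<bar>" for i using z(2) by (intro tendsto_intros)
    have off: "V $ i $ j = 0" if "i \<noteq> j" for i j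
      using lim[of i j] that by (simp add: diag_mat_component LIMSEQ_const_iff)
    have w: "(\<lambda>k. smooth_weights (z k) $ i) \<longlonglongrightarrow> V $ i $ i" for i
      using lim[of i i] by (simp add: diag_mat_component)
    have "huber_weights (\<chi> i. V $ i $ i) y"
      unfolding huber_weights_def
    proof (intro allI conjI impI)
      fix i
      show "0 \<le> (\<chi> i. V $ i $ i) $ i" by (simp, rule LIMSEQ_le_const[OF w]) (simp add: smooth_weights_def)
      show "(\<chi> i. V $ i $ i) $ i \<le> 1" by (simp, rule LIMSEQ_le_const2[OF w]) (simp add: smooth_weights_def)
      show "(\<chi> i. V $ i $ i) $ i = 1" if "\<bar>y $ i\<bar> < 1"
      proof -
        have "\<forall>\<^sub>F k in sequentially. \<bar>z k $ i\<bar> < 1" using order_tendstoD(2)[OF zi that] .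
        then have "\<forall>\<^sub>F k in sequentially. smooth_weights (z k) $ i = 1"
          by eventually_elim (simp add: smooth_weights_def)
        then show ?thesis using LIMSEQ_unique[OF w tendsto_eventually] by simp
      qed
      show "(\<chi> i. V $ i $ i) $ i = 0" if "1 < \<bar>y $ i\<bar>"
      proof -
        have "\<forall>\<^sub>F k in sequentially. 1 < \<bar>z k $ i\<bar>" using order_tendstoD(1)[OF zi that] .
        then have "\<forall>\<^sub>F k in sequentially. smooth_weights (z k) $ i = 0"
          by eventually_elim (simp add: smooth_weights_def)
        then show ?thesis using LIMSEQ_unique[OF w tendsto_eventually] by simp
      qed
    qed
    moreover have "V = diag_mat (\<chi> i. V $ i $ i)" using off by (auto simp: vec_eq_iff diag_mat_component)
    ultimately show "V \<in> {diag_mat q |q. huber_weights q y}" by blast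
  qed
  with conv have 1: "convex hull G \<subseteq> {diag_mat q |q. huber_weights q y}" by (intro hull_minimal)
  define T where "T t = (\<chi> i. if \<bar>y $ i\<bar> < 1 then 1 else if \<bar>y $ i\<bar> = 1 then t $ i else 0)" for t :: "real^'m"
  have vertex: "diag_mat (T t) \<in> G" if t: "\<forall>i. t $ i = 0 \<or> t $ i = 1" for t
  proof -
    \<comment> \<open>A kink coordinate is approached from inside the interval if weight 1 is wanted
      and from outside if weight 0 is wanted.\<close>
    define w where "w = (\<chi> i. if \<bar>y $ i\<bar> = 1 then (if t $ i = 1 then - y $ i else y $ i) else 0)"
    define z where "z k = y + inverse (real (Suc k)) *\<^sub>R (w /\<^sub>R 2)" for k
    have zi: "z k $ i = (if \<bar>y $ i\<bar> = 1 then (if t $ i = 1 then 1 - inverse (real (Suc k)) / 2 else 1 + inverse (real (Suc k)) / 2) * y $ i else y $ i)" for k i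
      by (simp add: z_def w_def algebra_simps)
    have small: "0 < inverse (real (Suc k))" "inverse (real (Suc k)) \<le> 1" for k by (auto simp: field_simps)
    have abs: "\<bar>z k $ i\<bar> = (if \<bar>y $ i\<bar> = 1 then (if t $ i = 1 then 1 - inverse (real (Suc k)) / 2 else 1 + inverse (real (Suc k)) / 2) else \<bar>y $ i\<bar>)" for k i
      unfolding zi abs_mult using small[of k] by (auto simp: abs_mult)
    have ne: "\<bar>z k $ i\<bar> \<noteq> 1" for k i using small[of k] by (simp add: abs)
    have "smooth_weights (z k) = T t" for k
      using t small[of k] by (auto simp: vec_eq_iff smooth_weights_def T_def abs)
    then have J: "jacobian clip_vec (at (z k)) = diag_mat (T t)" for k using jacobian_clip_vec[OF ne] by simp
    have "clip_vec differentiable (at (z k))" for k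
      using clip_vec_derivative[OF ne] by (rule differentiableI)
    moreover have "z \<longlonglongrightarrow> y + 0 *\<^sub>R (w /\<^sub>R 2)"
      unfolding z_def by (intro tendsto_intros LIMSEQ_inverse_real_of_nat)
    ultimately show ?thesis unfolding G_def using J by (intro CollectI exI[of _ z]) simp
  qed
  have 2: "diag_mat q \<in> convex hull G" if q: "huber_weights q y" for q
  proof -
    have "q \<in> cbox 0 One"
      using q by (auto simp: mem_box huber_weights_def Basis_vec_def inner_axis inner_sum_left inner_Basis)
    then have "q \<in> convex hull {t. \<forall>b\<in>Basis. t \<bullet> b = 0 \<or> t \<bullet> b = 1}" unfolding unit_interval_convex_hull .
    moreover have "{t. \<forall>b\<in>Basis. t \<bullet> b = 0 \<or> t \<bullet> b = 1} = {t::real^'m. \<forall>i. t $ i = 0 \<or> t $ i = 1}"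
      by (auto simp: Basis_vec_def inner_axis)
    ultimately have "q \<in> convex hull {t. \<forall>i. t $ i = 0 \<or> t $ i = 1}" by simp
    \<comment> \<open>The map \<open>T\<close> resets the coordinates away from kinks to their
      forced values and preserves convex combinations, so induction over the hull reduces the claim
      to the vertices of the cube.\<close>
    then have "diag_mat (T q) \<in> convex hull G"
    proof (rule hull_induct)
      show "diag_mat (T t) \<in> convex hull G" if "t \<in> {t. \<forall>i. t $ i = 0 \<or> t $ i = 1}" for t
        using vertex that by (intro hull_inc) simp
      show "convex {t. diag_mat (T t) \<in> convex hull G}"
      proof (rule convexI)
        fix s t and a b :: real
        assume s: "s \<in> {t. diag_mat (T t) \<in> convex hull G}" and t: "t \<in> {t. diag_mat (T t) \<in> convex hull G}"
          and ab: "0 \<le> a" "0 \<le> b" "a + b = 1"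
        have "T (a *\<^sub>R s + b *\<^sub>R t) = a *\<^sub>R T s + b *\<^sub>R T t" using ab by (auto simp: T_def vec_eq_iff)
        then have "diag_mat (T (a *\<^sub>R s + b *\<^sub>R t)) = a *\<^sub>R diag_mat (T s) + b *\<^sub>R diag_mat (T t)"
          by (simp add: diag_mat_add)
        then show "a *\<^sub>R s + b *\<^sub>R t \<in> {t. diag_mat (T t) \<in> convex hull G}"
          using s t ab convexD[OF convex_convex_hull[of G]] by simp
      qed
    qed
    moreover have "T q = q" using q by (auto simp: T_def vec_eq_iff huber_weights_def)
    ultimately show ?thesis by simp
  qed
  show ?thesis unfolding H using 1 2 by blast
qed

lemma huber_weights_exists: obtains q where "huber_weights q y"
proof
  show "huber_weights (smooth_weights y) y" by (simp add: huber_weights_def smooth_weights_def)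
qed

lemma huber_weights_nonneg: "huber_weights q y \<Longrightarrow> 0 \<le> q $ i"
  by (simp add: huber_weights_def)

lemma huber_weights_limit:
  fixes y :: "real^'m"
  assumes "\<And>k::nat. huber_weights (qs k) (ys k)" "ys \<longlonglongrightarrow> y" "qs \<longlonglongrightarrow> q"
  shows "huber_weights q y"
  unfolding huber_weights_def
proof (intro allI conjI impI)
  fix i
  have qi: "(\<lambda>k. qs k $ i) \<longlonglongrightarrow> q $ i" and yi: "(\<lambda>k. \<bar>ys k $ i\<bar>) \<longlonglongrightarrow> \<bar>y $ i\<bar>"
    using assms by (auto intro!: tendsto_intros)
  show "0 \<le> q $ i" by (rule LIMSEQ_le_const[OF qi]) (use assms(1) in \<open>simp add: huber_weights_def\<close>)
  show "q $ i \<le> 1" by (rule LIMSEQ_le_const2[OF qi]) (use assms(1) in \<open>simp add: huber_weights_def\<close>)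
  show "q $ i = 1" if "\<bar>y $ i\<bar> < 1"
  proof -
    have "\<forall>\<^sub>F k in sequentially. qs k $ i = 1"
      using order_tendstoD(2)[OF yi that] assms(1) by (auto elim!: eventually_mono simp: huber_weights_def)
    then show ?thesis using LIMSEQ_unique[OF qi tendsto_eventually] by simp
  qed
  show "q $ i = 0" if "1 < \<bar>y $ i\<bar>"
  proof -
    have "\<forall>\<^sub>F k in sequentially. qs k $ i = 0"
      using order_tendstoD(1)[OF yi that] assms(1) by (auto elim!: eventually_mono simp: huber_weights_def)
    then show ?thesis using LIMSEQ_unique[OF qi tendsto_eventually] by simp
  qed
qed

section \<open>The conservative Jacobian of the gradient of the objective\<close>

lemma AE_unit_interval:
  assumes "negligible M" "\<And>t. t \<in> {0<..<1} - M \<Longrightarrow> P t"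
  shows "AE t in lebesgue_on {0..1::real}. P t"
proof -
  \<comment> \<open>Removing the endpoints leaves interior times, where two-sided derivatives are
    available.\<close>
  have "negligible (M \<union> {0, 1})" by (rule negligible_Un[OF assms(1)]) (simp add: negligible_finite)
  then have "M \<union> {0, 1} \<in> null_sets lebesgue" by (simp add: negligible_iff_null_sets)
  then have "AE t in lebesgue. t \<in> {0..1} \<longrightarrow> P t"
    by (rule AE_I') (use assms(2) in force)
  then show ?thesis by (simp add: AE_restrict_space_iff)
qed

lemma negligible_isolated_points: "negligible {t\<in>T. \<not> t islimpt T}" for T :: "real set"
  unfolding negligible_iff_null_sets
  by (rule null_sets_completionI[OF countable_imp_null_set_lborel[OF countable_isolated_points]])

section \<open>Block vectors and the matrices of the conservative Jacobian\<close>

lemma left_vec_join_vec [simp]: "left_vec (join_vec x y) = x"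
  by (simp add: left_vec_def join_vec_def)

lemma right_vec_join_vec [simp]: "right_vec (join_vec x y) = y"
  by (simp add: right_vec_def join_vec_def)

lemma bounded_linear_left_vec: "bounded_linear (left_vec :: real^('n::finite + 'm::finite) \<Rightarrow> real^'n)"
  unfolding linear_conv_bounded_linear[symmetric]
  by (rule linearI) (simp_all add: left_vec_def vec_eq_iff)

lemma bounded_linear_right_vec: "bounded_linear (right_vec :: real^('n::finite + 'm::finite) \<Rightarrow> real^'m)"
  unfolding linear_conv_bounded_linear[symmetric]
  by (rule linearI) (simp_all add: right_vec_def vec_eq_iff)

lemma hcat_component: "hcat H M $ i $ Inl j = H $ i $ j" "hcat H M $ i $ Inr k = M $ i $ k"
  by (simp_all add: hcat_def join_vec_def)

lemma hcat_eq_iff: "hcat H M = hcat H' M' \<longleftrightarrow> H = H' \<and> M = M'"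
proof
  assume "hcat H M = hcat H' M'"
  then have "hcat H M $ i $ k = hcat H' M' $ i $ k" for i k by simp
  from this[of _ "Inl _"] this[of _ "Inr _"] show "H = H' \<and> M = M'"
    unfolding hcat_component by (simp add: vec_eq_iff)
qed simp

lemma hcat_vector:
  fixes H :: "real^'n^'q" and M :: "real^'m^'q"
  shows "hcat H M *v z = H *v left_vec z + M *v right_vec z"
proof -
  have "(\<Sum>k\<in>UNIV. hcat H M $ i $ k * z $ k) = (\<Sum>j\<in>UNIV. H $ i $ j * z $ Inl j) + (\<Sum>k\<in>UNIV. M $ i $ k * z $ Inr k)" for i
    by (subst UNIV_Plus_UNIV[symmetric], subst sum.Plus) (simp_all add: hcat_component)
  then show ?thesis by (simp add: vec_eq_iff matrix_vector_mult_def left_vec_def right_vec_def)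
qed

definition residual :: "real^'n^'m \<Rightarrow> real^('n::finite + 'm::finite) \<Rightarrow> real^'m" where
  "residual A z = A *v left_vec z - right_vec z"

lemma bounded_linear_residual: "bounded_linear (residual A)"
  unfolding residual_def
  by (intro bounded_linear_sub bounded_linear_compose[OF matrix_vector_mul_bounded_linear]
      bounded_linear_left_vec bounded_linear_right_vec)

definition JF_matrix :: "real^'n^'m \<Rightarrow> real^'m \<Rightarrow> real^('n::finite + 'm::finite)^'n" where
  "JF_matrix A q = hcat (transpose A ** diag_mat q ** A) (- (transpose A ** diag_mat q))"

lemma huber_JF_eq: "huber_JF A z = {JF_matrix A q |q. huber_weights q (residual A z)}"
  by (auto simp: huber_JF_def JF_matrix_def huber_hessians_eq residual_def)

lemma transpose_mult_diag_mat_component: "(transpose A ** diag_mat q) $ i $ k = A $ k $ i * q $ k"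
  by (simp add: matrix_matrix_mult_def transpose_def diag_mat_component if_distrib[of "\<lambda>c. _ * c"] cong: if_cong)

lemma gram_component: "(transpose A ** diag_mat q ** A) $ i $ j = (\<Sum>k\<in>UNIV. A $ k $ i * q $ k * A $ k $ j)"
  unfolding matrix_matrix_mult_def[of "transpose A ** diag_mat q"] by (simp add: transpose_mult_diag_mat_component)

lemma JF_matrix_component:
  "JF_matrix A q $ i $ Inl j = (\<Sum>k\<in>UNIV. A $ k $ i * q $ k * A $ k $ j)"
  "JF_matrix A q $ i $ Inr k = - (A $ k $ i * q $ k)"
  by (simp_all add: JF_matrix_def hcat_component gram_component transpose_mult_diag_mat_component)

lemma JF_matrix_vector:
  fixes A :: "real^'a^'b"
  shows "JF_matrix A q *v z = transpose A *v (diag_mat q *v residual A z)"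
proof -
  have "(- M) *v x = - (M *v x)" for M :: "real^'b^'a" and x
    by (simp add: matrix_vector_mult_def vec_eq_iff sum_negf)
  then show ?thesis
    by (simp add: JF_matrix_def hcat_vector residual_def matrix_vector_mult_diff_distrib matrix_vector_mul_assoc matrix_mul_assoc)
qed

lemma linear_JF_matrix: "linear (JF_matrix A)"
proof (rule linearI)
  show "JF_matrix A (p + q) = JF_matrix A p + JF_matrix A q" for p q
    unfolding vec_eq_iff split_sum_all
    by (simp add: JF_matrix_component sum.distrib[symmetric] algebra_simps)
  show "JF_matrix A (c *\<^sub>R q) = c *\<^sub>R JF_matrix A q" for c q
    unfolding vec_eq_iff split_sum_all
    by (simp add: JF_matrix_component sum_distrib_left algebra_simps)
qed

lemma huber_weights_in_cube: "huber_weights q y \<Longrightarrow> q \<in> cbox 0 One"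
  by (auto simp: mem_box huber_weights_def Basis_vec_def inner_axis inner_sum_left inner_Basis)

lemma partial_gradient_huber:
  fixes A :: "real^'n^'m"
  shows "partial_gradient (huber_objective A) = (\<lambda>z. transpose A *v clip_vec (residual A z))"
  unfolding partial_gradient_def smooth_convex_gradient[OF smooth_convex_huber_objective] residual_def ..

lemma gradient_huber_objective_lipschitz:
  fixes A :: "real^'n^'m"
  shows "norm (transpose A *v clip_vec y - transpose A *v clip_vec y') \<le> op_norm (transpose A) * norm (y - y')"
proof -
  have "norm (transpose A *v clip_vec y - transpose A *v clip_vec y') \<le> op_norm (transpose A) * norm (clip_vec y - clip_vec y')"
    unfolding matrix_vector_mult_diff_distrib[symmetric] by (rule norm_le_op_norm)
  also have "\<dots> \<le> op_norm (transpose A) * norm (y - y')"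
    by (intro mult_left_mono clip_vec_lipschitz op_norm_nonneg)
  finally show ?thesis .
qed

lemma locally_lipschitz_onI:
  assumes "\<And>x y. norm (f x - f y) \<le> L * norm (x - y)" "0 \<le> L"
  shows "locally_lipschitz_on U f"
  unfolding locally_lipschitz_on_def lipschitz_on_def dist_norm using assms zero_less_one by blast

lemma locally_lipschitz_partial_gradient_huber:
  fixes A :: "real^'n^'m"
  shows "locally_lipschitz_on U (partial_gradient (huber_objective A))"
proof -
  obtain K where K: "0 < K" "\<And>z. norm (residual A z) \<le> norm z * K"
    using bounded_linear.pos_bounded[OF bounded_linear_residual[of A]] by blast
  have diff: "residual A z - residual A z' = residual A (z - z')" for z z'
    by (rule linear_diff[OF bounded_linear.linear[OF bounded_linear_residual], symmetric])
  show ?thesis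
    unfolding partial_gradient_huber
  proof (rule locally_lipschitz_onI)
    fix z z'
    have "norm (transpose A *v clip_vec (residual A z) - transpose A *v clip_vec (residual A z'))
        \<le> op_norm (transpose A) * norm (residual A (z - z'))"
      using gradient_huber_objective_lipschitz[of A "residual A z" "residual A z'"] by (simp add: diff)
    also have "\<dots> \<le> op_norm (transpose A) * (norm (z - z') * K)"
      by (intro mult_left_mono K op_norm_nonneg)
    finally show "norm (transpose A *v clip_vec (residual A z) - transpose A *v clip_vec (residual A z'))
        \<le> (op_norm (transpose A) * K) * norm (z - z')" by (simp add: mult_ac)
  qed (use K op_norm_nonneg in \<open>simp add: op_norm_nonneg\<close>)
qed

lemma huber_regularity:
  fixes A :: "real^'n^'m"
  shows "regularity_assumption (huber_objective A) UNIV"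
  unfolding regularity_assumption_def
proof (intro conjI ballI allI)
  fix \<theta> :: "real^'m"
  show "(\<lambda>x. huber_objective A x \<theta>) differentiable (at x)" for x
    using smooth_convex_GDERIV[OF smooth_convex_huber_objective] unfolding gderiv_def by (rule differentiableI)
  show "\<exists>L. L-lipschitz_on UNIV (gradient (\<lambda>x. huber_objective A x \<theta>))"
  proof (intro exI[of _ "op_norm (transpose A) * op_norm A"] lipschitz_onI)
    fix x y
    have "norm (A *v x - \<theta> - (A *v y - \<theta>)) \<le> op_norm A * norm (x - y)"
      using norm_le_op_norm[of A "x - y"] by (simp add: matrix_vector_mult_diff_distrib)
    then have "op_norm (transpose A) * norm (A *v x - \<theta> - (A *v y - \<theta>)) \<le> op_norm (transpose A) * (op_norm A * norm (x - y))"
      by (rule mult_left_mono[OF _ op_norm_nonneg])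
    then show "dist (gradient (\<lambda>x. huber_objective A x \<theta>) x) (gradient (\<lambda>x. huber_objective A x \<theta>) y)
        \<le> op_norm (transpose A) * op_norm A * dist x y"
      unfolding smooth_convex_gradient[OF smooth_convex_huber_objective] dist_norm
      using gradient_huber_objective_lipschitz[of A "A *v x - \<theta>" "A *v y - \<theta>"] by (simp add: mult.assoc)
  qed (simp add: op_norm_nonneg)
  show "convex_on UNIV (\<lambda>x. huber_objective A x \<theta>)" by (rule smooth_convex_convex_on[OF smooth_convex_huber_objective])
  show "argmin_set (\<lambda>x. huber_objective A x \<theta>) \<noteq> {}" by (rule huber_argmin_nonempty)
qed (rule locally_lipschitz_partial_gradient_huber)

text \<open>The chain rule fails at a kink, but when the inner derivative is 0 the Lipschitz bound
  on \<open>clip\<close> suffices.\<close>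

lemma clip_has_vector_derivative_zero:
  assumes "(g has_vector_derivative 0) (at t)" shows "((\<lambda>s. clip (g s)) has_vector_derivative 0) (at t)"
proof -
  have alt: "(f has_vector_derivative 0) (at t) \<longleftrightarrow>
      (\<forall>e>0. \<exists>d>0. \<forall>y. norm (y - t) < d \<longrightarrow> \<bar>f y - f t\<bar> \<le> e * norm (y - t))" for f :: "real \<Rightarrow> real"
    unfolding has_vector_derivative_def has_derivative_at_alt by (simp add: bounded_linear_zero)
  show ?thesis
    using assms clip_lipschitz unfolding alt by (meson order_trans)
qed

text \<open>In a kink coordinate the curve returns to the same value at times accumulating at
  \<open>t\<close>, so its velocity there is 0. Every admissible weight is then multiplied by 0, and
  the result holds for all of them.\<close>

lemma clip_vec_path_derivative:
  fixes y :: "real \<Rightarrow> real^'m"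
  assumes y: "(y has_vector_derivative w) (at t)" and q: "huber_weights q (y t)"
    and acc: "\<And>i s. \<bar>s\<bar> = 1 \<Longrightarrow> y t $ i = s \<Longrightarrow> t islimpt {r. y r $ i = s}"
  shows "((\<lambda>s. clip_vec (y s)) has_vector_derivative (diag_mat q *v w)) (at t)"
proof (rule has_vector_derivative_componentwise)
  fix i
  have yi: "((\<lambda>s. y s $ i) has_vector_derivative (w $ i)) (at t)"
    using bounded_linear.has_vector_derivative[OF bounded_linear_vec_nth y] .
  have "((\<lambda>s. clip (y s $ i)) has_vector_derivative (q $ i * w $ i)) (at t)"
  proof (cases "\<bar>y t $ i\<bar> = 1")
    case True
    have "w $ i = 0"
      by (rule has_vector_derivative_zero_at_limpt[OF yi acc[OF True refl]]) simp
    then show ?thesis using clip_has_vector_derivative_zero yi by simp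
  next
    case False
    have "q $ i = (if \<bar>y t $ i\<bar> < 1 then 1 else 0)" using q False by (auto simp: huber_weights_def)
    then have "(clip has_real_derivative q $ i) (at (y t $ i))" using clip_derivative[OF False] by simp
    from DERIV_chain'[OF yi[folded has_real_derivative_iff_has_vector_derivative] this]
    show ?thesis by (simp add: has_real_derivative_iff_has_vector_derivative)
  qed
  then show "((\<lambda>s. clip_vec (y s) $ i) has_vector_derivative ((diag_mat q *v w) $ i)) (at t)"
    by (simp add: clip_vec_def diag_mat_vector)
qed

lemma conservative_huber_JF:
  fixes A :: "real^'n^'m"
  shows "conservative_jacobian UNIV (partial_gradient (huber_objective A)) (huber_JF A)"
  unfolding conservative_jacobian_def
proof (intro conjI ballI allI impI)
  show "locally_lipschitz_on UNIV (partial_gradient (huber_objective A))"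
    by (rule locally_lipschitz_partial_gradient_huber)
  show "huber_JF A z \<noteq> {}" for z unfolding huber_JF_eq using huber_weights_exists by blast
  have cont: "continuous_on X (JF_matrix A)" for X
    using linear_JF_matrix by (intro linear_continuous_on) (simp add: linear_conv_bounded_linear)
  show "\<exists>r>0. bounded (\<Union>y\<in>UNIV \<inter> ball z r. huber_JF A y)" for z
  proof (intro exI conjI)
    show "bounded (\<Union>y\<in>UNIV \<inter> ball z 1. huber_JF A y)"
    proof (rule bounded_subset)
      show "bounded (JF_matrix A ` cbox 0 One)"
        by (intro compact_imp_bounded compact_continuous_image cont compact_cbox)
      show "(\<Union>y\<in>UNIV \<inter> ball z 1. huber_JF A y) \<subseteq> JF_matrix A ` cbox 0 One"
        unfolding huber_JF_eq using huber_weights_in_cube by blast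
    qed
  qed simp
  have "closed (multi_graph_on UNIV (huber_JF A))"
    unfolding closed_sequential_limits
  proof (intro allI impI, elim conjE)
    fix p l assume p: "\<forall>k. p k \<in> multi_graph_on UNIV (huber_JF A)" and l: "p \<longlonglongrightarrow> l"
    then have "\<forall>k. \<exists>q. huber_weights q (residual A (fst (p k))) \<and> snd (p k) = JF_matrix A q"
      by (fastforce simp: multi_graph_on_def huber_JF_eq case_prod_beta)
    then obtain q where q: "\<And>k. huber_weights (q k) (residual A (fst (p k)))" "\<And>k. snd (p k) = JF_matrix A (q k)" by metis
    have "\<forall>k. q k \<in> cbox 0 One" using q(1) huber_weights_in_cube by blast
    then obtain q0 r where r: "strict_mono (r :: nat \<Rightarrow> nat)" "(q \<circ> r) \<longlonglongrightarrow> q0"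
      using compact_cbox[of "0::real^'m" One] unfolding compact_def by metis
    have pr: "(\<lambda>k. p (r k)) \<longlonglongrightarrow> l" using LIMSEQ_subseq_LIMSEQ[OF l r(1)] by (simp add: o_def)
    have "(\<lambda>k. residual A (fst (p (r k)))) \<longlonglongrightarrow> residual A (fst l)"
      by (intro bounded_linear.tendsto[OF bounded_linear_residual] tendsto_fst pr)
    then have "huber_weights q0 (residual A (fst l))"
      by (rule huber_weights_limit[rotated]) (use q(1) r(2) in \<open>auto simp: o_def\<close>)
    moreover have "(\<lambda>k. JF_matrix A (q (r k))) \<longlonglongrightarrow> JF_matrix A q0"
      using linear_JF_matrix r(2) by (intro bounded_linear.tendsto[of "JF_matrix A"]) (auto simp: linear_conv_bounded_linear o_def)
    then have "snd l = JF_matrix A q0"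
      using LIMSEQ_unique[OF tendsto_snd[OF pr]] by (simp add: q(2))
    ultimately show "l \<in> multi_graph_on UNIV (huber_JF A)"
      by (auto simp: multi_graph_on_def huber_JF_eq case_prod_beta)
  qed
  then show "closedin (top_of_set (UNIV \<times> UNIV)) (multi_graph_on UNIV (huber_JF A))"
    by (simp flip: closed_closedin)
  fix c :: "real \<Rightarrow> real^('n::finite + 'm::finite)"
  assume c: "abs_continuous_on 0 1 c \<and> c ` {0..1} \<subseteq> UNIV"
  let ?y = "\<lambda>t. residual A (c t)"
  obtain N where N: "negligible N" "\<And>t. t \<in> {0<..<1} - N \<Longrightarrow> \<exists>v. (c has_vector_derivative v) (at t)"
    using abs_continuous_on_differentiable c by blast
  define T where "T = (\<lambda>(i, s). {t. ?y t $ i = s})"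
  \<comment> \<open>Beyond the times without a derivative, only times at which some residual
    coordinate takes the value 1 or -1 in isolation are excluded.\<close>
  define M where "M = N \<union> (\<Union>p\<in>UNIV \<times> {1, -1}. {t\<in>T p. \<not> t islimpt T p})"
  have "negligible M"
    unfolding M_def
    by (intro negligible_Un N negligible_Union finite_imageI) (simp, erule imageE, simp only: negligible_isolated_points)
  then show "AE t in lebesgue_on {0..1}. \<exists>v. (c has_vector_derivative v) (at t within {0..1}) \<and>
      (\<forall>V\<in>huber_JF A (c t). ((\<lambda>s. partial_gradient (huber_objective A) (c s)) has_vector_derivative V *v v) (at t within {0..1}))"
  proof (rule AE_unit_interval)
    fix t assume t: "t \<in> {0<..<1} - M"
    then obtain v where v: "(c has_vector_derivative v) (at t)" using N(2) by (auto simp: M_def)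
    have y: "(?y has_vector_derivative residual A v) (at t)"
      by (rule bounded_linear.has_vector_derivative[OF bounded_linear_residual v])
    have acc: "t islimpt {r. ?y r $ i = s}" if "\<bar>s\<bar> = 1" "?y t $ i = s" for i s
    proof -
      have "(i, s) \<in> UNIV \<times> {1, -1}" using that(1) by auto
      then have "\<not> (t \<in> T (i, s) \<and> \<not> t islimpt T (i, s))" using t unfolding M_def by blast
      then show ?thesis using that(2) by (simp add: T_def)
    qed
    have "((\<lambda>s. partial_gradient (huber_objective A) (c s)) has_vector_derivative V *v v) (at t within {0..1})"
      if V: "V \<in> huber_JF A (c t)" for V
    proof -
      obtain q where q: "V = JF_matrix A q" "huber_weights q (?y t)" using V by (auto simp: huber_JF_eq)
      have "((\<lambda>s. clip_vec (?y s)) has_vector_derivative (diag_mat q *v residual A v)) (at t)"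
        by (rule clip_vec_path_derivative[OF y q(2) acc])
      from bounded_linear.has_vector_derivative[OF matrix_vector_mul_bounded_linear this, of "transpose A"]
      show ?thesis
        unfolding q(1) JF_matrix_vector partial_gradient_huber by (rule has_vector_derivative_at_within)
    qed
    with v show "\<exists>v. (c has_vector_derivative v) (at t within {0..1}) \<and>
      (\<forall>V\<in>huber_JF A (c t). ((\<lambda>s. partial_gradient (huber_objective A) (c s)) has_vector_derivative V *v v) (at t within {0..1}))"
      using has_vector_derivative_at_within by blast
  qed
qed simp

section \<open>The limiting Jacobian\<close>

text \<open>The linear system replaces \<open>matrix_inv\<close>: it is a polynomial condition on
  the entries, so it is usable in definable formulas, and it has the shape of the regularized
  equations already bounded.\<close>

definition resolvent_jacobian :: "real^'n^'m \<Rightarrow> real \<Rightarrow> real^'m \<Rightarrow> real^'m^'n \<Rightarrow> bool" where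
  "resolvent_jacobian A \<epsilon> q V \<longleftrightarrow>
     (transpose A ** diag_mat q ** A + \<epsilon> *\<^sub>R mat 1) ** V = transpose A ** diag_mat q"

lemma scaleR_mat_vector: "(\<epsilon> *\<^sub>R mat 1 :: real^'n^'n) *v x = \<epsilon> *\<^sub>R x"
  by (metis matrix_vector_mul_lid scaleR_matrix_vector_assoc)

lemma resolvent_jacobian_vector:
  fixes A :: "real^'n^'m"
  shows "resolvent_jacobian A \<epsilon> q V \<longleftrightarrow>
    (\<forall>w. transpose A *v (diag_mat q *v (A *v (V *v w) - w)) + \<epsilon> *\<^sub>R (V *v w) = 0)"
proof -
  have "((transpose A ** diag_mat q ** A + \<epsilon> *\<^sub>R mat 1) ** V) *v w - (transpose A ** diag_mat q) *v w
      = transpose A *v (diag_mat q *v (A *v (V *v w) - w)) + \<epsilon> *\<^sub>R (V *v w)" for w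
    by (simp add: matrix_vector_mul_assoc[symmetric] matrix_vector_mult_add_rdistrib scaleR_mat_vector
        matrix_vector_mult_diff_distrib)
  then show ?thesis
    unfolding resolvent_jacobian_def matrix_eq by (metis right_minus_eq)
qed

text \<open>A null vector solves the regularized equation with zero data, so the bound by
  \<open>chi_number A\<close> makes it 0.\<close>

lemma invertible_regularized_gram:
  fixes A :: "real^'n^'m"
  assumes q: "\<And>i. 0 \<le> q $ i" and "0 < \<epsilon>"
  shows "invertible (transpose A ** diag_mat q ** A + \<epsilon> *\<^sub>R mat 1)" (is "invertible ?H")
proof -
  have "x = 0" if "?H *v x = 0" for x
  proof -
    have "transpose A *v (diag_mat q *v (A *v x - 0)) + \<epsilon> *\<^sub>R x = 0"
      using that by (simp add: matrix_vector_mult_add_rdistrib scaleR_mat_vector matrix_vector_mul_assoc matrix_mul_assoc)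
    from regularized_least_squares_bound[OF q \<open>0 < \<epsilon>\<close> this] show ?thesis by simp
  qed
  then have "\<exists>B. B ** ?H = mat 1" by (simp add: matrix_left_invertible_ker)
  then show ?thesis by (simp add: invertible_left_inverse)
qed

lemma
  fixes M :: "real^'n^'n"
  assumes "invertible M"
  shows matrix_inv_right: "M ** matrix_inv M = mat 1" and matrix_inv_left: "matrix_inv M ** M = mat 1"
  using someI_ex[OF assms[unfolded invertible_def]] by (simp_all add: matrix_inv_def)

lemma J_reg_huber:
  fixes A :: "real^'n^'m"
  assumes "0 < \<epsilon>"
  shows "J_reg (huber_objective A) (huber_JF A) \<epsilon> \<theta> =
    {V. \<exists>q. huber_weights q (A *v x_reg (huber_objective A) \<epsilon> \<theta> - \<theta>) \<and> resolvent_jacobian A \<epsilon> q V}"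
proof -
  let ?x = "x_reg (huber_objective A) \<epsilon> \<theta>"
  have neg: "- (B ** (- N)) = B ** N" for B :: "real^'n^'n" and N :: "real^'m^'n"
    by (simp add: matrix_matrix_mult_def vec_eq_iff sum_negf)
  have mem: "hcat H M \<in> huber_JF A (join_vec ?x \<theta>) \<longleftrightarrow>
      (\<exists>q. huber_weights q (A *v ?x - \<theta>) \<and> H = transpose A ** diag_mat q ** A \<and> M = - (transpose A ** diag_mat q))" for H M
    unfolding huber_JF_eq JF_matrix_def residual_def by (auto simp: hcat_eq_iff)
  have "J_reg (huber_objective A) (huber_JF A) \<epsilon> \<theta> =
    {V. \<exists>q. huber_weights q (A *v ?x - \<theta>) \<and>
       V = matrix_inv (transpose A ** diag_mat q ** A + \<epsilon> *\<^sub>R mat 1) ** (transpose A ** diag_mat q)}"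
    unfolding J_reg_def mem using neg by (auto intro: exI) (metis neg)+
  moreover have "V = matrix_inv (transpose A ** diag_mat q ** A + \<epsilon> *\<^sub>R mat 1) ** (transpose A ** diag_mat q)
      \<longleftrightarrow> resolvent_jacobian A \<epsilon> q V" if "huber_weights q (A *v ?x - \<theta>)" for q V
  proof -
    let ?H = "transpose A ** diag_mat q ** A + \<epsilon> *\<^sub>R mat 1"
    have inv: "invertible ?H" using that huber_weights_nonneg assms by (intro invertible_regularized_gram) auto
    have "?H ** (matrix_inv ?H ** N) = N" "matrix_inv ?H ** (?H ** N) = N" for N :: "real^'m^'n"
      by (simp_all add: matrix_mul_assoc matrix_inv_right[OF inv] matrix_inv_left[OF inv])
    then show ?thesis unfolding resolvent_jacobian_def by metis
  qed
  ultimately show ?thesis by auto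
qed

lemma resolvent_jacobian_exists:
  fixes A :: "real^'n^'m"
  assumes q: "\<And>i. 0 \<le> q $ i" and "0 < \<epsilon>"
  obtains V where "resolvent_jacobian A \<epsilon> q V"
proof
  let ?H = "transpose A ** diag_mat q ** A + \<epsilon> *\<^sub>R mat 1"
  have inv: "invertible ?H" using assms by (rule invertible_regularized_gram)
  show "resolvent_jacobian A \<epsilon> q (matrix_inv ?H ** (transpose A ** diag_mat q))"
    unfolding resolvent_jacobian_def by (simp add: matrix_mul_assoc matrix_inv_right[OF inv])
qed

text \<open>Converts a bound in operator norm into one for \<open>norm\<close>, which on matrices is
  the Frobenius norm and governs boundedness and compactness here.\<close>

lemma norm_matrix_le:
  fixes V :: "real^'m^'n"
  assumes "\<And>w. norm (V *v w) \<le> c * norm w"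
  shows "norm V \<le> real CARD('n) * (real CARD('m) * c)"
proof -
  have e: "\<bar>V $ i $ j\<bar> \<le> c" for i j
  proof -
    have "V $ i $ j = (V *v axis j 1) $ i" by (simp add: matrix_vector_mul_component inner_axis)
    then have "\<bar>V $ i $ j\<bar> \<le> norm (V *v axis j 1)" using component_le_norm_cart[of "V *v axis j 1" i] by simp
    also have "\<dots> \<le> c" using assms[of "axis j 1"] by (simp add: norm_axis_1)
    finally show ?thesis .
  qed
  have "norm V \<le> (\<Sum>i\<in>UNIV. norm (V $ i))" unfolding norm_vec_def[of V] by (rule L2_set_le_sum) simp
  also have "\<dots> \<le> (\<Sum>i\<in>(UNIV::'n set). \<Sum>j\<in>(UNIV::'m set). c)"
    by (intro sum_mono order_trans[OF norm_le_l1_cart] e)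
  finally show ?thesis by simp
qed

lemma resolvent_jacobian_bound:
  fixes A :: "real^'n^'m"
  assumes "\<And>i. 0 \<le> q $ i" "0 < \<epsilon>" "resolvent_jacobian A \<epsilon> q V"
  shows "norm V \<le> real CARD('n) * (real CARD('m) * chi_number A)"
  using assms by (intro norm_matrix_le regularized_least_squares_bound[of q \<epsilon>]) (auto simp: resolvent_jacobian_vector)

text \<open>Convergence of the regularized solutions to \<open>x_min\<close> is automatic, so it
  disappears from the condition, and the sequences turn into approximation within every
  \<open>\<delta>\<close>. Conversely a sequence is built by dependent choice, since
  \<open>J_min\<close> wants the regularization parameters decreasing.\<close>

lemma J_min_huber_iff:
  fixes A :: "real^'n^'m"
  assumes "0 < \<epsilon>max"
  shows "V \<in> J_min (huber_objective A) UNIV \<epsilon>max (huber_JF A) \<theta> \<longleftrightarrow>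
    (\<forall>\<delta>>0. \<exists>\<theta>' \<epsilon> V' q. norm (\<theta>' - \<theta>) < \<delta> \<and> 0 < \<epsilon> \<and> \<epsilon> < \<delta> \<and> \<epsilon> \<le> \<epsilon>max \<and> norm (V' - V) < \<delta> \<and>
       huber_weights q (A *v x_reg (huber_objective A) \<epsilon> \<theta>' - \<theta>') \<and> resolvent_jacobian A \<epsilon> q V')"
    (is "?L \<longleftrightarrow> ?R")
proof
  assume ?L
  then obtain \<theta>s \<epsilon>s Vs where s: "\<theta>s \<longlonglongrightarrow> \<theta>" "\<And>k::nat. 0 < \<epsilon>s k \<and> \<epsilon>s k \<le> \<epsilon>max" "\<epsilon>s \<longlonglongrightarrow> 0"
    "\<And>k. Vs k \<in> J_reg (huber_objective A) (huber_JF A) (\<epsilon>s k) (\<theta>s k)" "Vs \<longlonglongrightarrow> V"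
    unfolding J_min_def by blast
  show ?R
  proof (intro allI impI)
    fix \<delta> :: real assume \<delta>: "0 < \<delta>"
    have "\<forall>\<^sub>F k in sequentially. norm (\<theta>s k - \<theta>) < \<delta> \<and> \<epsilon>s k < \<delta> \<and> norm (Vs k - V) < \<delta>"
      using tendstoD[OF s(1) \<delta>] tendstoD[OF s(5) \<delta>] order_tendstoD(2)[OF s(3) \<delta>]
      by eventually_elim (simp add: dist_norm)
    then obtain k where k: "norm (\<theta>s k - \<theta>) < \<delta>" "\<epsilon>s k < \<delta>" "norm (Vs k - V) < \<delta>"
      by (metis (mono_tags, lifting) eventually_happens' sequentially_bot)
    moreover obtain q where "huber_weights q (A *v x_reg (huber_objective A) (\<epsilon>s k) (\<theta>s k) - \<theta>s k)"
      "resolvent_jacobian A (\<epsilon>s k) q (Vs k)"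
      using s(4)[of k] s(2)[of k] by (auto simp: J_reg_huber)
    ultimately show "\<exists>\<theta>' \<epsilon> V' q. norm (\<theta>' - \<theta>) < \<delta> \<and> 0 < \<epsilon> \<and> \<epsilon> < \<delta> \<and> \<epsilon> \<le> \<epsilon>max \<and> norm (V' - V) < \<delta> \<and>
       huber_weights q (A *v x_reg (huber_objective A) \<epsilon> \<theta>' - \<theta>') \<and> resolvent_jacobian A \<epsilon> q V'"
      using s(2)[of k] by blast
  qed
next
  assume R: ?R
  define Q where "Q \<delta> z \<longleftrightarrow> norm (fst z - \<theta>) < \<delta> \<and> 0 < fst (snd z) \<and> fst (snd z) < \<delta> \<and> fst (snd z) \<le> \<epsilon>max \<and>
     norm (snd (snd z) - V) < \<delta> \<and> snd (snd z) \<in> J_reg (huber_objective A) (huber_JF A) (fst (snd z)) (fst z)"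
    for \<delta> and z :: "(real^'m) \<times> real \<times> (real^'m^'n)"
  have ex: "\<exists>z. Q \<delta> z" if \<delta>: "0 < \<delta>" for \<delta>
  proof -
    obtain \<theta>' \<epsilon> V' q where "norm (\<theta>' - \<theta>) < \<delta>" "0 < \<epsilon>" "\<epsilon> < \<delta>" "\<epsilon> \<le> \<epsilon>max" "norm (V' - V) < \<delta>"
       "huber_weights q (A *v x_reg (huber_objective A) \<epsilon> \<theta>' - \<theta>')" "resolvent_jacobian A \<epsilon> q V'"
      using R \<delta> by blast
    then show ?thesis by (intro exI[of _ "(\<theta>', \<epsilon>, V')"]) (auto simp: Q_def J_reg_huber)
  qed
  have mono: "Q b z" if "Q a z" "a \<le> b" for a b z using that by (auto simp: Q_def)
  have "\<exists>z. \<forall>k. Q (inverse (real (Suc k))) (z k) \<and> fst (snd (z (Suc k))) \<le> fst (snd (z k))"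
  proof (rule dependent_nat_choice)
    show "\<exists>z. Q (inverse (real (Suc 0))) z" by (rule ex) simp
    fix z k assume z: "Q (inverse (real (Suc k))) z"
    then have "0 < min (inverse (real (Suc (Suc k)))) (fst (snd z))" by (simp add: Q_def)
    \<comment> \<open>Bounding by the previous regularization parameter as well keeps the sequence
      monotone.\<close>
    then obtain z' where z': "Q (min (inverse (real (Suc (Suc k)))) (fst (snd z))) z'" using ex by blast
    then have "fst (snd z') \<le> fst (snd z)" by (simp add: Q_def)
    moreover have "Q (inverse (real (Suc (Suc k)))) z'" by (rule mono[OF z']) simp
    ultimately show "\<exists>z'. Q (inverse (real (Suc (Suc k)))) z' \<and> fst (snd z') \<le> fst (snd z)" by blast
  qed
  then obtain z where z: "\<And>k. Q (inverse (real (Suc k))) (z k)" "\<And>k. fst (snd (z (Suc k))) \<le> fst (snd (z k))" by blast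
  have inv: "(\<lambda>k. inverse (real (Suc k))) \<longlonglongrightarrow> 0" by (rule LIMSEQ_inverse_real_of_nat)
  have "(\<lambda>k. fst (z k) - \<theta>) \<longlonglongrightarrow> 0"
    by (rule Lim_null_comparison[OF _ inv]) (use z(1) in \<open>auto simp: Q_def less_imp_le\<close>)
  then have \<theta>: "(\<lambda>k. fst (z k)) \<longlonglongrightarrow> \<theta>" by (simp add: LIM_zero_iff)
  have "(\<lambda>k. snd (snd (z k)) - V) \<longlonglongrightarrow> 0"
    by (rule Lim_null_comparison[OF _ inv]) (use z(1) in \<open>auto simp: Q_def less_imp_le\<close>)
  then have V: "(\<lambda>k. snd (snd (z k))) \<longlonglongrightarrow> V" by (simp add: LIM_zero_iff)
  have \<epsilon>: "(\<lambda>k. fst (snd (z k))) \<longlonglongrightarrow> 0"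
    by (rule Lim_null_comparison[OF _ inv]) (use z(1) in \<open>auto simp: Q_def less_imp_le abs_of_pos\<close>)
  have pos: "0 < fst (snd (z k))" for k using z(1) by (simp add: Q_def)
  have "(\<lambda>k. x_reg (huber_objective A) (fst (snd (z k))) (fst (z k))) \<longlonglongrightarrow> x_min (huber_objective A) \<theta>"
    by (rule x_reg_tendsto_x_min[OF \<epsilon> pos \<theta>])
  moreover have "decseq (\<lambda>k. fst (snd (z k)))" by (rule decseq_SucI) (rule z(2))
  ultimately show ?L
    unfolding J_min_def using \<theta> V \<epsilon> z(1)
    by (intro CollectI exI[of _ "\<lambda>k. fst (z k)"] exI[of _ "\<lambda>k. fst (snd (z k))"] exI[of _ "\<lambda>k. snd (snd (z k))"])
      (simp add: Q_def)
qed

lemma J_min_huber_bounded: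
  fixes A :: "real^'n^'m"
  assumes "0 < \<epsilon>max" "V \<in> J_min (huber_objective A) UNIV \<epsilon>max (huber_JF A) \<theta>"
  shows "norm V \<le> real CARD('n) * (real CARD('m) * chi_number A) + 1"
proof -
  obtain \<epsilon> V' q y where "0 < \<epsilon>" "norm (V' - V) < 1" "huber_weights q y" "resolvent_jacobian A \<epsilon> q V'"
    using assms(2) unfolding J_min_huber_iff[OF assms(1)] using zero_less_one by blast
  then have "norm V' \<le> real CARD('n) * (real CARD('m) * chi_number A)"
    using huber_weights_nonneg by (intro resolvent_jacobian_bound[of q \<epsilon>]) auto
  moreover have "norm V \<le> norm V' + norm (V' - V)" by (metis add.commute norm_minus_commute norm_triangle_sub)
  ultimately show ?thesis using \<open>norm (V' - V) < 1\<close> by linarith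
qed

lemma J_min_huber_nonempty:
  fixes A :: "real^'n^'m"
  assumes "0 < \<epsilon>max"
  shows "J_min (huber_objective A) UNIV \<epsilon>max (huber_JF A) \<theta> \<noteq> {}"
proof -
  define e where "e k = min \<epsilon>max (inverse (real (Suc k)))" for k
  have e: "0 < e k" "e k \<le> \<epsilon>max" "e k \<le> inverse (real (Suc k))" for k using assms by (auto simp: e_def)
  have "\<exists>q V. huber_weights q (A *v x_reg (huber_objective A) (e k) \<theta> - \<theta>) \<and> resolvent_jacobian A (e k) q V" for k
  proof -
    obtain q where q: "huber_weights q (A *v x_reg (huber_objective A) (e k) \<theta> - \<theta>)" by (rule huber_weights_exists)
    obtain V where "resolvent_jacobian A (e k) q V"
      using resolvent_jacobian_exists[OF huber_weights_nonneg[OF q] e(1)] by blast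
    with q show ?thesis by blast
  qed
  then obtain q V where qV: "\<And>k. huber_weights (q k) (A *v x_reg (huber_objective A) (e k) \<theta> - \<theta>)"
    "\<And>k. resolvent_jacobian A (e k) (q k) (V k)" by metis
  define B where "B = real CARD('n) * (real CARD('m) * chi_number A)"
  have "\<forall>k. V k \<in> cball 0 B"
    unfolding B_def using resolvent_jacobian_bound[OF huber_weights_nonneg[OF qV(1)] e(1) qV(2)] by simp
  then obtain W r where r: "strict_mono (r :: nat \<Rightarrow> nat)" "(V \<circ> r) \<longlonglongrightarrow> W"
    using compact_cball[of "0 :: real^'m^'n" B] unfolding compact_def by metis
  have "W \<in> J_min (huber_objective A) UNIV \<epsilon>max (huber_JF A) \<theta>"
    unfolding J_min_huber_iff[OF assms]
  proof (intro allI impI)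
    fix \<delta> :: real assume \<delta>: "0 < \<delta>"
    have "(\<lambda>k. inverse (real (Suc (r k)))) \<longlonglongrightarrow> 0"
      using LIMSEQ_subseq_LIMSEQ[OF LIMSEQ_inverse_real_of_nat r(1)] by (simp add: o_def)
    then have "\<forall>\<^sub>F k in sequentially. inverse (real (Suc (r k))) < \<delta> \<and> norm (V (r k) - W) < \<delta>"
      using tendstoD[OF r(2) \<delta>] order_tendstoD(2)[OF _ \<delta>] by (force intro: eventually_conj simp: dist_norm)
    then obtain k where k: "inverse (real (Suc (r k))) < \<delta>" "norm (V (r k) - W) < \<delta>"
      by (metis (mono_tags, lifting) eventually_happens' sequentially_bot)
    show "\<exists>\<theta>' \<epsilon> V' q. norm (\<theta>' - \<theta>) < \<delta> \<and> 0 < \<epsilon> \<and> \<epsilon> < \<delta> \<and> \<epsilon> \<le> \<epsilon>max \<and> norm (V' - W) < \<delta> \<and>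
       huber_weights q (A *v x_reg (huber_objective A) \<epsilon> \<theta>' - \<theta>') \<and> resolvent_jacobian A \<epsilon> q V'"
      using k e[of "r k"] qV[of "r k"] \<delta>
      by (intro exI[of _ \<theta>] exI[of _ "e (r k)"] exI[of _ "V (r k)"] exI[of _ "q (r k)"]) simp
  qed
  then show ?thesis by blast
qed

text \<open>The approximation form is closed by its nature: a point of the graph within
  \<open>\<delta> / 2\<close> of the limit is itself approximated within
  \<open>\<delta> / 2\<close>.\<close>

lemma J_min_huber_closed:
  fixes A :: "real^'n^'m"
  assumes "0 < \<epsilon>max"
  shows "closed (multi_graph_on UNIV (J_min (huber_objective A) UNIV \<epsilon>max (huber_JF A)))"
  unfolding closed_sequential_limits
proof (intro allI impI, elim conjE)
  fix p l assume p: "\<forall>k. p k \<in> multi_graph_on UNIV (J_min (huber_objective A) UNIV \<epsilon>max (huber_JF A))" and l: "p \<longlonglongrightarrow> l"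
  have "snd l \<in> J_min (huber_objective A) UNIV \<epsilon>max (huber_JF A) (fst l)"
    unfolding J_min_huber_iff[OF assms]
  proof (intro allI impI)
    fix \<delta> :: real assume \<delta>: "0 < \<delta>"
    have "\<forall>\<^sub>F k in sequentially. dist (fst (p k)) (fst l) < \<delta> / 2 \<and> dist (snd (p k)) (snd l) < \<delta> / 2"
      using tendstoD[OF tendsto_fst[OF l], of "\<delta> / 2"] tendstoD[OF tendsto_snd[OF l], of "\<delta> / 2"] \<delta>
      by (simp add: eventually_conj)
    then obtain k where k: "dist (fst (p k)) (fst l) < \<delta> / 2" "dist (snd (p k)) (snd l) < \<delta> / 2"
      by (metis (mono_tags, lifting) eventually_happens' sequentially_bot)
    have "snd (p k) \<in> J_min (huber_objective A) UNIV \<epsilon>max (huber_JF A) (fst (p k))"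
      using p by (auto simp: multi_graph_on_def case_prod_beta)
    moreover have "0 < \<delta> / 2" using \<delta> by simp
    ultimately obtain \<theta>' \<epsilon> V' q where h: "norm (\<theta>' - fst (p k)) < \<delta> / 2" "0 < \<epsilon>" "\<epsilon> < \<delta> / 2" "\<epsilon> \<le> \<epsilon>max"
      "norm (V' - snd (p k)) < \<delta> / 2" "huber_weights q (A *v x_reg (huber_objective A) \<epsilon> \<theta>' - \<theta>')" "resolvent_jacobian A \<epsilon> q V'"
      unfolding J_min_huber_iff[OF assms] by blast
    have "norm (\<theta>' - fst l) < \<delta>" "norm (V' - snd l) < \<delta>"
      using h(1,5) k dist_triangle_half_l[of _ "fst (p k)"] dist_triangle[of \<theta>' "fst l" "fst (p k)"]
        dist_triangle[of V' "snd l" "snd (p k)"] unfolding dist_norm by linarith+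
    moreover have "\<epsilon> < \<delta>" using h \<delta> by simp
    ultimately show "\<exists>\<theta>' \<epsilon> V' q. norm (\<theta>' - fst l) < \<delta> \<and> 0 < \<epsilon> \<and> \<epsilon> < \<delta> \<and> \<epsilon> \<le> \<epsilon>max \<and> norm (V' - snd l) < \<delta> \<and>
       huber_weights q (A *v x_reg (huber_objective A) \<epsilon> \<theta>' - \<theta>') \<and> resolvent_jacobian A \<epsilon> q V'"
      using h by blast
  qed
  then show "l \<in> multi_graph_on UNIV (J_min (huber_objective A) UNIV \<epsilon>max (huber_JF A))"
    by (simp add: multi_graph_on_def case_prod_beta)
qed

text \<open>
  A pattern \<open>(I, E, P)\<close> records the coordinates of a residual \<open>y\<close> with \<open>\<bar>y\<^sub>i\<bar> < 1\<close>, with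
  \<open>\<bar>y\<^sub>i\<bar> = 1\<close>, and with \<open>y\<^sub>i \<ge> 1\<close>. Limits of regularized solutions of a fixed pattern as \<open>\<epsilon>\<close> tends
  to \<open>0\<close> lie in the affine space \<open>limit_cell\<close>: the component of the optimality condition along the
  null space of the rows in \<open>I\<close> forces the regularized solutions to be orthogonal to it.
  \<open>limit_directions\<close> is the direction of that space, and every limit of Jacobians along the pattern
  maps \<open>\<theta>'\<close> to \<open>\<xi>\<close> for each direction \<open>(\<theta>', \<xi>)\<close>, whatever the weights in the coordinates of \<open>E\<close>.
\<close>

definition saturation :: "'m set \<Rightarrow> 'm set \<Rightarrow> real^'m" where
  "saturation I P = (\<chi> i. if i \<in> I then 0 else if i \<in> P then 1 else -1)"

definition limit_cell :: "real^'n^'m \<Rightarrow> 'm set \<times> 'm set \<times> 'm set \<Rightarrow> ((real^'m) \<times> (real^'n)) set" where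
  "limit_cell A = (\<lambda>(I, E, P). {(\<theta>, x).
     (\<forall>n. partial_id I *v (A *v n) = 0 \<longrightarrow> n \<bullet> x = 0) \<and>
     transpose A *v (partial_id I *v (A *v x - \<theta>)) + transpose A *v saturation I P = 0 \<and>
     (\<forall>i\<in>E. (A *v x - \<theta>) $ i = saturation {} P $ i)})"

definition limit_directions :: "real^'n^'m \<Rightarrow> 'm set \<times> 'm set \<times> 'm set \<Rightarrow> ((real^'m) \<times> (real^'n)) set" where
  "limit_directions A = (\<lambda>(I, E, P). {(\<theta>, x).
     (\<forall>n. partial_id I *v (A *v n) = 0 \<longrightarrow> n \<bullet> x = 0) \<and>
     transpose A *v (partial_id I *v (A *v x - \<theta>)) = 0 \<and>
     (\<forall>i\<in>E. (A *v x - \<theta>) $ i = 0)})"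

definition pattern :: "real^'m \<Rightarrow> 'm set \<times> 'm set \<times> 'm set" where
  "pattern y = ({i. \<bar>y $ i\<bar> < 1}, {i. \<bar>y $ i\<bar> = 1}, {i. 1 \<le> y $ i})"

lemma transpose_partial_id: "transpose (partial_id I) = partial_id I"
  by (auto simp: transpose_def partial_id_def vec_eq_iff)

text \<open>A limit direction solves the regularized equation exactly once its parameter is shifted
  by a multiple of \<open>\<epsilon>s k\<close>. Uniqueness then gives the value of
  \<open>Vs k\<close> there, and the shift vanishes in the limit.\<close>

lemma resolvent_jacobian_on_limit_directions:
  fixes A :: "real^'n^'m"
  assumes V: "\<And>k::nat. resolvent_jacobian A (\<epsilon>s k) (qs k) (Vs k)" "\<And>k. 0 < \<epsilon>s k" "\<epsilon>s \<longlonglongrightarrow> 0" "Vs \<longlonglongrightarrow> V"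
    and pat: "\<And>k. huber_weights (qs k) (ys k)" "\<And>k. pattern (ys k) = (I, E, P)"
    and dir: "(\<theta>, \<xi>) \<in> limit_directions A (I, E, P)"
  shows "V *v \<theta> = \<xi>"
proof -
  have L: "\<And>n. partial_id I *v (A *v n) = 0 \<Longrightarrow> n \<bullet> \<xi> = 0"
    "transpose A *v (partial_id I *v (A *v \<xi> - \<theta>)) = 0" "\<And>i. i \<in> E \<Longrightarrow> (A *v \<xi> - \<theta>) $ i = 0"
    using dir by (auto simp: limit_directions_def)
  \<comment> \<open>As \<open>\<xi>\<close> is orthogonal to the null space of the rows in
    \<open>I\<close>, it is a combination of these rows. The coefficients \<open>w\<close> let a
    shift of \<open>\<theta>\<close> absorb the term
    \<open>\<epsilon>s k *\<^sub>R \<xi>\<close>.\<close>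
  obtain w where w: "\<xi> = transpose (partial_id I ** A) *v w"
    using orthogonal_null_space_imp_range_transpose[of "partial_id I ** A" \<xi>] L(1)
    by (auto simp: matrix_vector_mul_assoc)
  have w': "transpose A *v (partial_id I *v w) = \<xi>"
    using w by (simp add: matrix_transpose_mul transpose_partial_id matrix_vector_mul_assoc)
  define \<theta>' where "\<theta>' k = \<theta> + \<epsilon>s k *\<^sub>R (partial_id I *v w)" for k
  have eq: "Vs k *v \<theta>' k = \<xi>" for k
  proof -
    have q: "qs k $ i = (if i \<in> I then 1 else 0)" if "i \<notin> E" for i
    proof -
      have "I = {i. \<bar>ys k $ i\<bar> < 1}" "E = {i. \<bar>ys k $ i\<bar> = 1}" using pat(2)[of k] by (auto simp: pattern_def)
      then show ?thesis using pat(1)[of k] that by (auto simp: huber_weights_def)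
    qed
    have IE: "i \<notin> I" if "i \<in> E" for i using pat(2)[of k] that by (auto simp: pattern_def)
    \<comment> \<open>Outside \<open>E\<close> the weights are the indicator of \<open>I\<close>. On
      \<open>E\<close> they are unknown, but there the vector they multiply is 0.\<close>
    have "diag_mat (qs k) *v (A *v \<xi> - \<theta>' k) = partial_id I *v (A *v \<xi> - \<theta>) - \<epsilon>s k *\<^sub>R (partial_id I *v w)"
    proof (subst vec_eq_iff, intro allI)
      fix i
      show "(diag_mat (qs k) *v (A *v \<xi> - \<theta>' k)) $ i = (partial_id I *v (A *v \<xi> - \<theta>) - \<epsilon>s k *\<^sub>R (partial_id I *v w)) $ i"
        using L(3)[of i] IE[of i] q[of i]
        by (cases "i \<in> E") (auto simp: diag_mat_vector partial_id_vector \<theta>'_def)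
    qed
    then have s: "transpose A *v (diag_mat (qs k) *v (A *v \<xi> - \<theta>' k)) + \<epsilon>s k *\<^sub>R \<xi> = 0"
      by (simp add: matrix_vector_mult_diff_distrib[of "transpose A" "partial_id I *v _"] L(2) matrix_vector_mult_scaleR w')
    have r: "transpose A *v (diag_mat (qs k) *v (A *v (Vs k *v \<theta>' k) - \<theta>' k)) + \<epsilon>s k *\<^sub>R (Vs k *v \<theta>' k) = 0"
      using V(1) by (simp add: resolvent_jacobian_vector)
    have "transpose A *v (diag_mat (qs k) *v (A *v (Vs k *v \<theta>' k - \<xi>) - 0)) + \<epsilon>s k *\<^sub>R (Vs k *v \<theta>' k - \<xi>)
        = (transpose A *v (diag_mat (qs k) *v (A *v (Vs k *v \<theta>' k) - \<theta>' k)) + \<epsilon>s k *\<^sub>R (Vs k *v \<theta>' k))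
        - (transpose A *v (diag_mat (qs k) *v (A *v \<xi> - \<theta>' k)) + \<epsilon>s k *\<^sub>R \<xi>)"
      by (simp add: matrix_vector_mult_diff_distrib scaleR_diff_right)
    also have "\<dots> = 0" unfolding r s by simp
    finally have "norm (Vs k *v \<theta>' k - \<xi>) \<le> chi_number A * norm (0 :: real^'m)"
      by (rule regularized_least_squares_bound[OF huber_weights_nonneg[OF pat(1)] V(2)])
    then show ?thesis by simp
  qed
  have "(\<lambda>k. Vs k *v \<theta>' k) \<longlonglongrightarrow> V *v (\<theta> + 0 *\<^sub>R (partial_id I *v w))"
    unfolding \<theta>'_def matrix_vector_mult_def
    by (intro tendsto_vec_lambda tendsto_sum tendsto_mult tendsto_vec_nth tendsto_add tendsto_scaleR V tendsto_const)
  then show ?thesis by (simp add: eq LIMSEQ_const_iff)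
qed

lemma clip_vec_pattern:
  assumes "pattern y = (I, E, P)" shows "clip_vec y = partial_id I *v y + saturation I P"
  using assms by (auto simp: pattern_def clip_vec_def saturation_def vec_eq_iff partial_id_vector clip_def max_def min_def)

lemma limit_cell_of_regularized:
  fixes A :: "real^'n^'m"
  assumes lim: "\<epsilon>s \<longlonglongrightarrow> 0" "\<theta>s \<longlonglongrightarrow> \<theta>" "xs \<longlonglongrightarrow> x" and pos: "\<And>k::nat. 0 < \<epsilon>s k"
    and opt: "\<And>k. regularized_gradient A (\<epsilon>s k) (\<theta>s k) (xs k) = 0"
    and pat: "\<And>k. pattern (A *v xs k - \<theta>s k) = (I, E, P)"
  shows "(\<theta>, x) \<in> limit_cell A (I, E, P)"
proof -
  have opt': "transpose A *v (partial_id I *v (A *v xs k - \<theta>s k)) + transpose A *v saturation I P + \<epsilon>s k *\<^sub>R xs k = 0" for k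
    using opt[of k] unfolding regularized_gradient_def clip_vec_pattern[OF pat]
    by (simp add: matrix_vector_right_distrib)
  have lim_res: "(\<lambda>k. A *v xs k - \<theta>s k) \<longlonglongrightarrow> A *v x - \<theta>"
    by (intro tendsto_diff bounded_linear.tendsto[OF matrix_vector_mul_bounded_linear] lim)
  have "(\<lambda>k. transpose A *v (partial_id I *v (A *v xs k - \<theta>s k)) + transpose A *v saturation I P + \<epsilon>s k *\<^sub>R xs k)
      \<longlonglongrightarrow> transpose A *v (partial_id I *v (A *v x - \<theta>)) + transpose A *v saturation I P + 0 *\<^sub>R x"
    by (intro tendsto_add tendsto_scaleR bounded_linear.tendsto[OF matrix_vector_mul_bounded_linear] lim_res lim tendsto_const)
  then have 1: "transpose A *v (partial_id I *v (A *v x - \<theta>)) + transpose A *v saturation I P = 0"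
    unfolding opt' by (simp add: LIMSEQ_const_iff)
  have 2: "n \<bullet> x = 0" if n: "partial_id I *v (A *v n) = 0" for n
  proof -
    have orth: "n \<bullet> (transpose A *v (partial_id I *v y)) = 0" for y
      using n inner_matrix_vector_transpose[of "partial_id I" "A *v n" y]
      by (simp add: inner_matrix_vector_transpose[symmetric] transpose_partial_id)
    have "n \<bullet> (transpose A *v (partial_id I *v (A *v xs k - \<theta>s k)) + transpose A *v saturation I P + \<epsilon>s k *\<^sub>R xs k) = 0" for k
      unfolding opt' by simp
    \<comment> \<open>Tested with \<open>n\<close>, the condition loses its term from
      \<open>I\<close>. The limit equation \<open>1\<close> shows that the saturation term vanishes
      as well, and division by \<open>\<epsilon>s k\<close> leaves
      \<open>n \<bullet> xs k = 0\<close>.\<close>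
    then have e: "n \<bullet> (transpose A *v saturation I P) + \<epsilon>s k * (n \<bullet> xs k) = 0" for k
      unfolding inner_add_right orth by simp
    have "n \<bullet> (transpose A *v saturation I P) = 0"
      using arg_cong[OF 1, of "\<lambda>z. n \<bullet> z"] unfolding inner_add_right orth by simp
    then have "n \<bullet> xs k = 0" for k using e[of k] pos[of k] by simp
    moreover have "(\<lambda>k. n \<bullet> xs k) \<longlonglongrightarrow> n \<bullet> x" by (intro tendsto_intros lim)
    ultimately show ?thesis by (simp add: LIMSEQ_const_iff)
  qed
  have 3: "(A *v x - \<theta>) $ i = saturation {} P $ i" if i: "i \<in> E" for i
  proof -
    have "(A *v xs k - \<theta>s k) $ i = saturation {} P $ i" for k
    proof -
      have "E = {i. \<bar>(A *v xs k - \<theta>s k) $ i\<bar> = 1}" "P = {i. 1 \<le> (A *v xs k - \<theta>s k) $ i}"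
        using pat[of k] by (auto simp: pattern_def)
      then show ?thesis using i by (auto simp: saturation_def abs_if split: if_splits)
    qed
    then show ?thesis using tendsto_vec_nth[OF lim_res, of i] by (simp add: LIMSEQ_const_iff)
  qed
  show ?thesis using 1 2 3 by (auto simp: limit_cell_def)
qed

text \<open>There are finitely many patterns, so one of them occurs along a subsequence. The cell
  containing the limit point and the directions that determine \<open>V\<close> belong to the same
  pattern, which the curve argument relies on.\<close>

lemma J_min_huber_pattern:
  fixes A :: "real^'n^'m"
  assumes V: "V \<in> J_min (huber_objective A) UNIV \<epsilon>max (huber_JF A) \<theta>"
  obtains p where "(\<theta>, x_min (huber_objective A) \<theta>) \<in> limit_cell A p"
    "\<And>\<theta>' \<xi>. (\<theta>', \<xi>) \<in> limit_directions A p \<Longrightarrow> V *v \<theta>' = \<xi>"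
proof -
  obtain \<theta>s \<epsilon>s Vs where s: "\<theta>s \<longlonglongrightarrow> \<theta>" "\<And>k::nat. 0 < \<epsilon>s k" "\<epsilon>s \<longlonglongrightarrow> 0"
    "\<And>k. Vs k \<in> J_reg (huber_objective A) (huber_JF A) (\<epsilon>s k) (\<theta>s k)" "Vs \<longlonglongrightarrow> V"
    "(\<lambda>k. x_reg (huber_objective A) (\<epsilon>s k) (\<theta>s k)) \<longlonglongrightarrow> x_min (huber_objective A) \<theta>"
    using V unfolding J_min_def by blast
  let ?x = "\<lambda>k. x_reg (huber_objective A) (\<epsilon>s k) (\<theta>s k)"
  obtain qs where q: "\<And>k. huber_weights (qs k) (A *v ?x k - \<theta>s k)" "\<And>k. resolvent_jacobian A (\<epsilon>s k) (qs k) (Vs k)"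
    using s(4) unfolding J_reg_huber[OF s(2)] by (simp add: choice_iff) metis
  obtain k0 where k0: "infinite {k\<in>UNIV. pattern (A *v ?x k - \<theta>s k) = pattern (A *v ?x k0 - \<theta>s k0)}"
    using pigeonhole_infinite[of "UNIV :: nat set" "\<lambda>k. pattern (A *v ?x k - \<theta>s k)"] by auto
  obtain I E P where "pattern (A *v ?x k0 - \<theta>s k0) = (I, E, P)" by (metis prod_cases3)
  with k0 have "infinite {k. pattern (A *v ?x k - \<theta>s k) = (I, E, P)}" by simp
  then obtain r where r: "strict_mono (r :: nat \<Rightarrow> nat)" "\<And>k. pattern (A *v ?x (r k) - \<theta>s (r k)) = (I, E, P)"
    using infinite_enumerate by (metis (mono_tags, lifting) mem_Collect_eq)
  show thesis
  proof (rule that[of "(I, E, P)"])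
    show "(\<theta>, x_min (huber_objective A) \<theta>) \<in> limit_cell A (I, E, P)"
      by (rule limit_cell_of_regularized[OF LIMSEQ_subseq_LIMSEQ[OF s(3) r(1), unfolded o_def]
            LIMSEQ_subseq_LIMSEQ[OF s(1) r(1), unfolded o_def] LIMSEQ_subseq_LIMSEQ[OF s(6) r(1), unfolded o_def]
            s(2) x_reg_gradient[OF s(2)] r(2)])
    show "V *v \<theta>' = \<xi>" if "(\<theta>', \<xi>) \<in> limit_directions A (I, E, P)" for \<theta>' \<xi>
      by (rule resolvent_jacobian_on_limit_directions[OF q(2) s(2) LIMSEQ_subseq_LIMSEQ[OF s(3) r(1), unfolded o_def]
            LIMSEQ_subseq_LIMSEQ[OF s(5) r(1), unfolded o_def] q(1) r(2) that])
  qed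
qed

text \<open>Every defining condition of the cell fixes the value of an affine function. Along the
  accumulating times it is constant, so its linear part vanishes at the velocity.\<close>

lemma limit_cell_tangent:
  fixes \<theta> :: "real \<Rightarrow> real^'m" and x :: "real \<Rightarrow> real^'n" and A :: "real^'n^'m"
  assumes d: "(\<theta> has_vector_derivative v) (at t)" "(x has_vector_derivative w) (at t)"
    and T: "t islimpt {s. (\<theta> s, x s) \<in> limit_cell A p}" "(\<theta> t, x t) \<in> limit_cell A p"
  shows "(v, w) \<in> limit_directions A p"
proof -
  obtain I E P where p: "p = (I, E, P)" by (cases p)
  have C: "\<And>n. partial_id I *v (A *v n) = 0 \<Longrightarrow> n \<bullet> x s = 0"
      "transpose A *v (partial_id I *v (A *v x s - \<theta> s)) = - (transpose A *v saturation I P)"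
      "\<And>i. i \<in> E \<Longrightarrow> (A *v x s - \<theta> s) $ i = saturation {} P $ i" if "(\<theta> s, x s) \<in> limit_cell A p" for s
    using that unfolding limit_cell_def p by (auto simp: add_eq_0_iff2)
  have res: "((\<lambda>s. A *v x s - \<theta> s) has_vector_derivative (A *v w - v)) (at t)"
    by (intro has_vector_derivative_diff bounded_linear.has_vector_derivative[OF matrix_vector_mul_bounded_linear] d)
  have "n \<bullet> w = 0" if n: "partial_id I *v (A *v n) = 0" for n
    by (rule has_vector_derivative_zero_at_limpt[OF bounded_linear.has_vector_derivative[OF bounded_linear_inner_right d(2)] T(1)])
      (use C(1)[OF _ n] T(2) in simp)
  moreover have "transpose A *v (partial_id I *v (A *v w - v)) = 0"
    by (rule has_vector_derivative_zero_at_limpt[OF bounded_linear.has_vector_derivative[OF matrix_vector_mul_bounded_linear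
            bounded_linear.has_vector_derivative[OF matrix_vector_mul_bounded_linear res]] T(1)])
      (use C(2) T(2) in simp)
  moreover have "(A *v w - v) $ i = 0" if i: "i \<in> E" for i
    by (rule has_vector_derivative_zero_at_limpt[OF bounded_linear.has_vector_derivative[OF bounded_linear_vec_nth res] T(1)])
      (use C(3)[OF _ i] T(2) in simp)
  ultimately show ?thesis by (simp add: limit_directions_def p)
qed

lemma conservative_J_min_huber:
  fixes A :: "real^'n^'m"
  assumes "0 < \<epsilon>max"
  shows "conservative_jacobian UNIV (x_min (huber_objective A)) (J_min (huber_objective A) UNIV \<epsilon>max (huber_JF A))"
  unfolding conservative_jacobian_def
proof (intro conjI ballI allI impI)
  let ?J = "J_min (huber_objective A) UNIV \<epsilon>max (huber_JF A)" and ?x = "x_min (huber_objective A)"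
  show "locally_lipschitz_on UNIV ?x"
    by (rule locally_lipschitz_onI[OF x_min_lipschitz chi_number_nonneg])
  show "?J \<theta> \<noteq> {}" for \<theta> by (rule J_min_huber_nonempty[OF assms])
  show "\<exists>r>0. bounded (\<Union>y\<in>UNIV \<inter> ball \<theta> r. ?J y)" for \<theta>
    unfolding bounded_iff
    by (intro exI[of _ 1] conjI exI[of _ "real CARD('n) * (real CARD('m) * chi_number A) + 1"] ballI)
      (use J_min_huber_bounded[OF assms] in auto)
  show "closedin (top_of_set (UNIV \<times> UNIV)) (multi_graph_on UNIV ?J)"
    using J_min_huber_closed[OF assms, of A] by (simp flip: closed_closedin)
  fix c :: "real \<Rightarrow> real^'m"
  assume c: "abs_continuous_on 0 1 c \<and> c ` {0..1} \<subseteq> UNIV"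
  have ac: "abs_continuous_on 0 1 (\<lambda>t. ?x (c t))"
    by (rule abs_continuous_on_lipschitz_compose[OF conjunct1[OF c] x_min_lipschitz])
  obtain N1 where N1: "negligible N1" "\<And>t. t \<in> {0<..<1} - N1 \<Longrightarrow> \<exists>v. (c has_vector_derivative v) (at t)"
    using abs_continuous_on_differentiable c by blast
  obtain N2 where N2: "negligible N2" "\<And>t. t \<in> {0<..<1} - N2 \<Longrightarrow> \<exists>v. ((\<lambda>t. ?x (c t)) has_vector_derivative v) (at t)"
    using abs_continuous_on_differentiable[OF ac] by blast
  define T where "T p = {t. (c t, ?x (c t)) \<in> limit_cell A p}" for p
  \<comment> \<open>Only finitely many patterns exist, each with countably many isolated times, so
    this set is null and chosen before any element of the Jacobian.\<close>
  define M where "M = N1 \<union> N2 \<union> (\<Union>p\<in>UNIV. {t\<in>T p. \<not> t islimpt T p})"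
  have "negligible M"
    unfolding M_def
    by (intro negligible_Un N1 N2 negligible_Union finite_imageI) (simp, erule imageE, simp only: negligible_isolated_points)
  then show "AE t in lebesgue_on {0..1}. \<exists>v. (c has_vector_derivative v) (at t within {0..1}) \<and>
      (\<forall>V\<in>?J (c t). ((\<lambda>s. ?x (c s)) has_vector_derivative V *v v) (at t within {0..1}))"
  proof (rule AE_unit_interval)
    fix t assume t: "t \<in> {0<..<1} - M"
    then have "t \<in> {0<..<1} - N1" "t \<in> {0<..<1} - N2" by (simp_all add: M_def)
    then obtain v w where v: "(c has_vector_derivative v) (at t)" and w: "((\<lambda>t. ?x (c t)) has_vector_derivative w) (at t)"
      using N1(2) N2(2) by blast
    \<comment> \<open>The pattern depends on \<open>V\<close>, but the velocity
      \<open>(v, w)\<close> is a limit direction for each pattern whose cell contains the current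
      point, so every \<open>V\<close> sends \<open>v\<close> to \<open>w\<close>.\<close>
    have "V *v v = w" if V: "V \<in> ?J (c t)" for V
    proof -
      obtain p where p: "(c t, ?x (c t)) \<in> limit_cell A p"
        "\<And>\<theta>' \<xi>. (\<theta>', \<xi>) \<in> limit_directions A p \<Longrightarrow> V *v \<theta>' = \<xi>"
        using J_min_huber_pattern[OF V] by blast
      have "t islimpt T p" using t p(1) unfolding M_def T_def by blast
      then show ?thesis using limit_cell_tangent[OF v w _ p(1)] p(2) unfolding T_def by blast
    qed
    then show "\<exists>v. (c has_vector_derivative v) (at t within {0..1}) \<and>
      (\<forall>V\<in>?J (c t). ((\<lambda>s. ?x (c s)) has_vector_derivative V *v v) (at t within {0..1}))"
      using has_vector_derivative_at_within[OF v] has_vector_derivative_at_within[OF w] by (intro exI[of _ v]) auto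
  qed
qed simp

section \<open>Definability of the Huber objects\<close>

context o_minimal_expansion
begin

section \<open>Vector and matrix terms\<close>

lemma definable_map_componentwise:
  "(\<And>b. b \<in> Basis \<Longrightarrow> definable_map (\<lambda>x. f x \<bullet> b)) \<Longrightarrow> definable_map f"
  by (simp add: definable_map_def)

lemma definable_map_inner_Basis: "definable_map f \<Longrightarrow> b \<in> Basis \<Longrightarrow> definable_map (\<lambda>x. f x \<bullet> b)"
  by (simp add: definable_map_def)

lemma definable_map_linear:
  fixes L :: "'b::euclidean_space \<Rightarrow> 'c::euclidean_space"
  assumes L: "linear L" and f: "definable_map f"
  shows "definable_map (\<lambda>x. L (f x))"
proof (rule definable_map_componentwise)
  fix b :: 'c
  assume "b \<in> Basis"
  have "L y \<bullet> b = (\<Sum>c\<in>Basis. (y \<bullet> c) * (L c \<bullet> b))" for y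
    by (subst euclidean_representation[of y, symmetric]) (simp add: linear_sum[OF L] linear_scale[OF L] inner_sum_left)
  then have eq: "(\<lambda>x. L (f x) \<bullet> b) = (\<lambda>x. \<Sum>c\<in>Basis. (f x \<bullet> c) * (L c \<bullet> b))" by (rule ext)
  show "definable_map (\<lambda>x. L (f x) \<bullet> b)"
    by (subst eq) (intro definable_map_sum definable_map_mult definable_map_const definable_map_inner_Basis f)
qed

lemma definable_map_plus:
  "definable_map f \<Longrightarrow> definable_map g \<Longrightarrow> definable_map (\<lambda>x. f x + g x)"
  by (rule definable_map_componentwise) (simp only: inner_add_left definable_map_add definable_map_inner_Basis)

lemma definable_map_vector_diff:
  "definable_map f \<Longrightarrow> definable_map g \<Longrightarrow> definable_map (\<lambda>x. f x - g x)"
  by (rule definable_map_componentwise) (simp only: inner_diff_left definable_map_diff definable_map_inner_Basis)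

lemma definable_map_scaleR:
  "definable_map f \<Longrightarrow> definable_map g \<Longrightarrow> definable_map (\<lambda>x. f x *\<^sub>R g x)"
  by (rule definable_map_componentwise) (simp only: inner_scaleR_left definable_map_mult definable_map_inner_Basis)

lemma definable_map_matrix_vector:
  assumes "definable_map f" "definable_map g" shows "definable_map (\<lambda>x. (f x :: real^'n^'m) *v g x)"
  unfolding matrix_vector_mult_def
  by (intro definable_map_vec definable_map_sum definable_map_mult definable_map_nth assms)

lemma definable_map_diag_mat_vector:
  assumes "definable_map f" "definable_map g" shows "definable_map (\<lambda>x. diag_mat (f x :: real^'m) *v g x)"
proof -
  have "diag_mat q *v y = (\<chi> i. q $ i * y $ i)" for q y :: "real^'m" by (simp add: vec_eq_iff diag_mat_vector)
  then show ?thesis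
    by (simp only:) (intro definable_map_vec definable_map_mult definable_map_nth assms)
qed

text \<open>The square root is eliminated: the norm is the only nonnegative number whose square is
  the sum of the squared coordinates.\<close>

lemma definable_map_norm:
  fixes f :: "'a::euclidean_space \<Rightarrow> 'b::euclidean_space"
  assumes f: "definable_map f" shows "definable_map (\<lambda>x. norm (f x))"
proof -
  have eq: "u = norm y \<longleftrightarrow> 0 \<le> u \<and> u * u = (\<Sum>b\<in>Basis. (y \<bullet> b) * (y \<bullet> b))" for u and y :: 'b
  proof -
    have "(\<Sum>b\<in>Basis. (y \<bullet> b) * (y \<bullet> b)) = norm y * norm y"
      by (simp add: euclidean_inner[symmetric] power2_norm_eq_inner[symmetric] power2_eq_square)
    then show ?thesis by (auto simp: power2_eq_square[symmetric] power2_eq_iff_nonneg)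
  qed
  show ?thesis
    unfolding definable_map_real eq
    by (intro definable_conj definable_le definable_eq definable_map_sum definable_map_mult definable_map_const
        definable_map_snd definable_map_id definable_map_inner_Basis definable_map_comp_fst f)
qed

lemma definable_map_clip:
  assumes f: "definable_map f" shows "definable_map (\<lambda>x. clip (f x))"
proof -
  have "clip t = (if 1 \<le> t then 1 else if t \<le> -1 then -1 else t)" for t by (auto simp: clip_def)
  then show ?thesis
    by (simp only:) (intro definable_map_if definable_le definable_map_const f)
qed

lemma definable_map_clip_vec:
  assumes "definable_map f" shows "definable_map (\<lambda>x. clip_vec (f x))"
  unfolding clip_vec_def by (intro definable_map_vec definable_map_clip definable_map_nth assms)

lemmas definable_vector_intros = definable_conj definable_disj definable_imp definable_all_finite
  definable_ex definable_all definable_eq definable_less definable_le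
  definable_map_id definable_map_fst definable_map_snd definable_map_const
  definable_map_plus definable_map_vector_diff definable_map_scaleR definable_map_matrix_vector
  definable_map_diag_mat_vector definable_map_norm definable_map_clip_vec definable_map_nth

section \<open>First-order descriptions of the Huber objects\<close>

lemma definable_huber_weights:
  assumes "definable_map f" "definable_map g" shows "definable S {x. huber_weights (f x) (g x)}"
proof -
  have "huber_weights q y \<longleftrightarrow> (\<forall>i. (0 \<le> q $ i \<and> q $ i \<le> 1) \<and>
      ((-1 < y $ i \<and> y $ i < 1) \<longrightarrow> q $ i = 1) \<and> ((1 < y $ i \<or> y $ i < -1) \<longrightarrow> q $ i = 0))" for q y :: "real^'b"
    unfolding huber_weights_def by (intro iff_allI) (auto simp: abs_if)
  then show ?thesis
    by (simp only:) (intro definable_vector_intros assms)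
qed

lemma definable_huber_objective:
  fixes A :: "real^'n^'m"
  shows "definability_assumption S (huber_objective A) UNIV"
proof -
  have "definable_map (\<lambda>p. huber_objective A (fst p) (snd p))"
    unfolding huber_objective_def huber_loss_def huber_eq power2_eq_square divide_inverse
    by (intro definable_map_sum definable_map_diff definable_map_mult definable_map_clip definable_vector_intros)
  then have "definable S {p. snd p = huber_objective A (fst (fst p)) (snd (fst p))}" by (simp add: definable_map_real)
  moreover have "graph_on (UNIV \<times> UNIV) (\<lambda>(x, \<theta>). huber_objective A x \<theta>)
      = {p. snd p = huber_objective A (fst (fst p)) (snd (fst p))}"
    by (auto simp: graph_on_def)
  ultimately show ?thesis by (simp add: definability_assumption_def definable_UNIV)
qed

lemma definable_huber_JF:
  fixes A :: "real^'n^'m"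
  shows "definable S (multi_graph_on UNIV (huber_JF A))"
proof -
  have "definable S {p. \<exists>q. huber_weights q (residual A (fst p)) \<and> snd p = JF_matrix A q}"
    by (intro definable_vector_intros definable_huber_weights
        definable_map_linear[OF bounded_linear.linear[OF bounded_linear_residual]]
        definable_map_linear[OF linear_JF_matrix])
  moreover have "multi_graph_on UNIV (huber_JF A) = {p. \<exists>q. huber_weights q (residual A (fst p)) \<and> snd p = JF_matrix A q}"
    by (auto simp: multi_graph_on_def huber_JF_eq)
  ultimately show ?thesis by simp
qed

text \<open>In the approximation form, the regularized solution is described as a zero of the
  regularized gradient and the Jacobian by its linear system. What remains is polynomial apart from
  norms, truncations and order.\<close>

lemma definable_J_min_huber:
  fixes A :: "real^'n^'m"
  assumes "0 < \<epsilon>max"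
  shows "definable S (multi_graph_on UNIV (J_min (huber_objective A) UNIV \<epsilon>max (huber_JF A)))"
proof -
  \<comment> \<open>The zero of the regularized gradient is unique for positive
    \<open>\<epsilon>\<close>, so an existential quantifier may replace
    \<open>x_reg\<close>.\<close>
  have x: "huber_weights q (A *v x_reg (huber_objective A) \<epsilon> \<theta> - \<theta>) \<longleftrightarrow>
      (\<exists>x. regularized_gradient A \<epsilon> \<theta> x = 0 \<and> huber_weights q (A *v x - \<theta>))" if "0 < \<epsilon>" for q \<epsilon> \<theta>
    using x_reg_gradient[OF that] x_reg_unique[OF that] by blast
  have "multi_graph_on UNIV (J_min (huber_objective A) UNIV \<epsilon>max (huber_JF A)) =
    {p. \<forall>\<delta>::real. 0 < \<delta> \<longrightarrow> (\<exists>\<theta>' (\<epsilon>::real) V' q. norm (\<theta>' - fst p) < \<delta> \<and> 0 < \<epsilon> \<and> \<epsilon> < \<delta> \<and> \<epsilon> \<le> \<epsilon>max \<and> norm (V' - snd p) < \<delta> \<and>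
       (\<exists>x. transpose A *v clip_vec (A *v x - \<theta>') + \<epsilon> *\<^sub>R x = 0 \<and> huber_weights q (A *v x - \<theta>')) \<and>
       (\<forall>w. transpose A *v (diag_mat q *v (A *v (V' *v w) - w)) + \<epsilon> *\<^sub>R (V' *v w) = 0))}"
    unfolding multi_graph_on_def J_min_huber_iff[OF assms] resolvent_jacobian_vector[symmetric]
      regularized_gradient_def[symmetric]
    by (auto simp: x cong: conj_cong)
  moreover have "definable S \<dots>"
    by (intro definable_vector_intros definable_huber_weights)
  ultimately show ?thesis by simp
qed

end

theorem corollary15:
  fixes S :: "nat \<Rightarrow> real list set set"
    and A :: "real^'n^'m"
    and \<epsilon>max :: real
  assumes "o_minimal_expansion_of_real_field S"
    and "\<epsilon>max > 0"
  shows "regularity_assumption (huber_objective A) UNIV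
    \<and> definability_assumption S (huber_objective A) UNIV
    \<and> uniform_range_condition S (huber_objective A) UNIV \<epsilon>max (huber_JF A)
    \<and> (\<forall>\<theta> \<epsilon> Q. 0 < \<epsilon> \<and> \<epsilon> \<le> \<epsilon>max \<and>
          Q \<in> huber_hessians (A *v x_reg (huber_objective A) \<epsilon> \<theta> - \<theta>) \<longrightarrow>
          - (transpose A ** Q) = (transpose A ** Q ** A) ** huber_range_factor A Q \<and>
          op_norm (huber_range_factor A Q) \<le> chi_number A)
    \<and> path_differentiable_on UNIV (x_min (huber_objective A))
    \<and> definable_conservative_jacobian S UNIV (x_min (huber_objective A))
        (J_min (huber_objective A) UNIV \<epsilon>max (huber_JF A))"
proof -
  interpret o_minimal_expansion S by unfold_locales (rule assms(1))
  have range: "- (transpose A ** Q) = (transpose A ** Q ** A) ** huber_range_factor A Q \<and>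
      op_norm (huber_range_factor A Q) \<le> chi_number A" if "Q \<in> huber_hessians y" for Q y
    using that huber_range_factor_eq[of _ A] op_norm_huber_range_factor[of _ A] huber_weights_nonneg
    unfolding huber_hessians_eq by blast
  have psd: "sym_psd (transpose A ** diag_mat q ** A)" if "\<And>i. 0 \<le> q $ i" for q
  proof -
    have "transpose (transpose A ** diag_mat q ** A) = transpose A ** diag_mat q ** A"
      by (simp add: matrix_transpose_mul transpose_transpose transpose_diag_mat matrix_mul_assoc)
    moreover have "v \<bullet> ((transpose A ** diag_mat q ** A) *v v) = (A *v v) \<bullet> (diag_mat q *v (A *v v))" for v
      by (simp add: inner_matrix_vector_transpose matrix_vector_mul_assoc[symmetric])
    ultimately show ?thesis using sym_psd_diag_mat[of q] that by (simp add: sym_psd_def)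
  qed
  have "uniform_range_condition S (huber_objective A) UNIV \<epsilon>max (huber_JF A)"
    unfolding uniform_range_condition_def
  proof (intro conjI allI impI)
    show "definable_conservative_jacobian S {z. right_vec z \<in> UNIV} (partial_gradient (huber_objective A)) (huber_JF A)"
      unfolding definable_conservative_jacobian_def using conservative_huber_JF[of A] definable_huber_JF[of A] by simp
    fix K :: "(real^'m) set"
    show "\<exists>c>0. \<forall>\<theta>\<in>K. \<forall>\<epsilon> H M. 0 < \<epsilon> \<and> \<epsilon> \<le> \<epsilon>max \<and>
        hcat H M \<in> huber_JF A (join_vec (x_reg (huber_objective A) \<epsilon> \<theta>) \<theta>) \<longrightarrow>
        sym_psd H \<and> (\<exists>W. M = H ** W \<and> op_norm W \<le> c)"
    \<comment> \<open>The range condition asks for a positive constant, whereas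
      \<open>chi_number A\<close> is 0 for \<open>A = 0\<close>. The same constant serves every
      compact set.\<close>
    proof (intro exI[of _ "chi_number A + 1"] conjI ballI allI impI, goal_cases)
      case 1
      show ?case using chi_number_nonneg[of A] by linarith
    next
      case (2 \<theta> \<epsilon> H M)
      then obtain q where "huber_weights q (residual A (join_vec (x_reg (huber_objective A) \<epsilon> \<theta>) \<theta>))"
        "H = transpose A ** diag_mat q ** A"
        by (auto simp: huber_JF_eq JF_matrix_def hcat_eq_iff)
      then show ?case using psd[of q] by (simp add: huber_weights_nonneg)
    next
      case (3 \<theta> \<epsilon> H M)
      then obtain q where q: "huber_weights q (residual A (join_vec (x_reg (huber_objective A) \<epsilon> \<theta>) \<theta>))"
        "H = transpose A ** diag_mat q ** A" "M = - (transpose A ** diag_mat q)"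
        by (auto simp: huber_JF_eq JF_matrix_def hcat_eq_iff)
      then have "diag_mat q \<in> huber_hessians (residual A (join_vec (x_reg (huber_objective A) \<epsilon> \<theta>) \<theta>))"
        by (auto simp: huber_hessians_eq)
      from range[OF this] show ?case
        unfolding q(2,3) by (intro exI[of _ "huber_range_factor A (diag_mat q)"]) auto
    qed
  qed
  moreover have "conservative_jacobian UNIV (x_min (huber_objective A)) (J_min (huber_objective A) UNIV \<epsilon>max (huber_JF A))"
    by (rule conservative_J_min_huber[OF assms(2)])
  ultimately show ?thesis
    unfolding path_differentiable_on_def definable_conservative_jacobian_def
    using huber_regularity[of A] definable_huber_objective[of A] definable_J_min_huber[OF assms(2), of A] range by blast
qed

end
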